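(* Let $(M,\omega,\nabla)$ be a Fedosov manifold of dimension $2n$, with curvature tensor $R$ and symplectic Weyl tensor $W$. If $\nabla W=0$, then either $\nabla R=0$ (that is, $(M,\omega,\nabla)$ is locally symmetric) or $W=0$ identically on $M$ (that is, $(M,\omega,\nabla)$ is Weyl-flat).
   Context: A Fedosov manifold is a triple $(M,\omega,\nabla)$ where $(M,\omega)$ is a connected (smooth, real) symplectic manifold and $\nabla$ is a torsionfree affine connection on $M$ with $\nabla\omega=0$. Write $\dim M=2n$. The fully covariant curvature tensor is $R(X,Y,Z,S)=\omega(R(X,Y)Z,S)$, where $R(X,Y)Z=\nabla_X\nabla_YZ-\nabla_Y\nabla_XZ-\nabla_{[X,Y]}Z$. It satisfies $R(Y,X,Z,S)=-R(X,Y,Z,S)$, $R(X,Y,S,Z)=R(X,Y,Z,S)$, and $R(X,Y,Z,S)+R(Y,Z,X,S)+R(Z,X,Y,S)=0$. The Ricci tensor is the symmetric tensor ${\rm Ric}(Y,Z)=-{\rm tr}_\omega\big((X,S)\mapsto R(X,Y,Z,S)\big)$, where ${\rm tr}_\omega(B)=\omega^{ij}B_{ij}$ and $[\omega^{ij}]$ is the inverse matrix of $[\omega_{ij}]$, with $\omega^{ij}\omega_{jk}=\delta^i_k$; equivalently, ${\rm Ric}(Y,Z)={\rm tr}(X\mapsto R(X,Y)Z)$. For a $2$-form $F$ and a symmetric $2$-tensor $G$, the symplectic Kulkarni--Nomizu product $F\star G$ is the $4$-tensor $$(F\star G)(x,y,z,w)=G(y,z)F(x,w)-G(x,z)F(y,w)+F(x,z)G(y,w)-F(y,z)G(x,w)+2F(x,y)G(z,w).$$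 The symplectic Weyl tensor is $$W=R-\frac{1}{2(n+1)}\,\omega\star{\rm Ric}.$$ *)

theory Defs
  imports "HOL-Analysis.Analysis"
begin

section \<open>Smooth maps between open subsets of normed spaces\<close>

text \<open>Intended for open \<open>S\<close> in a finite-dimensional space, where continuity of all
  directional derivatives is continuity of the derivative.\<close>

primrec Ck_on :: "nat \<Rightarrow> 'a::real_normed_vector set \<Rightarrow> ('a \<Rightarrow> 'b::real_normed_vector) \<Rightarrow> bool"
  where
    "Ck_on 0 S f \<longleftrightarrow> continuous_on S f"
  | "Ck_on (Suc k) S f \<longleftrightarrow> (\<forall>x\<in>S. f differentiable (at x)) \<and>
       (\<forall>v. Ck_on k S (\<lambda>x. frechet_derivative f (at x) v))"

definition smooth_on :: "'a::real_normed_vector set \<Rightarrow> ('a \<Rightarrow> 'b::real_normed_vector) \<Rightarrow> bool"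
  where "smooth_on S f \<longleftrightarrow> (\<forall>k. Ck_on k S f)"

section \<open>Smooth manifolds\<close>

text \<open>The manifold is the whole type \<open>'m\<close>. A chart is a pair of a domain and a coordinate
  map; the values of the coordinate map outside the domain are irrelevant.\<close>

type_synonym ('m, 'd) chart = "'m set \<times> ('m \<Rightarrow> real ^ 'd)"

abbreviation cdom :: "('m, 'd) chart \<Rightarrow> 'm set"
  where "cdom c \<equiv> fst c"

abbreviation cmap :: "('m, 'd) chart \<Rightarrow> 'm \<Rightarrow> real ^ 'd"
  where "cmap c \<equiv> snd c"

abbreviation cinv :: "('m, 'd) chart \<Rightarrow> real ^ 'd \<Rightarrow> 'm"
  where "cinv c \<equiv> inv_into (fst c) (snd c)"

definition is_chart :: "('m::topological_space, 'd::finite) chart \<Rightarrow> bool"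
  where "is_chart c \<longleftrightarrow> open (cdom c) \<and> open (cmap c ` cdom c) \<and>
    homeomorphism (cdom c) (cmap c ` cdom c) (cmap c) (cinv c)"

definition smooth_atlas :: "('m::topological_space, 'd::finite) chart set \<Rightarrow> bool"
  where "smooth_atlas A \<longleftrightarrow> (\<forall>c\<in>A. is_chart c) \<and> (\<Union>c\<in>A. cdom c) = UNIV \<and>
    (\<forall>c\<in>A. \<forall>d\<in>A. smooth_on (cmap c ` (cdom c \<inter> cdom d)) (\<lambda>x. cmap d (cinv c x)))"

definition smooth_fun :: "('m, 'd::finite) chart set \<Rightarrow> ('m \<Rightarrow> real) \<Rightarrow> bool"
  where "smooth_fun A f \<longleftrightarrow> (\<forall>c\<in>A. smooth_on (cmap c ` cdom c) (\<lambda>x. f (cinv c x)))"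

section \<open>Tangent vectors and vector fields\<close>

text \<open>A preferred chart is chosen at each point \<open>p\<close>, and the tangent space at \<open>p\<close>
  is identified with \<open>real ^ 'd\<close> through it: a tangent vector is given by its components in the
  preferred chart, and its components in any other chart at \<open>p\<close> are obtained from the derivative
  of the transition map. A vector field is then a function \<open>'m \<Rightarrow> real ^ 'd\<close>. It need not
  be continuous as such a function in order to be smooth as a vector field.\<close>

definition chart_at :: "('m, 'd) chart set \<Rightarrow> 'm \<Rightarrow> ('m, 'd) chart"
  where "chart_at A p = (SOME c. c \<in> A \<and> p \<in> cdom c)"

definition tangent_coord ::
    "('m, 'd::finite) chart set \<Rightarrow> ('m, 'd) chart \<Rightarrow> 'm \<Rightarrow> real ^ 'd \<Rightarrow> real ^ 'd"
  where "tangent_coord A c p v =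
    (let k = chart_at A p in frechet_derivative (\<lambda>x. cmap c (cinv k x)) (at (cmap k p)) v)"

definition vf_coord ::
    "('m, 'd::finite) chart set \<Rightarrow> ('m, 'd) chart \<Rightarrow> ('m \<Rightarrow> real ^ 'd) \<Rightarrow> real ^ 'd \<Rightarrow> real ^ 'd"
  where "vf_coord A c X x = tangent_coord A c (cinv c x) (X (cinv c x))"

definition smooth_vf :: "('m, 'd::finite) chart set \<Rightarrow> ('m \<Rightarrow> real ^ 'd) \<Rightarrow> bool"
  where "smooth_vf A X \<longleftrightarrow> (\<forall>c\<in>A. smooth_on (cmap c ` cdom c) (vf_coord A c X))"

text \<open>The action \<open>X f\<close> of a vector field on a function.\<close>

definition vf_deriv ::
    "('m, 'd::finite) chart set \<Rightarrow> ('m \<Rightarrow> real ^ 'd) \<Rightarrow> ('m \<Rightarrow> real) \<Rightarrow> 'm \<Rightarrow> real"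
  where "vf_deriv A X f p =
    (let k = chart_at A p in frechet_derivative (\<lambda>x. f (cinv k x)) (at (cmap k p)) (X p))"

definition lie_bracket ::
    "('m, 'd::finite) chart set \<Rightarrow> ('m \<Rightarrow> real ^ 'd) \<Rightarrow> ('m \<Rightarrow> real ^ 'd) \<Rightarrow> 'm \<Rightarrow> real ^ 'd"
  where "lie_bracket A X Y p =
    (let k = chart_at A p; x = cmap k p in
       frechet_derivative (vf_coord A k Y) (at x) (X p)
     - frechet_derivative (vf_coord A k X) (at x) (Y p))"

section \<open>Symplectic forms\<close>

text \<open>The closedness condition is \<open>d\<omega>(X, Y, Z) = 0\<close>, by the invariant formula for
  the exterior derivative.\<close>

definition symplectic_form ::
    "('m, 'd::finite) chart set \<Rightarrow> ('m \<Rightarrow> real ^ 'd \<Rightarrow> real ^ 'd \<Rightarrow> real) \<Rightarrow> bool"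
  where "symplectic_form A \<omega> \<longleftrightarrow>
    (\<forall>p. bilinear (\<omega> p)) \<and>
    (\<forall>p u v. \<omega> p u v = - \<omega> p v u) \<and>
    (\<forall>p u. (\<forall>v. \<omega> p u v = 0) \<longrightarrow> u = 0) \<and>
    (\<forall>X Y. smooth_vf A X \<longrightarrow> smooth_vf A Y \<longrightarrow> smooth_fun A (\<lambda>p. \<omega> p (X p) (Y p))) \<and>
    (\<forall>X Y Z. smooth_vf A X \<longrightarrow> smooth_vf A Y \<longrightarrow> smooth_vf A Z \<longrightarrow>
      (\<forall>p. vf_deriv A X (\<lambda>q. \<omega> q (Y q) (Z q)) p
         - vf_deriv A Y (\<lambda>q. \<omega> q (X q) (Z q)) p
         + vf_deriv A Z (\<lambda>q. \<omega> q (X q) (Y q)) p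
         - \<omega> p (lie_bracket A X Y p) (Z p)
         + \<omega> p (lie_bracket A X Z p) (Y p)
         - \<omega> p (lie_bracket A Y Z p) (X p) = 0))"

section \<open>Affine connections\<close>

text \<open>A connection is an operator on smooth vector fields; its values on other functions
  \<open>'m \<Rightarrow> real ^ 'd\<close> are irrelevant.\<close>

definition affine_connection ::
    "('m, 'd::finite) chart set \<Rightarrow>
     (('m \<Rightarrow> real ^ 'd) \<Rightarrow> ('m \<Rightarrow> real ^ 'd) \<Rightarrow> ('m \<Rightarrow> real ^ 'd)) \<Rightarrow> bool"
  where "affine_connection A nabla \<longleftrightarrow>
    (\<forall>X Y. smooth_vf A X \<longrightarrow> smooth_vf A Y \<longrightarrow> smooth_vf A (nabla X Y)) \<and>
    (\<forall>X X' Y. smooth_vf A X \<longrightarrow> smooth_vf A X' \<longrightarrow> smooth_vf A Y \<longrightarrow>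
      (\<forall>p. nabla (\<lambda>q. X q + X' q) Y p = nabla X Y p + nabla X' Y p)) \<and>
    (\<forall>X Y Y'. smooth_vf A X \<longrightarrow> smooth_vf A Y \<longrightarrow> smooth_vf A Y' \<longrightarrow>
      (\<forall>p. nabla X (\<lambda>q. Y q + Y' q) p = nabla X Y p + nabla X Y' p)) \<and>
    (\<forall>f X Y. smooth_fun A f \<longrightarrow> smooth_vf A X \<longrightarrow> smooth_vf A Y \<longrightarrow>
      (\<forall>p. nabla (\<lambda>q. f q *\<^sub>R X q) Y p = f p *\<^sub>R nabla X Y p)) \<and>
    (\<forall>f X Y. smooth_fun A f \<longrightarrow> smooth_vf A X \<longrightarrow> smooth_vf A Y \<longrightarrow>
      (\<forall>p. nabla X (\<lambda>q. f q *\<^sub>R Y q) p = vf_deriv A X f p *\<^sub>R Y p + f p *\<^sub>R nabla X Y p))"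

definition torsion_free ::
    "('m, 'd::finite) chart set \<Rightarrow>
     (('m \<Rightarrow> real ^ 'd) \<Rightarrow> ('m \<Rightarrow> real ^ 'd) \<Rightarrow> ('m \<Rightarrow> real ^ 'd)) \<Rightarrow> bool"
  where "torsion_free A nabla \<longleftrightarrow> (\<forall>X Y. smooth_vf A X \<longrightarrow> smooth_vf A Y \<longrightarrow>
    (\<forall>p. nabla X Y p - nabla Y X p = lie_bracket A X Y p))"

text \<open>\<open>nabla T = 0\<close> for a covariant 2-tensor field and for a covariant 4-tensor field.\<close>

definition parallel2 ::
    "('m, 'd::finite) chart set \<Rightarrow>
     (('m \<Rightarrow> real ^ 'd) \<Rightarrow> ('m \<Rightarrow> real ^ 'd) \<Rightarrow> ('m \<Rightarrow> real ^ 'd)) \<Rightarrow>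
     ('m \<Rightarrow> real ^ 'd \<Rightarrow> real ^ 'd \<Rightarrow> real) \<Rightarrow> bool"
  where "parallel2 A nabla T \<longleftrightarrow>
    (\<forall>V X Y. smooth_vf A V \<longrightarrow> smooth_vf A X \<longrightarrow> smooth_vf A Y \<longrightarrow>
      (\<forall>p. vf_deriv A V (\<lambda>q. T q (X q) (Y q)) p
         - T p (nabla V X p) (Y p) - T p (X p) (nabla V Y p) = 0))"

definition parallel4 ::
    "('m, 'd::finite) chart set \<Rightarrow>
     (('m \<Rightarrow> real ^ 'd) \<Rightarrow> ('m \<Rightarrow> real ^ 'd) \<Rightarrow> ('m \<Rightarrow> real ^ 'd)) \<Rightarrow>
     ('m \<Rightarrow> real ^ 'd \<Rightarrow> real ^ 'd \<Rightarrow> real ^ 'd \<Rightarrow> real ^ 'd \<Rightarrow> real) \<Rightarrow> bool"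
  where "parallel4 A nabla T \<longleftrightarrow>
    (\<forall>V X Y Z S. smooth_vf A V \<longrightarrow> smooth_vf A X \<longrightarrow> smooth_vf A Y \<longrightarrow> smooth_vf A Z \<longrightarrow>
      smooth_vf A S \<longrightarrow>
      (\<forall>p. vf_deriv A V (\<lambda>q. T q (X q) (Y q) (Z q) (S q)) p
         - T p (nabla V X p) (Y p) (Z p) (S p) - T p (X p) (nabla V Y p) (Z p) (S p)
         - T p (X p) (Y p) (nabla V Z p) (S p) - T p (X p) (Y p) (Z p) (nabla V S p) = 0))"

definition fedosov_manifold ::
    "('m::{t2_space, second_countable_topology}, 'd::finite) chart set \<Rightarrow>
     ('m \<Rightarrow> real ^ 'd \<Rightarrow> real ^ 'd \<Rightarrow> real) \<Rightarrow>
     (('m \<Rightarrow> real ^ 'd) \<Rightarrow> ('m \<Rightarrow> real ^ 'd) \<Rightarrow> ('m \<Rightarrow> real ^ 'd)) \<Rightarrow> bool"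
  where "fedosov_manifold A \<omega> nabla \<longleftrightarrow>
    connected (UNIV :: 'm set) \<and> smooth_atlas A \<and> symplectic_form A \<omega> \<and>
    affine_connection A nabla \<and> torsion_free A nabla \<and> parallel2 A nabla \<omega>"

section \<open>Curvature\<close>

definition curvature_vf ::
    "('m, 'd::finite) chart set \<Rightarrow>
     (('m \<Rightarrow> real ^ 'd) \<Rightarrow> ('m \<Rightarrow> real ^ 'd) \<Rightarrow> ('m \<Rightarrow> real ^ 'd)) \<Rightarrow>
     ('m \<Rightarrow> real ^ 'd) \<Rightarrow> ('m \<Rightarrow> real ^ 'd) \<Rightarrow> ('m \<Rightarrow> real ^ 'd) \<Rightarrow> 'm \<Rightarrow> real ^ 'd"
  where "curvature_vf A nabla X Y Z p =
    nabla X (nabla Y Z) p - nabla Y (nabla X Z) p - nabla (lie_bracket A X Y) Z p"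

text \<open>Values of the curvature on tangent vectors at \<open>p\<close> are taken through an arbitrary
  extension of the vectors to smooth vector fields; by tensoriality they do not depend on the choice.\<close>

definition vf_ext :: "('m, 'd::finite) chart set \<Rightarrow> 'm \<Rightarrow> real ^ 'd \<Rightarrow> 'm \<Rightarrow> real ^ 'd"
  where "vf_ext A p v = (SOME X. smooth_vf A X \<and> X p = v)"

definition curvature_tensor ::
    "('m, 'd::finite) chart set \<Rightarrow> ('m \<Rightarrow> real ^ 'd \<Rightarrow> real ^ 'd \<Rightarrow> real) \<Rightarrow>
     (('m \<Rightarrow> real ^ 'd) \<Rightarrow> ('m \<Rightarrow> real ^ 'd) \<Rightarrow> ('m \<Rightarrow> real ^ 'd)) \<Rightarrow>
     'm \<Rightarrow> real ^ 'd \<Rightarrow> real ^ 'd \<Rightarrow> real ^ 'd \<Rightarrow> real ^ 'd \<Rightarrow> real"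
  where "curvature_tensor A \<omega> nabla p x y z s =
    \<omega> p (curvature_vf A nabla (vf_ext A p x) (vf_ext A p y) (vf_ext A p z) p) s"

definition symplectic_trace ::
    "(real ^ 'd::finite \<Rightarrow> real ^ 'd \<Rightarrow> real) \<Rightarrow> (real ^ 'd \<Rightarrow> real ^ 'd \<Rightarrow> real) \<Rightarrow> real"
  where "symplectic_trace w B =
    (\<Sum>i\<in>UNIV. \<Sum>j\<in>UNIV.
       matrix_inv (\<chi> i j. w (axis i 1) (axis j 1)) $ i $ j * B (axis i 1) (axis j 1))"

definition ricci_tensor ::
    "('m, 'd::finite) chart set \<Rightarrow> ('m \<Rightarrow> real ^ 'd \<Rightarrow> real ^ 'd \<Rightarrow> real) \<Rightarrow>
     (('m \<Rightarrow> real ^ 'd) \<Rightarrow> ('m \<Rightarrow> real ^ 'd) \<Rightarrow> ('m \<Rightarrow> real ^ 'd)) \<Rightarrow>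
     'm \<Rightarrow> real ^ 'd \<Rightarrow> real ^ 'd \<Rightarrow> real"
  where "ricci_tensor A \<omega> nabla p y z =
    - symplectic_trace (\<omega> p) (\<lambda>x s. curvature_tensor A \<omega> nabla p x y z s)"

definition kulkarni_nomizu ::
    "('v \<Rightarrow> 'v \<Rightarrow> real) \<Rightarrow> ('v \<Rightarrow> 'v \<Rightarrow> real) \<Rightarrow> 'v \<Rightarrow> 'v \<Rightarrow> 'v \<Rightarrow> 'v \<Rightarrow> real"
  where "kulkarni_nomizu F G x y z w =
    G y z * F x w - G x z * F y w + F x z * G y w - F y z * G x w + 2 * F x y * G z w"

text \<open>The parameter \<open>n\<close> is half the dimension.\<close>

definition weyl_tensor ::
    "nat \<Rightarrow> ('m, 'd::finite) chart set \<Rightarrow> ('m \<Rightarrow> real ^ 'd \<Rightarrow> real ^ 'd \<Rightarrow> real) \<Rightarrow>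
     (('m \<Rightarrow> real ^ 'd) \<Rightarrow> ('m \<Rightarrow> real ^ 'd) \<Rightarrow> ('m \<Rightarrow> real ^ 'd)) \<Rightarrow>
     'm \<Rightarrow> real ^ 'd \<Rightarrow> real ^ 'd \<Rightarrow> real ^ 'd \<Rightarrow> real ^ 'd \<Rightarrow> real"
  where "weyl_tensor n A \<omega> nabla p x y z s =
    curvature_tensor A \<omega> nabla p x y z s
    - 1 / (2 * (real n + 1)) * kulkarni_nomizu (\<omega> p) (ricci_tensor A \<omega> nabla p) x y z s"

end

theory Submission
  imports Defs
begin

text \<open>
  Write \<open>T = \<nabla>Ric\<close> and \<open>c = 1 / (2 (n + 1))\<close>. If \<open>\<nabla>W = 0\<close>, then \<open>\<nabla>\<^sub>V R = c \<omega> \<star> T\<^sub>V\<close>, and for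
  \<open>n \<ge> 2\<close> the second Bianchi identity forces
  \<open>2 T(V; Y, Z) = \<omega>(V, Y) \<omega>(U, Z) + \<omega>(V, Z) \<omega>(U, Y)\<close> for some vector \<open>U\<close> at each point.
  On the other hand \<open>\<nabla>W = 0\<close> gives \<open>R(X, Y) \<cdot> W = 0\<close>, and differentiating once more
  \<open>(\<nabla>\<^sub>V R)(X, Y) \<cdot> W = 0\<close>. If \<open>U \<noteq> 0\<close>, the endomorphisms \<open>(\<nabla>\<^sub>V R)(X, Y)\<close> generate the whole
  symplectic Lie algebra, and a tensor with the symmetries of \<open>W\<close> that is annihilated by it
  vanishes. Hence at each point \<open>T = 0\<close> or \<open>W = 0\<close>. Since \<open>W\<close> is parallel and the manifold is
  connected, \<open>W\<close> vanishes everywhere as soon as it vanishes at one point; otherwise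
  \<open>\<nabla>Ric = 0\<close> and so \<open>\<nabla>R = 0\<close>. For \<open>n = 1\<close> the tensor \<open>W\<close> is zero for algebraic reasons.
\<close>

section \<open>Smooth maps\<close>

text \<open>By the Bianchi identity \<open>T\<close> is built from one vector \<open>U\<close>, so
  the endomorphism dual to the product of \<omega> with \<open>T\<^sub>V\<close> is a combination of
  operators \<open>N U x\<close>, \<open>N V x\<close>, \<open>N V U\<close>, where
  \<open>N a b\<close> is the symplectic Lie algebra element attached to the symmetric product of
  \<open>a\<close> and \<open>b\<close>. Suitable arguments eliminate every \<open>N a b\<close>
  with one factor orthogonal to \<open>U\<close>; the missing direction is a commutator. This needs
  a symplectic pair orthogonal to \<open>U\<close> and its partner, hence dimension at least 4. Such
  a pair also forces T(z; z, z) = 0. The analytic obstacle is that the connection acts on global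
  smooth fields only, while tangent vectors are stored in a preferred chart that may jump from point
  to point. Local frames are therefore made global by cutoffs, tensors start as operators on global
  fields and descend to vectors by linearity over functions, and smoothness is checked in one fixed
  chart near each point. Zeros of \<open>W\<close> spread without parallel transport: along
  coordinate rays the frame components of \<open>W\<close> solve a linear system with bounded
  coefficients, and Gronwall's inequality applies.\<close>

lemma Ck_on_cong:
  assumes "open S" "\<And>x. x \<in> S \<Longrightarrow> f x = g x" "Ck_on k S f"
  shows "Ck_on k S g"
  using assms
proof (induction k arbitrary: f g)
  case 0
  then show ?case by (simp cong: continuous_on_cong)
next
  case (Suc k)
  have d: "(g has_derivative frechet_derivative f (at x)) (at x)" if "x \<in> S" for x
    using has_derivative_transform_within_open[of f _ x UNIV S g] Suc.prems that
    by (auto simp: frechet_derivative_works)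
  then have e: "frechet_derivative f (at x) = frechet_derivative g (at x)" if "x \<in> S" for x
    using frechet_derivative_at that by metis
  have "Ck_on k S (\<lambda>x. frechet_derivative g (at x) v)" for v
    by (rule Suc.IH[OF Suc.prems(1), of "\<lambda>x. frechet_derivative f (at x) v"])
      (use e Suc.prems in auto)
  then show ?case
    using d by (auto simp: differentiable_def)
qed

lemma Ck_on_subset: "T \<subseteq> S \<Longrightarrow> Ck_on k S f \<Longrightarrow> Ck_on k T f"
  by (induction k arbitrary: f) (auto intro: continuous_on_subset)

lemma Ck_on_Suc_D: "Ck_on (Suc k) S f \<Longrightarrow> Ck_on k S f"
proof (induction k arbitrary: f)
  case 0
  then show ?case
    by (auto intro!: continuous_at_imp_continuous_on differentiable_imp_continuous_within)
next
  case (Suc k)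
  then show ?case by (simp only: Ck_on.simps) blast
qed

lemma Ck_on_local:
  assumes "\<And>x. x \<in> S \<Longrightarrow> \<exists>T. open T \<and> x \<in> T \<and> Ck_on k T f"
  shows "Ck_on k S f"
  using assms
proof (induction k arbitrary: f)
  case 0
  then show ?case
    by (auto intro!: continuous_at_imp_continuous_on simp: continuous_on_eq_continuous_at)
       (metis continuous_on_eq_continuous_at)
next
  case (Suc k)
  show ?case
    unfolding Ck_on.simps
  proof (intro conjI ballI allI)
    show "f differentiable (at x)" if "x \<in> S" for x
      using Suc.prems[OF that] by auto
    show "Ck_on k S (\<lambda>x. frechet_derivative f (at x) v)" for v
      by (rule Suc.IH) (use Suc.prems in fastforce)
  qed
qed

lemma Ck_on_const: "Ck_on k S (\<lambda>x. c)"
  by (induction k arbitrary: c) auto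

lemma Ck_on_bounded_linear_comp:
  assumes L: "bounded_linear L" and "open S" "Ck_on k S f"
  shows "Ck_on k S (\<lambda>x. L (f x))"
  using assms
proof (induction k arbitrary: f)
  case 0
  then show ?case by (simp add: bounded_linear.continuous_on)
next
  case (Suc k)
  have d: "((\<lambda>x. L (f x)) has_derivative (\<lambda>v. L (frechet_derivative f (at x) v))) (at x)" if "x \<in> S" for x
    using Suc.prems that by (intro bounded_linear.has_derivative[OF L]) (auto simp: frechet_derivative_works)
  have "Ck_on k S (\<lambda>x. frechet_derivative (\<lambda>x. L (f x)) (at x) v)" for v
    by (rule Ck_on_cong[OF Suc.prems(2), of "\<lambda>x. L (frechet_derivative f (at x) v)"])
      (use Suc in \<open>auto simp: frechet_derivative_at[OF d, symmetric]\<close>)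
  then show ?case
    using d by (auto simp: differentiable_def)
qed

lemma Ck_on_add:
  assumes "open S" "Ck_on k S f" "Ck_on k S g"
  shows "Ck_on k S (\<lambda>x. f x + g x)"
  using assms
proof (induction k arbitrary: f g)
  case 0
  then show ?case by (auto intro: continuous_on_add)
next
  case (Suc k)
  have d: "((\<lambda>x. f x + g x) has_derivative
      (\<lambda>v. frechet_derivative f (at x) v + frechet_derivative g (at x) v)) (at x)" if "x \<in> S" for x
    using Suc.prems that by (intro has_derivative_add) (auto simp: frechet_derivative_works)
  have "Ck_on k S (\<lambda>x. frechet_derivative (\<lambda>x. f x + g x) (at x) v)" for v
    by (rule Ck_on_cong[OF Suc.prems(1), of "\<lambda>x. frechet_derivative f (at x) v + frechet_derivative g (at x) v"])
      (use Suc in \<open>auto simp: frechet_derivative_at[OF d, symmetric]\<close>)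
  then show ?case
    using d by (auto simp: differentiable_def)
qed

text \<open>The product rule gives two terms of the same shape. In each only one factor is
  differentiated, and \<open>Ck_on_Suc_D\<close> lowers the order of the other, so an induction
  hypothesis general in \<open>f\<close> and \<open>g\<close> covers both.\<close>

lemma Ck_on_bilinear:
  assumes B: "bounded_bilinear B" and "open S" "Ck_on k S f" "Ck_on k S g"
  shows "Ck_on k S (\<lambda>x. B (f x) (g x))"
  using assms
proof (induction k arbitrary: f g)
  case 0
  then show ?case by (auto intro: bounded_bilinear.continuous_on)
next
  case (Suc k)
  have d: "((\<lambda>x. B (f x) (g x)) has_derivative
      (\<lambda>v. B (f x) (frechet_derivative g (at x) v) + B (frechet_derivative f (at x) v) (g x))) (at x)"
    if "x \<in> S" for x
    using Suc.prems that by (intro bounded_bilinear.FDERIV[OF B]) (auto simp: frechet_derivative_works)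
  have "Ck_on k S (\<lambda>x. frechet_derivative (\<lambda>x. B (f x) (g x)) (at x) v)" for v
  proof (rule Ck_on_cong[OF Suc.prems(2)])
    show "Ck_on k S (\<lambda>x. B (f x) (frechet_derivative g (at x) v) + B (frechet_derivative f (at x) v) (g x))"
      using Suc.prems Ck_on_Suc_D[OF Suc.prems(3)] Ck_on_Suc_D[OF Suc.prems(4)]
      by (intro Ck_on_add[OF Suc.prems(2)] Suc.IH[OF Suc.prems(1,2)]) simp_all
  qed (auto simp: frechet_derivative_at[OF d, symmetric])
  then show ?case
    using d by (auto simp: differentiable_def)
qed

lemma Ck_on_sum:
  assumes "open S" "\<And>i. i \<in> I \<Longrightarrow> Ck_on k S (f i)"
  shows "Ck_on k S (\<lambda>x. \<Sum>i\<in>I. f i x)"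
  using assms(2)
  by (induction I rule: infinite_finite_induct) (auto intro!: Ck_on_const Ck_on_add assms(1))

lemma linear_euclidean_expand:
  fixes L :: "'a::euclidean_space \<Rightarrow> 'b::real_vector"
  assumes "linear L"
  shows "L v = (\<Sum>b\<in>Basis. (v \<bullet> b) *\<^sub>R L b)"
  by (subst euclidean_representation[of v, symmetric])
    (simp add: linear_sum[OF assms] linear_scale[OF assms] del: euclidean_representation)

text \<open>\<open>Ck_on\<close> controls derivatives in constant directions, whereas the chain rule
  differentiates \<open>f\<close> in a moving direction. Expanding that direction over
  \<open>Basis\<close> reduces to constant ones, hence the Euclidean domain of
  \<open>f\<close>.\<close>

lemma Ck_on_compose:
  fixes f :: "'b::euclidean_space \<Rightarrow> 'c::real_normed_vector" and g :: "'a::real_normed_vector \<Rightarrow> 'b"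
  assumes "open S" "g ` S \<subseteq> T" "Ck_on k S g" "Ck_on k T f"
  shows "Ck_on k S (\<lambda>x. f (g x))"
  using assms
proof (induction k arbitrary: f)
  case 0
  then show ?case by (auto intro: continuous_on_compose2)
next
  case (Suc k)
  have df: "f differentiable (at (g x))" if "x \<in> S" for x
    using Suc.prems that by auto
  have d: "((\<lambda>x. f (g x)) has_derivative
      (\<lambda>v. frechet_derivative f (at (g x)) (frechet_derivative g (at x) v))) (at x)" if "x \<in> S" for x
    using Suc.prems that df[OF that]
    by (intro has_derivative_compose[where f=g and g=f]) (simp_all add: frechet_derivative_works)
  have "Ck_on k S (\<lambda>x. frechet_derivative (\<lambda>x. f (g x)) (at x) v)" for v
  proof (rule Ck_on_cong[OF Suc.prems(1)])
    show "Ck_on k S (\<lambda>x. \<Sum>b\<in>Basis. (frechet_derivative g (at x) v \<bullet> b) *\<^sub>R frechet_derivative f (at (g x)) b)"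
      using Suc.prems Ck_on_Suc_D[OF Suc.prems(3)]
      by (intro Ck_on_sum Ck_on_bilinear[OF bounded_bilinear_scaleR]
            Ck_on_bilinear[OF bounded_bilinear_inner] Ck_on_const Suc.IH) auto
  qed (simp add: frechet_derivative_at[OF d, symmetric]
        linear_euclidean_expand[OF linear_frechet_derivative[OF df], symmetric])
  then show ?case
    using d by (auto simp: differentiable_def)
qed

text \<open>The derivative is a product of \<open>inverse (f x)\<close> with a derivative of
  \<open>f\<close>, so the induction closes with the product rule alone.\<close>

lemma Ck_on_inverse:
  fixes f :: "'a::real_normed_vector \<Rightarrow> real"
  assumes "open S" "\<And>x. x \<in> S \<Longrightarrow> f x \<noteq> 0" "Ck_on k S f"
  shows "Ck_on k S (\<lambda>x. inverse (f x))"
  using assms(3)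
proof (induction k)
  case 0
  then show ?case using assms(2) by (auto intro: continuous_on_inverse)
next
  case (Suc k)
  have d: "((\<lambda>x. inverse (f x)) has_derivative
      (\<lambda>v. - (inverse (f x) * frechet_derivative f (at x) v * inverse (f x)))) (at x)" if "x \<in> S" for x
    using Suc.prems that
    by (intro Deriv.has_derivative_inverse[where f=f, OF assms(2)[OF that]])
      (simp add: frechet_derivative_works)
  have "Ck_on k S (\<lambda>x. frechet_derivative (\<lambda>x. inverse (f x)) (at x) v)" for v
  proof (rule Ck_on_cong[OF assms(1)])
    show "Ck_on k S (\<lambda>x. - (inverse (f x) * frechet_derivative f (at x) v * inverse (f x)))"
      using Suc Ck_on_Suc_D[OF Suc.prems]
      by (intro Ck_on_bounded_linear_comp[OF bounded_linear_minus[OF bounded_linear_ident]]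
          Ck_on_bilinear[OF bounded_bilinear_mult] assms(1)) auto
  qed (auto simp: frechet_derivative_at[OF d, symmetric])
  then show ?case
    using d by (auto simp: differentiable_def)
qed

section \<open>Infinitely differentiable maps\<close>

lemma smooth_on_imp_Ck_on: "smooth_on S f \<Longrightarrow> Ck_on k S f"
  by (simp add: smooth_on_def)

lemma smooth_on_continuous_on: "smooth_on S f \<Longrightarrow> continuous_on S f"
  using smooth_on_imp_Ck_on[of S f 0] by simp

lemma smooth_on_differentiable: "smooth_on S f \<Longrightarrow> x \<in> S \<Longrightarrow> f differentiable (at x)"
  using smooth_on_imp_Ck_on[of S f "Suc 0"] by simp

lemma smooth_on_has_derivative:
  "smooth_on S f \<Longrightarrow> x \<in> S \<Longrightarrow> (f has_derivative frechet_derivative f (at x)) (at x)"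
  using smooth_on_differentiable frechet_derivative_works by blast

lemma smooth_on_cong:
  "open S \<Longrightarrow> (\<And>x. x \<in> S \<Longrightarrow> f x = g x) \<Longrightarrow> smooth_on S f \<Longrightarrow> smooth_on S g"
  unfolding smooth_on_def using Ck_on_cong by blast

lemma smooth_on_subset: "smooth_on S f \<Longrightarrow> T \<subseteq> S \<Longrightarrow> smooth_on T f"
  unfolding smooth_on_def using Ck_on_subset by blast

lemma smooth_on_local:
  "(\<And>x. x \<in> S \<Longrightarrow> \<exists>T. open T \<and> x \<in> T \<and> smooth_on T f) \<Longrightarrow> smooth_on S f"
  unfolding smooth_on_def using Ck_on_local by metis

lemma smooth_on_const [simp]: "smooth_on S (\<lambda>x. c)"
  by (simp add: smooth_on_def Ck_on_const)

lemma smooth_on_linear_comp: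
  "bounded_linear L \<Longrightarrow> open S \<Longrightarrow> smooth_on S f \<Longrightarrow> smooth_on S (\<lambda>x. L (f x))"
  unfolding smooth_on_def using Ck_on_bounded_linear_comp by blast

lemma smooth_on_ident: "smooth_on S (\<lambda>x. x)"
proof -
  have "Ck_on k S (\<lambda>x. x)" for k
    by (cases k) (auto simp: Ck_on_const)
  then show ?thesis by (simp add: smooth_on_def)
qed

lemma smooth_on_add:
  "open S \<Longrightarrow> smooth_on S f \<Longrightarrow> smooth_on S g \<Longrightarrow> smooth_on S (\<lambda>x. f x + g x)"
  unfolding smooth_on_def using Ck_on_add by blast

lemma smooth_on_minus: "open S \<Longrightarrow> smooth_on S f \<Longrightarrow> smooth_on S (\<lambda>x. - f x)"
  by (rule smooth_on_linear_comp[OF bounded_linear_minus[OF bounded_linear_ident]])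

lemma smooth_on_diff:
  "open S \<Longrightarrow> smooth_on S f \<Longrightarrow> smooth_on S g \<Longrightarrow> smooth_on S (\<lambda>x. f x - g x)"
  using smooth_on_add[of S f "\<lambda>x. - g x"] smooth_on_minus by auto

lemma smooth_on_sum:
  "open S \<Longrightarrow> (\<And>i. i \<in> I \<Longrightarrow> smooth_on S (f i)) \<Longrightarrow> smooth_on S (\<lambda>x. \<Sum>i\<in>I. f i x)"
  unfolding smooth_on_def using Ck_on_sum by metis

lemma smooth_on_bilinear:
  "bounded_bilinear B \<Longrightarrow> open S \<Longrightarrow> smooth_on S f \<Longrightarrow> smooth_on S g \<Longrightarrow> smooth_on S (\<lambda>x. B (f x) (g x))"
  unfolding smooth_on_def using Ck_on_bilinear by blast

lemmas smooth_on_mult = smooth_on_bilinear[OF bounded_bilinear_mult]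
lemmas smooth_on_scaleR = smooth_on_bilinear[OF bounded_bilinear_scaleR]
lemmas smooth_on_inner = smooth_on_bilinear[OF bounded_bilinear_inner]

lemma smooth_on_compose:
  fixes f :: "'b::euclidean_space \<Rightarrow> 'c::real_normed_vector"
  shows "open S \<Longrightarrow> g ` S \<subseteq> T \<Longrightarrow> smooth_on S g \<Longrightarrow> smooth_on T f \<Longrightarrow> smooth_on S (\<lambda>x. f (g x))"
  unfolding smooth_on_def using Ck_on_compose by blast

lemma smooth_on_inverse:
  fixes f :: "'a::real_normed_vector \<Rightarrow> real"
  shows "open S \<Longrightarrow> (\<And>x. x \<in> S \<Longrightarrow> f x \<noteq> 0) \<Longrightarrow> smooth_on S f \<Longrightarrow> smooth_on S (\<lambda>x. inverse (f x))"
  unfolding smooth_on_def using Ck_on_inverse by blast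

lemma smooth_on_nth: "open S \<Longrightarrow> smooth_on S f \<Longrightarrow> smooth_on S (\<lambda>x. f x $ i)"
  by (rule smooth_on_linear_comp[OF bounded_linear_vec_nth])

lemma smooth_on_frechet_derivative_const:
  assumes "smooth_on S f"
  shows "smooth_on S (\<lambda>x. frechet_derivative f (at x) v)"
  unfolding smooth_on_def
proof
  fix k show "Ck_on k S (\<lambda>x. frechet_derivative f (at x) v)"
    using smooth_on_imp_Ck_on[OF assms, of "Suc k"] by simp
qed

lemma smooth_on_frechet_derivative:
  fixes f :: "'a::euclidean_space \<Rightarrow> 'b::real_normed_vector"
  assumes "open S" "smooth_on S f" "smooth_on S V"
  shows "smooth_on S (\<lambda>x. frechet_derivative f (at x) (V x))"
proof (rule smooth_on_cong[OF assms(1)])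
  show "smooth_on S (\<lambda>x. \<Sum>b\<in>Basis. (V x \<bullet> b) *\<^sub>R frechet_derivative f (at x) b)"
    using assms
    by (intro smooth_on_sum smooth_on_scaleR smooth_on_inner smooth_on_const smooth_on_frechet_derivative_const)
qed (metis linear_euclidean_expand linear_frechet_derivative smooth_on_differentiable[OF assms(2)])

subsection \<open>Symmetry of second derivatives\<close>

text \<open>The mean value theorem is used twice: in the direction \<open>u\<close> on the increment
  of \<open>f\<close> along \<open>s *\<^sub>R v\<close>, then in the direction \<open>v\<close> on
  the derivative of \<open>f\<close> along \<open>u\<close>.\<close>

lemma second_difference:
  fixes f :: "'a::real_normed_vector \<Rightarrow> real"
  assumes "Ck_on 2 (ball x r) f" "s > 0" "s * (norm u + norm v) < r"
  shows "\<exists>a b. 0 \<le> a \<and> a \<le> s \<and> 0 \<le> b \<and> b \<le> s \<and>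
    f (x + s *\<^sub>R u + s *\<^sub>R v) - f (x + s *\<^sub>R u) - f (x + s *\<^sub>R v) + f x =
    s * s * frechet_derivative (\<lambda>y. frechet_derivative f (at y) u) (at (x + a *\<^sub>R u + b *\<^sub>R v)) v"
proof -
  have inb: "x + a *\<^sub>R u + b *\<^sub>R v \<in> ball x r" if "0 \<le> a" "a \<le> s" "0 \<le> b" "b \<le> s" for a b
  proof -
    have "norm (a *\<^sub>R u + b *\<^sub>R v) \<le> a * norm u + b * norm v"
      using that norm_triangle_ineq[of "a *\<^sub>R u" "b *\<^sub>R v"] by simp
    also have "\<dots> \<le> s * norm u + s * norm v"
      using that by (intro add_mono mult_right_mono) auto
    finally have "norm (a *\<^sub>R u + b *\<^sub>R v) < r"
      using assms(3) by (simp add: algebra_simps)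
    moreover have "dist x (x + a *\<^sub>R u + b *\<^sub>R v) = norm (a *\<^sub>R u + b *\<^sub>R v)"
      by (metis add.assoc add_diff_cancel_left' dist_commute dist_norm)
    ultimately show ?thesis by simp
  qed
  have df: "(f has_derivative frechet_derivative f (at y)) (at y)" if "y \<in> ball x r" for y
    using assms(1) that by (auto simp: numeral_2_eq_2 frechet_derivative_works)
  have ddf: "((\<lambda>y. frechet_derivative f (at y) u) has_derivative
     frechet_derivative (\<lambda>y. frechet_derivative f (at y) u) (at y)) (at y)" if "y \<in> ball x r" for y
    using assms(1) that by (auto simp: numeral_2_eq_2 frechet_derivative_works)
  let ?g = "\<lambda>t. f (x + t *\<^sub>R u + s *\<^sub>R v) - f (x + t *\<^sub>R u)"
  let ?g' = "\<lambda>t. frechet_derivative f (at (x + t *\<^sub>R u + s *\<^sub>R v)) u - frechet_derivative f (at (x + t *\<^sub>R u)) u"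
  have sc: "frechet_derivative f (at y) (h *\<^sub>R u) = h * frechet_derivative f (at y) u" if "y \<in> ball x r" for y h
    using linear_scale[OF has_derivative_linear[OF df[OF that]]] by simp
  have "(?g has_real_derivative ?g' t) (at t)" if "0 \<le> t" "t \<le> s" for t
  proof -
    have 1: "((\<lambda>t. f (x + t *\<^sub>R u + s *\<^sub>R v)) has_derivative
        (\<lambda>h. frechet_derivative f (at (x + t *\<^sub>R u + s *\<^sub>R v)) (h *\<^sub>R u))) (at t)"
      by (rule has_derivative_compose[OF _ df, of _ "\<lambda>h. h *\<^sub>R u"])
         (use inb[OF that, of s] assms in \<open>auto intro!: derivative_eq_intros\<close>)
    have 2: "((\<lambda>t. f (x + t *\<^sub>R u)) has_derivative
        (\<lambda>h. frechet_derivative f (at (x + t *\<^sub>R u)) (h *\<^sub>R u))) (at t)"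
      by (rule has_derivative_compose[OF _ df, of _ "\<lambda>h. h *\<^sub>R u"])
         (use inb[OF that, of 0] assms in \<open>auto intro!: derivative_eq_intros\<close>)
    show ?thesis
      unfolding has_field_derivative_def
      by (rule has_derivative_eq_rhs[OF has_derivative_diff[OF 1 2]])
        (use sc inb[OF that, of 0] inb[OF that, of s] assms in \<open>auto simp: fun_eq_iff algebra_simps\<close>)
  qed
  then obtain a where a: "0 < a" "a < s" "?g s - ?g 0 = s * ?g' a"
    using MVT2[of 0 s ?g ?g'] assms by auto
  let ?k = "\<lambda>t. frechet_derivative f (at (x + a *\<^sub>R u + t *\<^sub>R v)) u"
  let ?k' = "\<lambda>t. frechet_derivative (\<lambda>y. frechet_derivative f (at y) u) (at (x + a *\<^sub>R u + t *\<^sub>R v)) v"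
  have "(?k has_real_derivative ?k' t) (at t)" if "0 \<le> t" "t \<le> s" for t
  proof -
    have inb': "x + a *\<^sub>R u + t *\<^sub>R v \<in> ball x r"
      using inb that a by auto
    have 1: "(?k has_derivative
        (\<lambda>h. frechet_derivative (\<lambda>y. frechet_derivative f (at y) u) (at (x + a *\<^sub>R u + t *\<^sub>R v)) (h *\<^sub>R v))) (at t)"
      by (rule has_derivative_compose[OF _ ddf, of _ "\<lambda>h. h *\<^sub>R v"])
         (use inb' in \<open>auto intro!: derivative_eq_intros\<close>)
    show ?thesis
      unfolding has_field_derivative_def
      by (rule has_derivative_eq_rhs[OF 1])
        (simp add: fun_eq_iff linear_scale[OF has_derivative_linear[OF ddf[OF inb']]])
  qed
  then obtain b where b: "0 < b" "b < s" "?k s - ?k 0 = s * ?k' b"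
    using MVT2[of 0 s ?k ?k'] assms by auto
  show ?thesis
    by (rule exI[of _ a], rule exI[of _ b]) (use a b in auto)
qed

text \<open>The second difference is symmetric in \<open>u\<close> and \<open>v\<close>, so the two
  mixed derivatives take equal values at two points near \<open>x\<close>; continuity carries the
  equality to \<open>x\<close>.\<close>

lemma symmetric_second_derivative:
  fixes f :: "'a::real_normed_vector \<Rightarrow> real"
  assumes "open S" "x \<in> S" "smooth_on S f"
  shows "frechet_derivative (\<lambda>y. frechet_derivative f (at y) u) (at x) v =
    frechet_derivative (\<lambda>y. frechet_derivative f (at y) v) (at x) u"
proof (rule ccontr)
  let ?D = "\<lambda>u v y. frechet_derivative (\<lambda>y. frechet_derivative f (at y) u) (at y) v"
  \<comment> \<open>Half the gap: two numbers each closer than \<open>?e\<close> to the respective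
    value at \<open>x\<close> cannot coincide.\<close>
  let ?e = "\<bar>?D u v x - ?D v u x\<bar> / 2"
  assume "?D u v x \<noteq> ?D v u x"
  then have e: "?e > 0" by simp
  obtain r where r: "r > 0" "ball x r \<subseteq> S"
    using assms open_contains_ball by blast
  have c: "isCont (?D u v) x" for u v
    using smooth_on_imp_Ck_on[OF assms(3), of 2] assms by (simp add: numeral_2_eq_2 continuous_on_eq_continuous_at)
  obtain r1 where r1: "r1 > 0" "\<And>y. dist y x < r1 \<Longrightarrow> \<bar>?D u v y - ?D u v x\<bar> < ?e"
    using c[of u v] e unfolding continuous_at_eps_delta dist_real_def by blast
  obtain r2 where r2: "r2 > 0" "\<And>y. dist y x < r2 \<Longrightarrow> \<bar>?D v u y - ?D v u x\<bar> < ?e"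
    using c[of v u] e unfolding continuous_at_eps_delta dist_real_def by blast
  define m where "m = min r (min r1 r2)"
  \<comment> \<open>The summand 1 keeps the denominator positive and the inequality strict even for
    \<open>u = v = 0\<close>.\<close>
  define s where "s = m / (1 + norm u + norm v)"
  have m: "m > 0" using r r1 r2 by (simp add: m_def)
  have s: "s > 0" "s * (norm u + norm v) < m"
    using m by (auto simp: s_def field_simps add_pos_nonneg)
  have near: "dist (x + a *\<^sub>R u + b *\<^sub>R v) x < m" if "0 \<le> a" "a \<le> s" "0 \<le> b" "b \<le> s" for a b
  proof -
    have "norm (a *\<^sub>R u + b *\<^sub>R v) \<le> a * norm u + b * norm v"
      using that norm_triangle_ineq[of "a *\<^sub>R u" "b *\<^sub>R v"] by simp
    also have "\<dots> \<le> s * norm u + s * norm v"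
      using that by (intro add_mono mult_right_mono) auto
    finally show ?thesis using s by (simp add: dist_norm algebra_simps)
  qed
  have C2: "Ck_on 2 (ball x m) f"
    by (rule Ck_on_subset[OF _ smooth_on_imp_Ck_on[OF assms(3)]]) (use r m_def in auto)
  obtain a b where ab: "0 \<le> a" "a \<le> s" "0 \<le> b" "b \<le> s"
    "f (x + s *\<^sub>R u + s *\<^sub>R v) - f (x + s *\<^sub>R u) - f (x + s *\<^sub>R v) + f x =
    s * s * ?D u v (x + a *\<^sub>R u + b *\<^sub>R v)"
    using second_difference[OF C2 s] by blast
  obtain a' b' where ab': "0 \<le> a'" "a' \<le> s" "0 \<le> b'" "b' \<le> s"
    "f (x + s *\<^sub>R v + s *\<^sub>R u) - f (x + s *\<^sub>R v) - f (x + s *\<^sub>R u) + f x =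
    s * s * ?D v u (x + a' *\<^sub>R v + b' *\<^sub>R u)"
    using second_difference[OF C2 s(1), of v u] s(2) by (auto simp: add.commute)
  have "s * s * ?D u v (x + a *\<^sub>R u + b *\<^sub>R v) = s * s * ?D v u (x + a' *\<^sub>R v + b' *\<^sub>R u)"
    using ab(5) ab'(5) by (simp add: algebra_simps)
  then have "?D u v (x + a *\<^sub>R u + b *\<^sub>R v) = ?D v u (x + a' *\<^sub>R v + b' *\<^sub>R u)"
    using s by simp
  moreover have "\<bar>?D u v (x + a *\<^sub>R u + b *\<^sub>R v) - ?D u v x\<bar> < ?e"
    using r1(2) near[OF ab(1-4)] m_def by auto
  moreover have "\<bar>?D v u (x + a' *\<^sub>R v + b' *\<^sub>R u) - ?D v u x\<bar> < ?e"
    using r2(2) near[OF ab'(3,4,1,2)] m_def by (auto simp: algebra_simps)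
  ultimately show False by argo
qed

subsection \<open>Bump functions\<close>

text \<open>The family t^(-n) exp(-1/t), continued by zero. Derivatives of members are linear
  combinations of members, which makes smoothness an induction over all \<open>n\<close> at
  once.\<close>

definition flat_exp :: "nat \<Rightarrow> real \<Rightarrow> real"
  where "flat_exp n t = (if t > 0 then inverse t ^ n * exp (- inverse t) else 0)"

lemma has_derivative_flat_exp:
  "(flat_exp n has_real_derivative flat_exp (n + 2) t - real n * flat_exp (n + 1) t) (at t)"
proof -
  consider "t > 0" | "t < 0" | "t = 0" by linarith
  then show ?thesis
  proof cases
    case 1
    have "((\<lambda>t. inverse t ^ n * exp (- inverse t)) has_real_derivative
       real n * inverse t ^ (n - 1) * (- (inverse t * inverse t)) * exp (- inverse t) +
       inverse t ^ n * (exp (- inverse t) * (inverse t * inverse t))) (at t)"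
      using 1 by (auto intro!: derivative_eq_intros)
    \<comment> \<open>For \<open>n = 0\<close> the truncated exponent \<open>n - 1\<close> is
      harmless because its coefficient is 0.\<close>
    moreover have "real n * inverse t ^ (n - 1) * (- (inverse t * inverse t)) * exp (- inverse t) +
       inverse t ^ n * (exp (- inverse t) * (inverse t * inverse t)) =
       flat_exp (n + 2) t - real n * flat_exp (n + 1) t"
      using 1 by (cases n) (simp_all add: flat_exp_def)
    ultimately have "((\<lambda>t. inverse t ^ n * exp (- inverse t)) has_real_derivative
       flat_exp (n + 2) t - real n * flat_exp (n + 1) t) (at t)"
      by simp
    then show ?thesis
      by (rule has_field_derivative_transform_within_open[of _ _ _ "{0<..}"]) (use 1 in \<open>auto simp: flat_exp_def\<close>)
  next
    case 2
    have "((\<lambda>t. 0) has_real_derivative 0) (at t)" by simp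
    then have "(flat_exp n has_real_derivative 0) (at t)"
      by (rule has_field_derivative_transform_within_open[of _ _ _ "{..<0}"]) (use 2 in \<open>auto simp: flat_exp_def\<close>)
    then show ?thesis using 2 by (simp add: flat_exp_def)
  next
    case 3
    \<comment> \<open>With s = 1/t the difference quotient at 0 is s^(n+1) exp(-s) for s tending to
      infinity.\<close>
    have "((\<lambda>t::real. inverse t ^ (n + 1) * exp (- inverse t)) \<longlongrightarrow> 0) (at_right 0)"
      using filterlim_compose[OF tendsto_power_div_exp_0 filterlim_inverse_at_top_right, of "n + 1"]
      by (simp only: exp_minus divide_inverse)
    then have r: "((\<lambda>t. flat_exp n t / t) \<longlongrightarrow> 0) (at_right 0)"
      by (rule Lim_transform_eventually)
        (auto simp: eventually_at_filter flat_exp_def field_simps)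
    have l: "((\<lambda>t. flat_exp n t / t) \<longlongrightarrow> 0) (at_left 0)"
      by (rule Lim_transform_eventually[OF tendsto_const])
        (auto simp: eventually_at_filter flat_exp_def)
    have "((\<lambda>t. flat_exp n t / t) \<longlongrightarrow> 0) (at 0)"
      using l r by (simp add: filterlim_split_at)
    then show ?thesis
      using 3 by (simp add: DERIV_def flat_exp_def)
  qed
qed

lemma smooth_on_flat_exp: "smooth_on UNIV (flat_exp n)"
proof -
  have d: "(flat_exp n has_derivative (\<lambda>h. (flat_exp (n + 2) t - real n * flat_exp (n + 1) t) * h)) (at t)" for n t
    using has_derivative_flat_exp[of n t] by (simp add: has_field_derivative_def)
  have e: "frechet_derivative (flat_exp n) (at t) h = (flat_exp (n + 2) t - real n * flat_exp (n + 1) t) * h" for n t h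
    using frechet_derivative_at[OF d[of n t]] by (metis)
  have "Ck_on k UNIV (flat_exp n)" for k
  proof (induction k arbitrary: n)
    case 0
    then show ?case
      by (auto intro!: continuous_at_imp_continuous_on DERIV_isCont has_derivative_flat_exp)
  next
    case (Suc k)
    have "Ck_on k UNIV (\<lambda>t. (flat_exp (n + 2) t + (- real n) * flat_exp (n + 1) t) * h)" for h
      by (intro Ck_on_bilinear[OF bounded_bilinear_mult] Ck_on_add Suc Ck_on_const open_UNIV)
    then show ?case
      using d unfolding Ck_on.simps e by (auto simp: differentiable_def)
  qed
  then show ?thesis by (simp add: smooth_on_def)
qed

text \<open>The squared distance is used because it is smooth at the centre. Since r < R, at least
  one of the two arguments of \<open>flat_exp 0\<close> in the denominator is positive, so the
  quotient is defined everywhere.\<close>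

lemma smooth_bump:
  fixes x0 :: "'a::euclidean_space"
  assumes "0 < r" "r < R"
  obtains \<phi> :: "'a \<Rightarrow> real"
  where "smooth_on UNIV \<phi>" "\<And>x. x \<in> cball x0 r \<Longrightarrow> \<phi> x = 1" "\<And>x. x \<notin> cball x0 R \<Longrightarrow> \<phi> x = 0"
proof -
  let ?s = "\<lambda>x. (x - x0) \<bullet> (x - x0)"
  let ?h = "flat_exp 0"
  define \<phi> where "\<phi> x = ?h (R\<^sup>2 - ?s x) * inverse (?h (R\<^sup>2 - ?s x) + ?h (?s x - r\<^sup>2))" for x
  have pos: "?h t > 0 \<longleftrightarrow> t > 0" and nn: "?h t \<ge> 0" for t
    by (auto simp: flat_exp_def)
  have lt: "r\<^sup>2 < R\<^sup>2" using assms by (intro power_strict_mono) auto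
  have den: "?h (R\<^sup>2 - ?s x) + ?h (?s x - r\<^sup>2) \<noteq> 0" for x
    using pos[of "R\<^sup>2 - ?s x"] pos[of "?s x - r\<^sup>2"] nn[of "R\<^sup>2 - ?s x"] nn[of "?s x - r\<^sup>2"] lt by linarith
  have ss: "smooth_on UNIV ?s"
    by (intro smooth_on_inner smooth_on_diff smooth_on_ident smooth_on_const open_UNIV)
  have h: "smooth_on UNIV (\<lambda>x. ?h (f x))" if "smooth_on UNIV f" for f :: "'a \<Rightarrow> real"
    by (rule smooth_on_compose[OF _ _ that smooth_on_flat_exp]) auto
  have 1: "smooth_on UNIV \<phi>"
    unfolding \<phi>_def
    by (intro smooth_on_mult smooth_on_inverse den smooth_on_add h smooth_on_diff smooth_on_const ss open_UNIV)
  have se: "?s x = (dist x0 x)\<^sup>2" for x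
    by (metis dist_commute dist_norm power2_norm_eq_inner)
  have 2: "\<phi> x = 1" if "x \<in> cball x0 r" for x
  proof -
    have "?s x \<le> r\<^sup>2" using that by (auto simp: se intro: power_mono)
    then have "?h (?s x - r\<^sup>2) = 0" by (simp add: flat_exp_def)
    then show ?thesis using den[of x] by (simp add: \<phi>_def)
  qed
  have 3: "\<phi> x = 0" if "x \<notin> cball x0 R" for x
  proof -
    have "?s x \<ge> R\<^sup>2" using that assms by (auto simp: se intro!: power_mono)
    then show ?thesis by (simp add: \<phi>_def flat_exp_def)
  qed
  show ?thesis using that 1 2 3 by blast
qed

section \<open>Charts and smooth fields\<close>

locale smooth_manifold =
  fixes A :: "('m::t2_space, 'd::finite) chart set"
  assumes atlas: "smooth_atlas A"
begin

abbreviation cimg :: "('m, 'd) chart \<Rightarrow> (real ^ 'd) set"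
  where "cimg c \<equiv> cmap c ` cdom c"

abbreviation trans_map :: "('m, 'd) chart \<Rightarrow> ('m, 'd) chart \<Rightarrow> real ^ 'd \<Rightarrow> real ^ 'd"
  where "trans_map c d \<equiv> (\<lambda>x. cmap d (cinv c x))"

text \<open>Jacobian at \<open>q\<close> of the coordinate change from \<open>c\<close> to
  \<open>d\<close>. \<open>tangent_coord\<close> is the case where \<open>c\<close> is the preferred
  chart of \<open>q\<close>, so the cocycle law \<open>jac_chain\<close> governs all changes of
  components.\<close>

definition jac :: "('m, 'd) chart \<Rightarrow> ('m, 'd) chart \<Rightarrow> 'm \<Rightarrow> real ^ 'd \<Rightarrow> real ^ 'd"
  where "jac c d q = frechet_derivative (trans_map c d) (at (cmap c q))"

lemma is_chart: "c \<in> A \<Longrightarrow> is_chart c"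
  using atlas by (simp add: smooth_atlas_def)

lemma open_cdom: "c \<in> A \<Longrightarrow> open (cdom c)"
  and open_cimg: "c \<in> A \<Longrightarrow> open (cimg c)"
  and homeo: "c \<in> A \<Longrightarrow> homeomorphism (cdom c) (cimg c) (cmap c) (cinv c)"
  using is_chart by (auto simp: is_chart_def)

lemma cinv_cmap [simp]: "c \<in> A \<Longrightarrow> q \<in> cdom c \<Longrightarrow> cinv c (cmap c q) = q"
  using homeo by (auto simp: homeomorphism_def)

lemma cmap_cinv [simp]: "c \<in> A \<Longrightarrow> x \<in> cimg c \<Longrightarrow> cmap c (cinv c x) = x"
  using homeo by (auto simp: homeomorphism_def)

lemma cinv_in [simp]: "c \<in> A \<Longrightarrow> x \<in> cimg c \<Longrightarrow> cinv c x \<in> cdom c"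
  by auto

lemma cmap_in [simp]: "q \<in> cdom c \<Longrightarrow> cmap c q \<in> cimg c"
  by auto

lemma open_cmap_image:
  assumes "c \<in> A" "open U"
  shows "open (cmap c ` (cdom c \<inter> U))"
proof -
  have "cmap c ` (cdom c \<inter> U) = cimg c \<inter> cinv c -` U"
    using assms by (force simp: image_iff)
  moreover have "continuous_on (cimg c) (cinv c)"
    using homeo[OF assms(1)] by (simp add: homeomorphism_def)
  ultimately show ?thesis
    using continuous_open_preimage open_cimg assms by metis
qed

lemma open_cinv_image:
  assumes "c \<in> A" "open T" "T \<subseteq> cimg c"
  shows "open (cinv c ` T)"
proof -
  have "cinv c ` T = cdom c \<inter> cmap c -` T"
  proof
    show "cdom c \<inter> cmap c -` T \<subseteq> cinv c ` T"
    proof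
      fix q assume "q \<in> cdom c \<inter> cmap c -` T"
      then show "q \<in> cinv c ` T" using assms by (intro image_eqI[of _ _ "cmap c q"]) auto
    qed
    show "cinv c ` T \<subseteq> cdom c \<inter> cmap c -` T"
    proof
      fix q assume "q \<in> cinv c ` T"
      then obtain x where x: "x \<in> T" "q = cinv c x" by blast
      then have "x \<in> cimg c" using assms by blast
      then show "q \<in> cdom c \<inter> cmap c -` T" using x assms(1) by (simp del: image_iff)
    qed
  qed
  moreover have "continuous_on (cdom c) (cmap c)"
    using homeo[OF assms(1)] by (simp add: homeomorphism_def)
  ultimately show ?thesis
    using continuous_open_preimage open_cdom assms by metis
qed

lemma smooth_trans:
  "c \<in> A \<Longrightarrow> d \<in> A \<Longrightarrow> smooth_on (cmap c ` (cdom c \<inter> cdom d)) (trans_map c d)"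
  using atlas by (simp add: smooth_atlas_def)

lemma open_overlap: "c \<in> A \<Longrightarrow> d \<in> A \<Longrightarrow> open (cmap c ` (cdom c \<inter> cdom d))"
  using open_cmap_image open_cdom by blast

lemma has_derivative_trans:
  assumes "c \<in> A" "d \<in> A" "q \<in> cdom c" "q \<in> cdom d"
  shows "(trans_map c d has_derivative jac c d q) (at (cmap c q))"
  unfolding jac_def
  by (rule smooth_on_has_derivative[OF smooth_trans]) (use assms in auto)

lemma linear_jac: "c \<in> A \<Longrightarrow> d \<in> A \<Longrightarrow> q \<in> cdom c \<Longrightarrow> q \<in> cdom d \<Longrightarrow> linear (jac c d q)"
  using has_derivative_trans has_derivative_linear by blast

lemma jac_chain:
  assumes "c \<in> A" "d \<in> A" "e \<in> A" "q \<in> cdom c" "q \<in> cdom d" "q \<in> cdom e"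
  shows "jac d e q (jac c d q v) = jac c e q v"
proof -
  have "(trans_map d e has_derivative jac d e q) (at (trans_map c d (cmap c q)))"
    using has_derivative_trans[of d e q] assms by simp
  from has_derivative_compose[OF has_derivative_trans[of c d q] this]
  have 1: "((\<lambda>x. trans_map d e (trans_map c d x)) has_derivative (\<lambda>v. jac d e q (jac c d q v))) (at (cmap c q))"
    using assms by simp
  have "((\<lambda>x. trans_map c e x) has_derivative (\<lambda>v. jac d e q (jac c d q v))) (at (cmap c q))"
    by (rule has_derivative_transform_within_open[OF 1 open_overlap[of c d]]) (use assms in auto)
  from has_derivative_unique[OF this has_derivative_trans[of c e q]] show ?thesis
    using assms by metis
qed

lemma jac_same:
  assumes "c \<in> A" "q \<in> cdom c"
  shows "jac c c q v = v"
proof -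
  have "((\<lambda>x. trans_map c c x) has_derivative (\<lambda>v. v)) (at (cmap c q))"
    by (rule has_derivative_transform_within_open[OF has_derivative_ident open_cimg[of c]]) (use assms in auto)
  from has_derivative_unique[OF this has_derivative_trans[of c c q]] show ?thesis
    using assms by metis
qed

lemma jac_inverse:
  assumes "c \<in> A" "d \<in> A" "q \<in> cdom c" "q \<in> cdom d"
  shows "jac d c q (jac c d q v) = v"
  using jac_chain[of c d c q v] jac_same assms by simp

lemma chart_at: "chart_at A p \<in> A" "p \<in> cdom (chart_at A p)"
proof -
  have "\<exists>c. c \<in> A \<and> p \<in> cdom c"
    using atlas unfolding smooth_atlas_def by blast
  from someI_ex[OF this] show "chart_at A p \<in> A" "p \<in> cdom (chart_at A p)"
    by (auto simp: chart_at_def)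
qed

section \<open>Components of vector fields and local criteria for smoothness\<close>

lemma vf_coord_cmap: "c \<in> A \<Longrightarrow> q \<in> cdom c \<Longrightarrow> vf_coord A c X (cmap c q) = jac (chart_at A q) c q (X q)"
  by (simp add: vf_coord_def tangent_coord_def jac_def Let_def)

lemma vf_coord_change:
  "c \<in> A \<Longrightarrow> d \<in> A \<Longrightarrow> q \<in> cdom c \<Longrightarrow> q \<in> cdom d \<Longrightarrow>
    vf_coord A d X (cmap d q) = jac c d q (vf_coord A c X (cmap c q))"
  by (simp add: vf_coord_cmap jac_chain chart_at)

lemma vf_coord_chart_at: "vf_coord A (chart_at A p) X (cmap (chart_at A p) p) = X p"
  by (simp add: vf_coord_cmap chart_at jac_same)

lemma vf_coord_add:
  "c \<in> A \<Longrightarrow> x \<in> cimg c \<Longrightarrow> vf_coord A c (\<lambda>q. X q + Y q) x = vf_coord A c X x + vf_coord A c Y x"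
  by (auto simp: vf_coord_cmap linear_add[OF linear_jac] chart_at)

lemma vf_coord_scale:
  "c \<in> A \<Longrightarrow> x \<in> cimg c \<Longrightarrow> vf_coord A c (\<lambda>q. f q *\<^sub>R X q) x = f (cinv c x) *\<^sub>R vf_coord A c X x"
  by (auto simp: vf_coord_cmap linear_scale[OF linear_jac] chart_at)

lemma smooth_funI_local:
  assumes "\<And>p. \<exists>c\<in>A. \<exists>T. p \<in> cdom c \<and> open T \<and> cmap c p \<in> T \<and> T \<subseteq> cimg c \<and> smooth_on T (\<lambda>x. f (cinv c x))"
  shows "smooth_fun A f"
  unfolding smooth_fun_def
proof (intro ballI smooth_on_local)
  fix d y assume d: "d \<in> A" and y: "y \<in> cimg d"
  define p where "p = cinv d y"
  have p: "p \<in> cdom d" "y = cmap d p" using d y p_def by auto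
  obtain c T where c: "c \<in> A" "p \<in> cdom c" "open T" "cmap c p \<in> T" "T \<subseteq> cimg c"
    and sm: "smooth_on T (\<lambda>x. f (cinv c x))"
    using assms by blast
  let ?T = "cmap d ` (cdom d \<inter> cinv c ` T)"
  have o: "open ?T" using d c open_cinv_image open_cmap_image by blast
  have "smooth_on ?T (\<lambda>x. f (cinv c (trans_map d c x)))"
    by (rule smooth_on_compose[OF o _ smooth_on_subset[OF smooth_trans[of d c]] sm]) (use c d in force)+
  then have "smooth_on ?T (\<lambda>x. f (cinv d x))"
    by (rule smooth_on_cong[OF o, rotated]) (use c d in force)
  moreover have "y \<in> ?T" using p c by (auto intro!: image_eqI[of _ _ "cmap c p"] simp: p(2))
  ultimately show "\<exists>T. open T \<and> y \<in> T \<and> smooth_on T (\<lambda>x. f (cinv d x))" using o by blast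
qed

text \<open>In another chart \<open>d\<close> the components arise from those in \<open>c\<close> by
  the Jacobian of \<open>trans_map c d\<close>, a smooth function of the
  \<open>c\<close>-coordinates, followed by precomposition with
  \<open>trans_map d c\<close>.\<close>

lemma smooth_vfI_local:
  assumes "\<And>p. \<exists>c\<in>A. \<exists>T. p \<in> cdom c \<and> open T \<and> cmap c p \<in> T \<and> T \<subseteq> cimg c \<and> smooth_on T (vf_coord A c X)"
  shows "smooth_vf A X"
  unfolding smooth_vf_def
proof (intro ballI smooth_on_local)
  fix d y assume d: "d \<in> A" and y: "y \<in> cimg d"
  define p where "p = cinv d y"
  have p: "p \<in> cdom d" "y = cmap d p" using d y p_def by auto
  obtain c T where c: "c \<in> A" "p \<in> cdom c" "open T" "cmap c p \<in> T" "T \<subseteq> cimg c"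
    and sm: "smooth_on T (vf_coord A c X)"
    using assms by blast
  let ?S = "T \<inter> cmap c ` (cdom c \<inter> cdom d)"
  let ?T = "cmap d ` (cdom d \<inter> cinv c ` T)"
  have o: "open ?T" and oS: "open ?S" using d c open_cinv_image open_cmap_image open_overlap by blast+
  have "smooth_on ?S (\<lambda>x. frechet_derivative (trans_map c d) (at x) (vf_coord A c X x))"
    by (intro smooth_on_frechet_derivative oS smooth_on_subset[OF smooth_trans[of c d]]
        smooth_on_subset[OF sm]) (use c d in auto)
  then have "smooth_on ?T (\<lambda>x. (\<lambda>x. frechet_derivative (trans_map c d) (at x) (vf_coord A c X x)) (trans_map d c x))"
  proof (rule smooth_on_compose[OF o, rotated 2])
    show "trans_map d c ` ?T \<subseteq> ?S" using c d by force
    show "smooth_on ?T (trans_map d c)"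
      by (rule smooth_on_subset[OF smooth_trans[of d c]]) (use c d in force)+
  qed
  then have "smooth_on ?T (vf_coord A d X)"
    by (rule smooth_on_cong[OF o, rotated])
      (use c d in \<open>auto simp: vf_coord_change[of c d] jac_def image_subset_iff subset_iff\<close>)
  moreover have "y \<in> ?T" using p c by (auto intro!: image_eqI[of _ _ "cmap c p"] simp: p(2))
  ultimately show "\<exists>T. open T \<and> y \<in> T \<and> smooth_on T (vf_coord A d X)" using o by blast
qed

lemma smooth_funD: "smooth_fun A f \<Longrightarrow> c \<in> A \<Longrightarrow> smooth_on (cimg c) (\<lambda>x. f (cinv c x))"
  by (simp add: smooth_fun_def)

lemma smooth_vfD: "smooth_vf A X \<Longrightarrow> c \<in> A \<Longrightarrow> smooth_on (cimg c) (vf_coord A c X)"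
  by (simp add: smooth_vf_def)

lemma smooth_fun_const: "smooth_fun A (\<lambda>q. k)"
  by (simp add: smooth_fun_def)

lemma smooth_fun_add: "smooth_fun A f \<Longrightarrow> smooth_fun A g \<Longrightarrow> smooth_fun A (\<lambda>q. f q + g q)"
  unfolding smooth_fun_def using smooth_on_add open_cimg by blast

lemma smooth_fun_mult: "smooth_fun A f \<Longrightarrow> smooth_fun A g \<Longrightarrow> smooth_fun A (\<lambda>q. f q * g q)"
  unfolding smooth_fun_def using smooth_on_mult open_cimg by blast

lemma smooth_fun_diff: "smooth_fun A f \<Longrightarrow> smooth_fun A g \<Longrightarrow> smooth_fun A (\<lambda>q. f q - g q)"
  unfolding smooth_fun_def using smooth_on_diff open_cimg by blast

lemma smooth_fun_minus: "smooth_fun A f \<Longrightarrow> smooth_fun A (\<lambda>q. - f q)"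
  unfolding smooth_fun_def using smooth_on_minus open_cimg by blast

lemma smooth_vf_add:
  assumes "smooth_vf A X" "smooth_vf A Y"
  shows "smooth_vf A (\<lambda>q. X q + Y q)"
  unfolding smooth_vf_def
proof
  fix c assume c: "c \<in> A"
  show "smooth_on (cimg c) (vf_coord A c (\<lambda>q. X q + Y q))"
    by (rule smooth_on_cong[OF open_cimg[OF c] _ smooth_on_add[OF open_cimg[OF c]
          smooth_vfD[OF assms(1) c] smooth_vfD[OF assms(2) c]]]) (use c in \<open>simp only: vf_coord_add\<close>)
qed

lemma smooth_vf_scale:
  assumes "smooth_fun A f" "smooth_vf A X"
  shows "smooth_vf A (\<lambda>q. f q *\<^sub>R X q)"
  unfolding smooth_vf_def
proof
  fix c assume c: "c \<in> A"
  show "smooth_on (cimg c) (vf_coord A c (\<lambda>q. f q *\<^sub>R X q))"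
    by (rule smooth_on_cong[OF open_cimg[OF c] _ smooth_on_scaleR[OF open_cimg[OF c]
          smooth_funD[OF assms(1) c] smooth_vfD[OF assms(2) c]]]) (use c in \<open>simp only: vf_coord_scale\<close>)
qed

lemma smooth_vf_minus: "smooth_vf A X \<Longrightarrow> smooth_vf A (\<lambda>q. - X q)"
  using smooth_vf_scale[OF smooth_fun_const[of "-1"]] by simp

lemma smooth_vf_diff: "smooth_vf A X \<Longrightarrow> smooth_vf A Y \<Longrightarrow> smooth_vf A (\<lambda>q. X q - Y q)"
  using smooth_vf_add[of X "\<lambda>q. - Y q"] smooth_vf_minus[of Y] by simp

lemma smooth_vf_zero: "smooth_vf A (\<lambda>q. 0)"
proof -
  have "vf_coord A c (\<lambda>q. 0) x = 0" if "c \<in> A" "x \<in> cimg c" for c x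
    using that by (auto simp: vf_coord_cmap linear_0[OF linear_jac] chart_at)
  then show ?thesis
    unfolding smooth_vf_def using smooth_on_cong[OF open_cimg _ smooth_on_const] by metis
qed

lemma smooth_vf_sum:
  "(\<And>i. i \<in> I \<Longrightarrow> smooth_vf A (X i)) \<Longrightarrow> smooth_vf A (\<lambda>q. \<Sum>i\<in>I. X i q)"
  by (induction I rule: infinite_finite_induct) (auto intro!: smooth_vf_zero smooth_vf_add)

subsection \<open>Derivatives of functions along fields\<close>

lemma smooth_fun_has_derivative:
  "smooth_fun A f \<Longrightarrow> c \<in> A \<Longrightarrow> q \<in> cdom c \<Longrightarrow>
    ((\<lambda>x. f (cinv c x)) has_derivative frechet_derivative (\<lambda>x. f (cinv c x)) (at (cmap c q))) (at (cmap c q))"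
  using smooth_on_has_derivative[OF smooth_funD] by simp

lemma vf_deriv_eq:
  "vf_deriv A X f p = frechet_derivative (\<lambda>x. f (cinv (chart_at A p) x)) (at (cmap (chart_at A p) p)) (X p)"
  by (simp add: vf_deriv_def Let_def)

text \<open>\<open>vf_deriv\<close> is computed in the preferred chart of each point, which may
  jump; smoothness of the result requires one chart for a whole neighbourhood. The chain rule
  through the transition map provides it.\<close>

lemma vf_deriv_chart:
  assumes "smooth_fun A f" "c \<in> A" "q \<in> cdom c"
  shows "vf_deriv A X f q = frechet_derivative (\<lambda>x. f (cinv c x)) (at (cmap c q)) (vf_coord A c X (cmap c q))"
proof -
  define k where "k = chart_at A q"
  have k: "k \<in> A" "q \<in> cdom k" using chart_at k_def by auto
  have "((\<lambda>x. f (cinv c x)) has_derivative frechet_derivative (\<lambda>x. f (cinv c x)) (at (cmap c q))) (at (trans_map k c (cmap k q)))"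
    using smooth_fun_has_derivative assms k by simp
  from has_derivative_compose[OF has_derivative_trans[of k c q] this]
  have 1: "((\<lambda>x. f (cinv c (trans_map k c x))) has_derivative
      (\<lambda>v. frechet_derivative (\<lambda>x. f (cinv c x)) (at (cmap c q)) (jac k c q v))) (at (cmap k q))"
    using assms k by simp
  have "((\<lambda>x. f (cinv k x)) has_derivative
      (\<lambda>v. frechet_derivative (\<lambda>x. f (cinv c x)) (at (cmap c q)) (jac k c q v))) (at (cmap k q))"
    by (rule has_derivative_transform_within_open[OF 1 open_overlap[of k c]]) (use assms k in auto)
  then have "frechet_derivative (\<lambda>x. f (cinv k x)) (at (cmap k q)) v =
      frechet_derivative (\<lambda>x. f (cinv c x)) (at (cmap c q)) (jac k c q v)" for v
    by (metis frechet_derivative_at)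
  then show ?thesis
    using assms by (simp add: vf_deriv_eq vf_coord_cmap k_def)
qed

lemma smooth_fun_vf_deriv:
  assumes "smooth_vf A X" "smooth_fun A f"
  shows "smooth_fun A (vf_deriv A X f)"
  unfolding smooth_fun_def
proof
  fix c assume c: "c \<in> A"
  have "smooth_on (cimg c) (\<lambda>x. frechet_derivative (\<lambda>x. f (cinv c x)) (at x) (vf_coord A c X x))"
    by (intro smooth_on_frechet_derivative open_cimg smooth_funD smooth_vfD c assms)
  then show "smooth_on (cimg c) (\<lambda>x. vf_deriv A X f (cinv c x))"
    by (rule smooth_on_cong[OF open_cimg[OF c], rotated]) (use c assms in \<open>auto simp: vf_deriv_chart\<close>)
qed

lemma vf_deriv_const: "vf_deriv A X (\<lambda>q. k) p = 0"
  by (simp add: vf_deriv_eq)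

lemma vf_deriv_add:
  assumes "smooth_fun A f" "smooth_fun A g"
  shows "vf_deriv A X (\<lambda>q. f q + g q) p = vf_deriv A X f p + vf_deriv A X g p"
  unfolding vf_deriv_eq
  by (simp add: frechet_derivative_at[OF has_derivative_add[OF smooth_fun_has_derivative[OF assms(1) chart_at]
      smooth_fun_has_derivative[OF assms(2) chart_at]], symmetric])

lemma vf_deriv_mult:
  assumes "smooth_fun A f" "smooth_fun A g"
  shows "vf_deriv A X (\<lambda>q. f q * g q) p = f p * vf_deriv A X g p + vf_deriv A X f p * g p"
  unfolding vf_deriv_eq
  by (simp add: frechet_derivative_at[OF has_derivative_mult[OF smooth_fun_has_derivative[OF assms(1) chart_at]
      smooth_fun_has_derivative[OF assms(2) chart_at]], symmetric] chart_at)

lemma vf_deriv_minus: "smooth_fun A f \<Longrightarrow> vf_deriv A X (\<lambda>q. - f q) p = - vf_deriv A X f p"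
  using vf_deriv_mult[OF smooth_fun_const[of "-1"], of f X p] by (simp add: vf_deriv_const)

lemma vf_deriv_diff:
  "smooth_fun A f \<Longrightarrow> smooth_fun A g \<Longrightarrow> vf_deriv A X (\<lambda>q. f q - g q) p = vf_deriv A X f p - vf_deriv A X g p"
  using vf_deriv_add[of f "\<lambda>q. - g q"] smooth_fun_minus[of g] vf_deriv_minus[of g] by simp

lemma linear_frechet_chart_at:
  "smooth_fun A f \<Longrightarrow> linear (frechet_derivative (\<lambda>x. f (cinv (chart_at A p) x)) (at (cmap (chart_at A p) p)))"
  using has_derivative_linear[OF smooth_fun_has_derivative[OF _ chart_at]] .

lemma vf_deriv_field_add:
  "smooth_fun A f \<Longrightarrow> vf_deriv A (\<lambda>q. X q + Y q) f p = vf_deriv A X f p + vf_deriv A Y f p"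
  unfolding vf_deriv_eq using linear_add[OF linear_frechet_chart_at] by blast

lemma vf_deriv_field_scale:
  "smooth_fun A f \<Longrightarrow> vf_deriv A (\<lambda>q. g q *\<^sub>R X q) f p = g p * vf_deriv A X f p"
  unfolding vf_deriv_eq by (simp add: linear_scale[OF linear_frechet_chart_at])

lemma vf_deriv_field_diff:
  "smooth_fun A f \<Longrightarrow> vf_deriv A (\<lambda>q. X q - Y q) f p = vf_deriv A X f p - vf_deriv A Y f p"
  unfolding vf_deriv_eq using linear_diff[OF linear_frechet_chart_at] by blast

text \<open>In a chart, X(Yf) is a Hessian term in X and Y plus the derivative of f along the
  derivative of Y in direction X. The Hessian terms cancel by symmetry and the rest is the
  coordinate formula of the bracket.\<close>

lemma vf_deriv_lie_bracket:
  assumes "smooth_vf A X" "smooth_vf A Y" "smooth_fun A f"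
  shows "vf_deriv A (lie_bracket A X Y) f p = vf_deriv A X (vf_deriv A Y f) p - vf_deriv A Y (vf_deriv A X f) p"
proof -
  define k where "k = chart_at A p"
  have k: "k \<in> A" "p \<in> cdom k" using chart_at k_def by auto
  define g where "g = (\<lambda>x. f (cinv k x))"
  define x where "x = cmap k p"
  have x: "x \<in> cimg k" using k x_def by simp
  have sg: "smooth_on (cimg k) g" unfolding g_def using smooth_funD assms k by blast
  let ?D = "frechet_derivative"
  have lin: "linear (?D g (at y))" if "y \<in> cimg k" for y
    using smooth_on_has_derivative[OF sg that] has_derivative_linear by blast
  have second: "vf_deriv A X (vf_deriv A Y f) p =
     (\<Sum>b\<in>Basis. (Y p \<bullet> b) * ?D (\<lambda>y. ?D g (at y) b) (at x) (X p))
      + ?D g (at x) (?D (vf_coord A k Y) (at x) (X p))"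
    if X: "smooth_vf A X" and Y: "smooth_vf A Y" for X Y
  proof -
    have Yx: "vf_coord A k Y x = Y p" by (simp add: x_def k_def vf_coord_chart_at)
    have dY: "(vf_coord A k Y has_derivative ?D (vf_coord A k Y) (at x)) (at x)"
      using smooth_on_has_derivative[OF smooth_vfD[OF Y k(1)] x] .
    have dg: "((\<lambda>y. ?D g (at y) b) has_derivative ?D (\<lambda>y. ?D g (at y) b) (at x)) (at x)" for b
      using smooth_on_has_derivative[OF smooth_on_frechet_derivative_const[OF sg] x] .
    have "((\<lambda>y. \<Sum>b\<in>Basis. (vf_coord A k Y y \<bullet> b) * ?D g (at y) b) has_derivative
      (\<lambda>v. \<Sum>b\<in>Basis. (vf_coord A k Y x \<bullet> b) * ?D (\<lambda>y. ?D g (at y) b) (at x) v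
          + (?D (vf_coord A k Y) (at x) v \<bullet> b) * ?D g (at x) b)) (at x)"
      by (intro has_derivative_sum has_derivative_mult has_derivative_inner_left dY dg)
    then have "((\<lambda>y. vf_deriv A Y f (cinv k y)) has_derivative
      (\<lambda>v. \<Sum>b\<in>Basis. (vf_coord A k Y x \<bullet> b) * ?D (\<lambda>y. ?D g (at y) b) (at x) v
          + (?D (vf_coord A k Y) (at x) v \<bullet> b) * ?D g (at x) b)) (at x)"
    proof (rule has_derivative_transform_within_open[OF _ open_cimg[OF k(1)] x])
      fix y assume y: "y \<in> cimg k"
      have "vf_deriv A Y f (cinv k y) = ?D g (at y) (vf_coord A k Y y)"
        using y k assms by (auto simp: vf_deriv_chart g_def)
      then show "(\<Sum>b\<in>Basis. (vf_coord A k Y y \<bullet> b) * ?D g (at y) b) = vf_deriv A Y f (cinv k y)"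
        using linear_euclidean_expand[OF lin[OF y], of "vf_coord A k Y y"] by simp
    qed
    from frechet_derivative_at[OF this] show ?thesis
      unfolding vf_deriv_eq[of X]
      using linear_euclidean_expand[OF lin[OF x], of "?D (vf_coord A k Y) (at x) (X p)"]
      by (simp add: k_def[symmetric] x_def[symmetric] Yx sum.distrib fun_eq_iff)
  qed
  have sym: "(\<Sum>b\<in>Basis. (Y p \<bullet> b) * ?D (\<lambda>y. ?D g (at y) b) (at x) (X p)) =
     (\<Sum>b\<in>Basis. (X p \<bullet> b) * ?D (\<lambda>y. ?D g (at y) b) (at x) (Y p))"
  proof -
    have l2: "linear (?D (\<lambda>y. ?D g (at y) b) (at x))" for b
      using smooth_on_has_derivative[OF smooth_on_frechet_derivative_const[OF sg] x] has_derivative_linear by blast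
    have "(\<Sum>b\<in>Basis. (Y p \<bullet> b) * ?D (\<lambda>y. ?D g (at y) b) (at x) (X p)) =
      (\<Sum>b\<in>Basis. \<Sum>a\<in>Basis. (Y p \<bullet> b) * ((X p \<bullet> a) * ?D (\<lambda>y. ?D g (at y) b) (at x) a))"
      by (subst linear_euclidean_expand[OF l2]) (simp add: sum_distrib_left)
    also have "\<dots> = (\<Sum>b\<in>Basis. \<Sum>a\<in>Basis. (X p \<bullet> a) * ((Y p \<bullet> b) * ?D (\<lambda>y. ?D g (at y) a) (at x) b))"
      using symmetric_second_derivative[OF open_cimg[OF k(1)] x sg]
      by (intro sum.cong refl) (simp add: algebra_simps)
    also have "\<dots> = (\<Sum>a\<in>Basis. \<Sum>b\<in>Basis. (X p \<bullet> a) * ((Y p \<bullet> b) * ?D (\<lambda>y. ?D g (at y) a) (at x) b))"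
      by (rule sum.swap)
    also have "\<dots> = (\<Sum>a\<in>Basis. (X p \<bullet> a) * ?D (\<lambda>y. ?D g (at y) a) (at x) (Y p))"
      by (subst (2) linear_euclidean_expand[OF l2]) (simp add: sum_distrib_left)
    finally show ?thesis .
  qed
  have "vf_deriv A (lie_bracket A X Y) f p =
      ?D g (at x) (?D (vf_coord A k Y) (at x) (X p) - ?D (vf_coord A k X) (at x) (Y p))"
    by (simp add: vf_deriv_eq lie_bracket_def Let_def k_def g_def x_def)
  then show ?thesis
    using second[OF assms(1,2)] second[OF assms(2,1)] sym linear_diff[OF lin[OF x]] by simp
qed

subsection \<open>Extension of local data\<close>

definition extend_fun :: "('m, 'd) chart \<Rightarrow> (real ^ 'd \<Rightarrow> real) \<Rightarrow> 'm \<Rightarrow> real"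
  where "extend_fun c g q = (if q \<in> cdom c then g (cmap c q) else 0)"

definition extend_vf :: "('m, 'd) chart \<Rightarrow> (real ^ 'd \<Rightarrow> real ^ 'd) \<Rightarrow> 'm \<Rightarrow> real ^ 'd"
  where "extend_vf c V q = (if q \<in> cdom c then jac c (chart_at A q) q (V (cmap c q)) else 0)"

text \<open>The Hausdorff property enters here: a compact set inside a chart is closed in the whole
  manifold, so its complement is an open set on which extensions by zero vanish.\<close>

lemma closed_cinv_compact:
  assumes "c \<in> A" "compact K" "K \<subseteq> cimg c"
  shows "closed (cinv c ` K)"
proof -
  have "continuous_on K (cinv c)"
    using homeo[OF assms(1)] continuous_on_subset[OF _ assms(3)] by (auto simp: homeomorphism_def)
  then show ?thesis using compact_continuous_image compact_imp_closed assms by blast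
qed

lemma smooth_extend_fun:
  assumes c: "c \<in> A" and K: "compact K" "K \<subseteq> cimg c"
    and g: "smooth_on (cimg c) g" "\<And>x. x \<in> cimg c \<Longrightarrow> x \<notin> K \<Longrightarrow> g x = 0"
  shows "smooth_fun A (extend_fun c g)"
proof (rule smooth_funI_local)
  fix p
  show "\<exists>c'\<in>A. \<exists>T. p \<in> cdom c' \<and> open T \<and> cmap c' p \<in> T \<and> T \<subseteq> cimg c' \<and> smooth_on T (\<lambda>x. extend_fun c g (cinv c' x))"
  proof (cases "p \<in> cdom c")
    case True
    have "smooth_on (cimg c) (\<lambda>x. extend_fun c g (cinv c x))"
      by (rule smooth_on_cong[OF open_cimg[OF c] _ g(1)]) (use c in \<open>auto simp: extend_fun_def\<close>)
    then show ?thesis using c open_cimg True by blast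
  next
    case False
    define d where "d = chart_at A p"
    have d: "d \<in> A" "p \<in> cdom d" using chart_at d_def by auto
    let ?T = "cmap d ` (cdom d \<inter> - cinv c ` K)"
    have o: "open ?T" using open_cmap_image d closed_cinv_compact[OF c K] by blast
    have "smooth_on ?T (\<lambda>x. extend_fun c g (cinv d x))"
    proof (rule smooth_on_cong[OF o _ smooth_on_const[of _ 0]])
      fix x assume "x \<in> ?T"
      then obtain q where q: "q \<in> cdom d" "x = cmap d q" "q \<notin> cinv c ` K" by auto
      have "g (cmap c q) = 0" if "q \<in> cdom c"
        using g(2)[of "cmap c q"] that q(3) c by force
      then show "0 = extend_fun c g (cinv d x)" using d q by (simp add: extend_fun_def)
    qed
    moreover have "p \<notin> cinv c ` K" using False K c by auto
    then have "cmap d p \<in> ?T" using d by blast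
    ultimately show ?thesis using o d by (intro bexI[of _ d] exI[of _ ?T]) auto
  qed
qed

lemma vf_coord_extend:
  "c \<in> A \<Longrightarrow> x \<in> cimg c \<Longrightarrow> vf_coord A c (extend_vf c V) x = V x"
  by (auto simp: vf_coord_cmap extend_vf_def jac_inverse chart_at)

lemma smooth_extend_vf:
  assumes c: "c \<in> A" and K: "compact K" "K \<subseteq> cimg c"
    and g: "smooth_on (cimg c) V" "\<And>x. x \<in> cimg c \<Longrightarrow> x \<notin> K \<Longrightarrow> V x = 0"
  shows "smooth_vf A (extend_vf c V)"
proof (rule smooth_vfI_local)
  fix p
  show "\<exists>c'\<in>A. \<exists>T. p \<in> cdom c' \<and> open T \<and> cmap c' p \<in> T \<and> T \<subseteq> cimg c' \<and> smooth_on T (vf_coord A c' (extend_vf c V))"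
  proof (cases "p \<in> cdom c")
    case True
    have "smooth_on (cimg c) (vf_coord A c (extend_vf c V))"
      by (rule smooth_on_cong[OF open_cimg[OF c] _ g(1)]) (use c in \<open>simp add: vf_coord_extend\<close>)
    then show ?thesis using c open_cimg True by blast
  next
    case False
    define d where "d = chart_at A p"
    have d: "d \<in> A" "p \<in> cdom d" using chart_at d_def by auto
    let ?T = "cmap d ` (cdom d \<inter> - cinv c ` K)"
    have o: "open ?T" using open_cmap_image d closed_cinv_compact[OF c K] by blast
    have "smooth_on ?T (vf_coord A d (extend_vf c V))"
    proof (rule smooth_on_cong[OF o _ smooth_on_const[of _ 0]])
      fix x assume "x \<in> ?T"
      then obtain q where q: "q \<in> cdom d" "x = cmap d q" "q \<notin> cinv c ` K" by auto
      have "V (cmap c q) = 0" if "q \<in> cdom c"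
        using g(2)[of "cmap c q"] that q(3) c by force
      then have "extend_vf c V q = 0"
        using c by (simp add: extend_vf_def linear_0[OF linear_jac] chart_at)
      then show "0 = vf_coord A d (extend_vf c V) x"
        using d q by (simp add: vf_coord_cmap linear_0[OF linear_jac] chart_at)
    qed
    moreover have "p \<notin> cinv c ` K" using False K c by auto
    then have "cmap d p \<in> ?T" using d by blast
    ultimately show ?thesis using o d by (intro bexI[of _ d] exI[of _ ?T]) auto
  qed
qed

section \<open>Cutoffs, local frames and tensoriality\<close>

lemma cutoff:
  assumes "c \<in> A" "p \<in> cdom c"
  obtains r and \<phi> :: "real ^ 'd \<Rightarrow> real" and K
  where "r > 0" "cball (cmap c p) r \<subseteq> cimg c" "smooth_on UNIV \<phi>"
    "\<And>x. x \<in> cball (cmap c p) r \<Longrightarrow> \<phi> x = 1"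
    "compact K" "K \<subseteq> cimg c" "\<And>x. x \<notin> K \<Longrightarrow> \<phi> x = 0"
proof -
  obtain R where R: "R > 0" "cball (cmap c p) R \<subseteq> cimg c"
    using open_contains_cball[of "cimg c"] open_cimg assms by auto
  obtain \<phi> :: "real ^ 'd \<Rightarrow> real" where \<phi>: "smooth_on UNIV \<phi>" "\<And>x. x \<in> cball (cmap c p) (R/2) \<Longrightarrow> \<phi> x = 1"
      "\<And>x. x \<notin> cball (cmap c p) R \<Longrightarrow> \<phi> x = 0"
    using smooth_bump[of "R/2" R "cmap c p"] R by auto
  have "cball (cmap c p) (R/2) \<subseteq> cimg c" using R by (smt (verit) mem_cball subset_iff field_sum_of_halves)
  then show ?thesis
    using that[of "R/2" \<phi> "cball (cmap c p) R"] R \<phi> by simp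
qed

text \<open>Coordinate fields exist on a chart domain only, but \<open>nabla\<close> acts on global
  fields. A cutoff makes them global and leaves them unchanged on a ball.\<close>

lemma frame:
  assumes c: "c \<in> A" "p \<in> cdom c"
  obtains r E where "r > 0" "cball (cmap c p) r \<subseteq> cimg c" "\<And>i. smooth_vf A (E i)"
    "\<And>i x. x \<in> cball (cmap c p) r \<Longrightarrow> vf_coord A c (E i) x = axis i 1"
proof -
  obtain r K and \<phi> :: "real ^ 'd \<Rightarrow> real" where \<phi>: "r > 0" "cball (cmap c p) r \<subseteq> cimg c" "smooth_on UNIV \<phi>"
    "\<And>x. x \<in> cball (cmap c p) r \<Longrightarrow> \<phi> x = 1"
    "compact K" "K \<subseteq> cimg c" "\<And>x. x \<notin> K \<Longrightarrow> \<phi> x = 0"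
    using cutoff[OF c] by metis
  show ?thesis
  proof (rule that[OF \<phi>(1,2)])
    show "smooth_vf A (extend_vf c (\<lambda>x. \<phi> x *\<^sub>R axis i 1))" for i
      by (rule smooth_extend_vf[OF c(1) \<phi>(5,6)])
        (use \<phi> open_cimg c in \<open>auto intro!: smooth_on_scaleR smooth_on_subset[OF \<phi>(3)]\<close>)
    show "vf_coord A c (extend_vf c (\<lambda>x. \<phi> x *\<^sub>R axis i 1)) x = axis i 1" if "x \<in> cball (cmap c p) r" for x i
      using that \<phi> c by (subst vf_coord_extend) auto
  qed
qed

lemma extension_exists: "\<exists>X. smooth_vf A X \<and> X p = v"
proof -
  define c where "c = chart_at A p"
  have c: "c \<in> A" "p \<in> cdom c" using chart_at c_def by auto
  obtain r E where E: "r > 0" "cball (cmap c p) r \<subseteq> cimg c" "\<And>i. smooth_vf A (E i)"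
    "\<And>i x. x \<in> cball (cmap c p) r \<Longrightarrow> vf_coord A c (E i) x = axis i 1"
    using frame[OF c] by metis
  have Ep: "E i p = axis i 1" for i
    using E(4)[of "cmap c p" i] E(1) vf_coord_chart_at[of p "E i"] by (simp add: c_def)
  have "(\<Sum>i\<in>UNIV. (v $ i) *\<^sub>R E i p) = v"
    unfolding Ep by (simp add: vec_eq_iff sum_component axis_def if_distrib cong: if_cong)
  moreover have "smooth_vf A (\<lambda>q. \<Sum>i\<in>UNIV. (v $ i) *\<^sub>R E i q)"
    by (intro smooth_vf_sum smooth_vf_scale smooth_fun_const E)
  ultimately show ?thesis by blast
qed

lemma vf_ext: "smooth_vf A (vf_ext A p v)" "vf_ext A p v p = v"
  using someI_ex[OF extension_exists[of p v]] by (auto simp: vf_ext_def)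

text \<open>With a cutoff \<open>\<phi>\<close>, a field decomposes as
  \<open>X = (\<Sum>i. (\<phi> X\<^sup>i) (\<phi> \<partial>\<^sub>i)) + (1 - \<phi>\<^sup>2) X\<close>.\<close>

lemma tensorial_zero:
  fixes \<Phi> :: "('m \<Rightarrow> real ^ 'd) \<Rightarrow> 'b::real_vector"
  assumes add: "\<And>X Y. smooth_vf A X \<Longrightarrow> smooth_vf A Y \<Longrightarrow> \<Phi> (\<lambda>q. X q + Y q) = \<Phi> X + \<Phi> Y"
    and scale: "\<And>f X. smooth_fun A f \<Longrightarrow> smooth_vf A X \<Longrightarrow> \<Phi> (\<lambda>q. f q *\<^sub>R X q) = f p *\<^sub>R \<Phi> X"
    and X: "smooth_vf A X" "X p = 0"
  shows "\<Phi> X = 0"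
proof -
  define c where "c = chart_at A p"
  have c: "c \<in> A" "p \<in> cdom c" using chart_at c_def by auto
  obtain r K and \<phi> :: "real ^ 'd \<Rightarrow> real" where \<phi>: "r > 0" "cball (cmap c p) r \<subseteq> cimg c" "smooth_on UNIV \<phi>"
    "\<And>x. x \<in> cball (cmap c p) r \<Longrightarrow> \<phi> x = 1"
    "compact K" "K \<subseteq> cimg c" "\<And>x. x \<notin> K \<Longrightarrow> \<phi> x = 0"
    using cutoff[OF c] by metis
  have o: "open (cimg c)" using open_cimg c by blast
  define f where "f i = extend_fun c (\<lambda>x. \<phi> x * vf_coord A c X x $ i)" for i
  define E where "E i = extend_vf c (\<lambda>x. \<phi> x *\<^sub>R axis i 1)" for i
  define h where "h = (\<lambda>q. 1 - extend_fun c \<phi> q * extend_fun c \<phi> q)"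
  have sf: "smooth_fun A (f i)" for i unfolding f_def
    by (rule smooth_extend_fun[OF c(1) \<phi>(5,6)])
      (use \<phi> o smooth_vfD[OF X(1) c(1)] in \<open>auto intro!: smooth_on_mult smooth_on_nth smooth_on_subset[OF \<phi>(3)]\<close>)
  have sE: "smooth_vf A (E i)" for i unfolding E_def
    by (rule smooth_extend_vf[OF c(1) \<phi>(5,6)])
      (use \<phi> o in \<open>auto intro!: smooth_on_scaleR smooth_on_subset[OF \<phi>(3)]\<close>)
  have sp: "smooth_fun A (extend_fun c \<phi>)"
    by (rule smooth_extend_fun[OF c(1) \<phi>(5,6)]) (use \<phi> in \<open>auto intro!: smooth_on_subset[OF \<phi>(3)]\<close>)
  have sh: "smooth_fun A h" unfolding h_def by (intro smooth_fun_diff smooth_fun_mult smooth_fun_const sp)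
  have Xp: "vf_coord A c X (cmap c p) = 0" using X by (simp add: c_def vf_coord_chart_at)
  have f0: "f i p = 0" for i by (simp add: f_def extend_fun_def Xp)
  have h0: "h p = 0" using \<phi>(4)[of "cmap c p"] \<phi>(1) c by (simp add: h_def extend_fun_def)
  have dec: "X = (\<lambda>q. (\<Sum>i\<in>UNIV. f i q *\<^sub>R E i q) + h q *\<^sub>R X q)"
  proof
    fix q
    show "X q = (\<Sum>i\<in>UNIV. f i q *\<^sub>R E i q) + h q *\<^sub>R X q"
    proof (cases "q \<in> cdom c")
      case True
      define x where "x = cmap c q"
      have l: "linear (jac c (chart_at A q) q)" using linear_jac True c chart_at by blast
      have "(\<Sum>i\<in>UNIV. f i q *\<^sub>R E i q) = jac c (chart_at A q) q (\<Sum>i\<in>UNIV. (\<phi> x * \<phi> x * vf_coord A c X x $ i) *\<^sub>R axis i 1)"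
        using True by (simp add: f_def E_def extend_fun_def extend_vf_def x_def linear_sum[OF l] linear_scale[OF l] mult_ac)
      also have "(\<Sum>i\<in>UNIV. (\<phi> x * \<phi> x * vf_coord A c X x $ i) *\<^sub>R axis i (1::real)) = (\<phi> x * \<phi> x) *\<^sub>R vf_coord A c X x"
        by (simp add: vec_eq_iff sum_component axis_def if_distrib cong: if_cong)
      also have "jac c (chart_at A q) q \<dots> = (\<phi> x * \<phi> x) *\<^sub>R X q"
        using True c by (simp add: linear_scale[OF l] x_def vf_coord_cmap jac_inverse chart_at)
      finally show ?thesis using True by (simp add: h_def extend_fun_def x_def algebra_simps)
    qed (simp add: f_def h_def extend_fun_def)
  qed
  have "\<Phi> (\<lambda>q. (\<Sum>i\<in>I. f i q *\<^sub>R E i q) + h q *\<^sub>R X q) = (\<Sum>i\<in>I. f i p *\<^sub>R \<Phi> (E i)) + h p *\<^sub>R \<Phi> X"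
    if "finite I" for I
    using that
  proof (induction I)
    case empty
    then show ?case using scale[OF sh X(1)] by simp
  next
    case (insert j I)
    have "\<Phi> (\<lambda>q. f j q *\<^sub>R E j q + ((\<Sum>i\<in>I. f i q *\<^sub>R E i q) + h q *\<^sub>R X q)) =
       \<Phi> (\<lambda>q. f j q *\<^sub>R E j q) + \<Phi> (\<lambda>q. (\<Sum>i\<in>I. f i q *\<^sub>R E i q) + h q *\<^sub>R X q)"
      by (rule add) (intro smooth_vf_add smooth_vf_sum smooth_vf_scale sf sE sh X)+
    then show ?case using insert scale[OF sf sE] by (simp add: add.assoc)
  qed
  from this[of UNIV] show ?thesis
    unfolding dec[symmetric] by (simp add: f0 h0)
qed

text \<open>This replaces locality arguments: linearity over global smooth functions forces
  dependence on the value at \<open>p\<close> alone. The difference is written with the scalar -1 so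
  that \<open>add\<close> and \<open>scale\<close> evaluate it.\<close>

lemma tensorial:
  fixes \<Phi> :: "('m \<Rightarrow> real ^ 'd) \<Rightarrow> 'b::real_vector"
  assumes add: "\<And>X Y. smooth_vf A X \<Longrightarrow> smooth_vf A Y \<Longrightarrow> \<Phi> (\<lambda>q. X q + Y q) = \<Phi> X + \<Phi> Y"
    and scale: "\<And>f X. smooth_fun A f \<Longrightarrow> smooth_vf A X \<Longrightarrow> \<Phi> (\<lambda>q. f q *\<^sub>R X q) = f p *\<^sub>R \<Phi> X"
    and X: "smooth_vf A X" "smooth_vf A Y" "X p = Y p"
  shows "\<Phi> X = \<Phi> Y"
proof -
  have "\<Phi> (\<lambda>q. X q + (-1) *\<^sub>R Y q) = 0"
    by (rule tensorial_zero[OF add scale])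
      (use X in \<open>auto intro!: smooth_vf_diff\<close>)
  also have "\<Phi> (\<lambda>q. X q + (-1) *\<^sub>R Y q) = \<Phi> X + (-1) *\<^sub>R \<Phi> Y"
    using add[OF X(1) smooth_vf_scale[OF smooth_fun_const[of "-1"] X(2)]] scale[OF smooth_fun_const X(2), of "-1"] by simp
  finally show ?thesis by simp
qed

text \<open>Testing on coordinate functions times a cutoff recovers every component. Identities
  between fields, such as that of Jacobi, thereby reduce to identities between derivations.\<close>

lemma vf_deriv_separates:
  assumes "smooth_vf A X" and "\<And>f. smooth_fun A f \<Longrightarrow> vf_deriv A X f p = 0"
  shows "X p = 0"
proof -
  define c where "c = chart_at A p"
  have c: "c \<in> A" "p \<in> cdom c" using chart_at c_def by auto
  obtain r K and \<phi> :: "real ^ 'd \<Rightarrow> real" where \<phi>: "r > 0" "cball (cmap c p) r \<subseteq> cimg c" "smooth_on UNIV \<phi>"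
    "\<And>x. x \<in> cball (cmap c p) r \<Longrightarrow> \<phi> x = 1"
    "compact K" "K \<subseteq> cimg c" "\<And>x. x \<notin> K \<Longrightarrow> \<phi> x = 0"
    using cutoff[OF c] by metis
  have "X p $ i = 0" for i
  proof -
    let ?f = "extend_fun c (\<lambda>x. \<phi> x * x $ i)"
    have sf: "smooth_fun A ?f"
      by (rule smooth_extend_fun[OF c(1) \<phi>(5,6)])
        (use \<phi> open_cimg c in \<open>auto intro!: smooth_on_mult smooth_on_nth smooth_on_ident smooth_on_subset[OF \<phi>(3)]\<close>)
    have "((\<lambda>x. x $ i) has_derivative (\<lambda>v. v $ i)) (at (cmap c p))"
      by (intro bounded_linear_imp_has_derivative bounded_linear_vec_nth)
    then have "((\<lambda>x. ?f (cinv c x)) has_derivative (\<lambda>v. v $ i)) (at (cmap c p))"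
    proof (rule has_derivative_transform_within_open[of _ _ _ _ "ball (cmap c p) r"])
      fix x assume "x \<in> ball (cmap c p) r"
      then have x: "x \<in> cball (cmap c p) r" "x \<in> cimg c" using \<phi>(2) by (auto simp: subset_iff)
      show "x $ i = ?f (cinv c x)" using \<phi>(4)[OF x(1)] x(2) c by (simp add: extend_fun_def)
    qed (use \<phi> in auto)
    from frechet_derivative_at[OF this] show ?thesis
      using assms(2)[OF sf] unfolding vf_deriv_eq c_def[symmetric] by metis
  qed
  then show ?thesis by (simp add: vec_eq_iff)
qed

end

section \<open>Algebra on a symplectic vector space\<close>

lemma linear_axis_expand:
  fixes f :: "real ^ 'd::finite \<Rightarrow> 'b::real_vector"
  assumes "linear f"
  shows "f z = (\<Sum>i\<in>UNIV. z $ i *\<^sub>R f (axis i 1))"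
proof -
  have "f z = f (\<Sum>i\<in>UNIV. z $ i *\<^sub>R axis i 1)"
    by (simp add: basis_expansion flip: scalar_mult_eq_scaleR)
  also have "\<dots> = (\<Sum>i\<in>UNIV. z $ i *\<^sub>R f (axis i 1))"
    by (simp add: linear_sum[OF assms] linear_scale[OF assms])
  finally show ?thesis .
qed

text \<open>Infinitesimal action of an endomorphism on a covariant tensor, without the sign of the
  dual representation, which does not affect whether the result vanishes.\<close>

definition derivation_act ::
    "('v \<Rightarrow> 'v) \<Rightarrow> ('v \<Rightarrow> 'v \<Rightarrow> 'v \<Rightarrow> 'v \<Rightarrow> real) \<Rightarrow> 'v \<Rightarrow> 'v \<Rightarrow> 'v \<Rightarrow> 'v \<Rightarrow> real"
  where "derivation_act M F x y z s = F (M x) y z s + F x (M y) z s + F x y (M z) s + F x y z (M s)"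

definition multilinear4 :: "('v::real_vector \<Rightarrow> 'v \<Rightarrow> 'v \<Rightarrow> 'v \<Rightarrow> real) \<Rightarrow> bool"
  where "multilinear4 F \<longleftrightarrow> (\<forall>y z s. linear (\<lambda>x. F x y z s)) \<and> (\<forall>x z s. linear (\<lambda>y. F x y z s)) \<and>
    (\<forall>x y s. linear (\<lambda>z. F x y z s)) \<and> (\<forall>x y z. linear (\<lambda>s. F x y z s))"

lemma multilinear4_simps:
  assumes "multilinear4 F"
  shows "F (x + x') y z s = F x y z s + F x' y z s" "F x (y + y') z s = F x y z s + F x y' z s"
    "F x y (z + z') s = F x y z s + F x y z' s" "F x y z (s + s') = F x y z s + F x y z s'"
    "F (r *\<^sub>R x) y z s = r * F x y z s" "F x (r *\<^sub>R y) z s = r * F x y z s"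
    "F x y (r *\<^sub>R z) s = r * F x y z s" "F x y z (r *\<^sub>R s) = r * F x y z s"
  using assms by (auto simp: multilinear4_def linear_iff)

lemma multilinear4_diff:
  assumes "multilinear4 F"
  shows "F (x - x') y z s = F x y z s - F x' y z s" "F x (y - y') z s = F x y z s - F x y' z s"
    "F x y (z - z') s = F x y z s - F x y z' s" "F x y z (s - s') = F x y z s - F x y z s'"
  using multilinear4_simps[OF assms] by (metis add_diff_cancel_right' diff_add_cancel)+

text \<open>The operators act on \<open>F\<close> as a Lie algebra representation; the cross terms of the two orders cancel.\<close>

lemma derivation_act_commutator:
  assumes F: "multilinear4 F"
    and M: "\<And>x y z s. derivation_act M F x y z s = 0" and N: "\<And>x y z s. derivation_act N F x y z s = 0"
  shows "derivation_act (\<lambda>x. M (N x) - N (M x)) F x y z s = 0"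
proof -
  have "derivation_act M F (N x) y z s + derivation_act M F x (N y) z s
      + derivation_act M F x y (N z) s + derivation_act M F x y z (N s)
     - derivation_act N F (M x) y z s - derivation_act N F x (M y) z s
      - derivation_act N F x y (M z) s - derivation_act N F x y z (M s) = 0"
    by (simp add: M N)
  then show ?thesis
    by (simp add: derivation_act_def multilinear4_diff[OF F])
qed

section \<open>Linear symplectic geometry and invariant tensors\<close>

locale symplectic_space =
  fixes w :: "real ^ 'd::finite \<Rightarrow> real ^ 'd \<Rightarrow> real"
  assumes w_bilinear: "bilinear w"
    and w_skew: "w u v = - w v u"
    and w_nondeg: "(\<And>v. w u v = 0) \<Longrightarrow> u = 0"
begin

lemma w_simps:
  "w (a + b) c = w a c + w b c" "w c (a + b) = w c a + w c b"
  "w (a - b) c = w a c - w b c" "w c (a - b) = w c a - w c b"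
  "w (r *\<^sub>R a) c = r * w a c" "w c (r *\<^sub>R a) = r * w c a"
  using w_bilinear by (auto simp: bilinear_ladd bilinear_radd bilinear_lsub bilinear_rsub bilinear_lmul bilinear_rmul)

lemma w_self [simp]: "w a a = 0"
  using w_skew[of a a] by simp

lemma w_eqI: "(\<And>s. w a s = w b s) \<Longrightarrow> a = b"
  using w_nondeg[of "a - b"] by (simp add: w_simps)

lemma dual_vector: "z \<noteq> 0 \<Longrightarrow> \<exists>t. w z t = 1"
proof -
  assume "z \<noteq> 0"
  then obtain v where "w z v \<noteq> 0" using w_nondeg by blast
  then have "w z (inverse (w z v) *\<^sub>R v) = 1" by (simp add: w_simps)
  then show ?thesis by blast
qed

text \<open>\<open>pr\<close> projects along \<open>span {a, b}\<close> onto its symplectic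
  complement, nonzero since the dimension exceeds two. Projecting a partner \<open>t\<close> of
  \<open>pr v\<close> keeps its pairing with \<open>pr v\<close>, because \<open>pr v\<close> is
  orthogonal to \<open>a\<close> and \<open>b\<close>.\<close>

lemma dual_pair_perp:
  assumes "w a b = 1" "CARD('d) > 2"
  obtains x y where "w x y = 1" "w a x = 0" "w b x = 0" "w a y = 0" "w b y = 0"
proof -
  have "span {a, b} \<noteq> UNIV"
  proof
    assume e: "span {a, b} = UNIV"
    have "dim (span {a, b}) \<le> card {a, b}" by (simp add: dim_le_card')
    also have "\<dots> \<le> 2" by (simp add: card_insert_if)
    finally show False using assms(2) unfolding e by simp
  qed
  then obtain v where v: "v \<notin> span {a, b}" by blast
  define pr where "pr v = v - w v b *\<^sub>R a + w v a *\<^sub>R b" for v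
  have ba: "w b a = -1" using assms w_skew by metis
  have pr: "w a (pr v) = 0" "w b (pr v) = 0" for v
    using w_skew[of a v] w_skew[of b v] by (simp_all add: pr_def w_simps assms ba)
  have "pr v \<noteq> 0"
  proof
    assume "pr v = 0"
    then have "v = w v b *\<^sub>R a - w v a *\<^sub>R b" by (simp add: pr_def algebra_simps)
    also have "\<dots> \<in> span {a, b}" by (intro span_diff span_scale span_base) auto
    finally show False using v by simp
  qed
  then obtain t where t: "w (pr v) t = 1" using dual_vector by blast
  have "w (pr v) (pr t) = 1"
    using w_skew[of "pr v" a] w_skew[of "pr v" b] pr[of v] t by (simp add: pr_def[of t] w_simps)
  then show ?thesis using that pr by blast
qed

lemma linear_functional_repr:
  fixes u :: "real ^ 'd \<Rightarrow> real"
  assumes "linear u"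
  obtains U where "\<And>z. u z = w U z"
proof -
  define J where "J v = (\<chi> i. w v (axis i 1))" for v
  have lw: "linear (w v)" for v using w_bilinear by (simp add: bilinear_def)
  have "linear J" by (intro linearI) (simp_all add: J_def vec_eq_iff w_simps)
  moreover have "inj J"
  proof (rule injI)
    fix a b assume "J a = J b"
    then have "w a (axis i 1) = w b (axis i 1)" for i by (simp add: J_def vec_eq_iff)
    then show "a = b" by (intro w_eqI) (metis (no_types, lifting) linear_axis_expand[OF lw] sum.cong)
  qed
  ultimately have "surj J" using linear_injective_imp_surjective by blast
  then obtain U where "J U = (\<chi> i. u (axis i 1))" by (metis surjD)
  then have "w U (axis i 1) = u (axis i 1)" for i by (simp add: J_def vec_eq_iff)
  then have "u z = w U z" for z by (simp add: linear_axis_expand[OF lw, of _ z] linear_axis_expand[OF assms, of z])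
  then show ?thesis using that by blast
qed

text \<open>\<open>N a b\<close> is the element of the symplectic Lie algebra corresponding to the symmetric
  product of \<open>a\<close> and \<open>b\<close>.\<close>

definition N :: "real ^ 'd \<Rightarrow> real ^ 'd \<Rightarrow> real ^ 'd \<Rightarrow> real ^ 'd"
  where "N a b z = w a z *\<^sub>R b + w b z *\<^sub>R a"

text \<open>A weight argument: for \<open>w z t = 1\<close> the operator \<open>N z t\<close> has
  eigenvalue -1 on \<open>z\<close>, 1 on \<open>t\<close> and 0 on their complement. Invariance of
  \<open>F x y z z\<close> leaves only the part where \<open>x\<close> and \<open>y\<close> both
  have weight 1, that is \<open>F t t z z\<close>, which is zero by skewness. Polarisation in
  \<open>z\<close> and the symmetry of the last two slots give all of \<open>F\<close>.\<close>

lemma N_invariant_zero: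
  assumes F: "multilinear4 F" and skew: "\<And>x y z s. F x y z s = - F y x z s"
    and sym: "\<And>x y z s. F x y z s = F x y s z"
    and inv: "\<And>a b x y z s. derivation_act (N a b) F x y z s = 0"
  shows "F x y z s = 0"
proof -
  have diag: "F x y z z = 0" for x y z
  proof (cases "z = 0")
    case True
    then show ?thesis using multilinear4_simps(7)[OF F, of x y 0 z z] by simp
  next
    case False
    then obtain t where t: "w z t = 1" using dual_vector by blast
    have tz: "w t z = -1" using t w_skew by metis
    have Nz: "N z t z = - z" and Nt: "N z t t = t" by (simp_all add: N_def t tz)
    have m: "F x y (- z) z = - F x y z z" "F x y z (- z) = - F x y z z" for x y
      using multilinear4_simps(7)[OF F, of x y "-1" z z] multilinear4_simps(8)[OF F, of x y z "-1" z] by simp_all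
    have e: "F (N z t x) y z z + F x (N z t y) z z = 2 * F x y z z" for x y
      using inv[of z t x y z z] by (simp add: derivation_act_def Nz m)
    have self: "F a a z z = 0" for a using skew[of a a z z] by simp
    have zt: "F z t z z = 0"
      using e[of z t] multilinear4_simps(5)[OF F, of "-1" z t z z] by (simp add: Nz Nt)
    then have tz0: "F t z z z = 0" using skew[of t z z z] by simp
    have xt: "F x t z z = 0" for x
      using e[of x t] by (simp add: Nt) (simp add: N_def multilinear4_simps[OF F] self zt)
    have xz: "F x z z z = 0" for x
      using e[of x z] multilinear4_simps(6)[OF F, of x "-1" z z z]
      by (simp add: Nz) (simp add: N_def multilinear4_simps[OF F] self tz0)
    have "F (N z t x) y z z = 0" for x y
      using xt[of y] xz[of y] skew[of t y z z] skew[of z y z z] by (simp add: N_def multilinear4_simps[OF F])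
    moreover have "F x (N z t y) z z = 0"
      using xt xz by (simp add: N_def multilinear4_simps[OF F])
    ultimately show ?thesis using e[of x y] by simp
  qed
  have "F x y (z + s) (z + s) = 0" by (rule diag)
  then show ?thesis
    using diag[of x y z] diag[of x y s] sym[of x y s z] by (simp add: multilinear4_simps[OF F])
qed

text \<open>The action of \<open>N a b\<close> on \<open>F\<close> is symmetric and bilinear in
  \<open>a\<close> and \<open>b\<close>. With \<open>w U y0 = 1\<close>, specialisations of
  \<open>inv\<close> kill \<open>N V x\<close> for all \<open>V\<close> and all \<open>x\<close>
  orthogonal to \<open>U\<close>. What remains is \<open>N y0 y0\<close>, a commutator of operators
  already known to act trivially.\<close>

lemma act_N_zero:
  assumes F: "multilinear4 F" and dim: "CARD('d) > 2" and U: "U \<noteq> 0"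
    and inv: "\<And>V x y z1 z2 z3 z4. w V y * derivation_act (N U x) F z1 z2 z3 z4
      + w U y * derivation_act (N V x) F z1 z2 z3 z4 - w V x * derivation_act (N U y) F z1 z2 z3 z4
      - w U x * derivation_act (N V y) F z1 z2 z3 z4 + 2 * w x y * derivation_act (N V U) F z1 z2 z3 z4 = 0"
  shows "derivation_act (N a b) F z1 z2 z3 z4 = 0"
proof -
  define D where "D a b = derivation_act (N a b) F" for a b
  have Dsym: "D a b z1 z2 z3 z4 = D b a z1 z2 z3 z4" for a b z1 z2 z3 z4
    by (simp add: D_def N_def derivation_act_def add.commute)
  have Dlin: "D (a + a') b z1 z2 z3 z4 = D a b z1 z2 z3 z4 + D a' b z1 z2 z3 z4"
    "D (r *\<^sub>R a) b z1 z2 z3 z4 = r * D a b z1 z2 z3 z4" for a a' b r z1 z2 z3 z4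
    by (simp_all add: D_def N_def derivation_act_def w_simps multilinear4_simps[OF F] algebra_simps)
  have inv': "w V y * D U x z1 z2 z3 z4 + w U y * D V x z1 z2 z3 z4 - w V x * D U y z1 z2 z3 z4
      - w U x * D V y z1 z2 z3 z4 + 2 * w x y * D V U z1 z2 z3 z4 = 0" for V x y z1 z2 z3 z4
    using inv by (simp add: D_def)
  obtain y0 where y0: "w U y0 = 1" using dual_vector U by blast
  obtain p q where pq: "w p q = 1" "w U p = 0" "w y0 p = 0" "w U q = 0" "w y0 q = 0"
    using dual_pair_perp[OF y0 dim] by metis
  have UU: "D U U z1 z2 z3 z4 = 0" for z1 z2 z3 z4
    using inv'[of U y0 U z1 z2 z3 z4] y0 by simp
  have Ux: "D U x z1 z2 z3 z4 = 0" if "w U x = 0" for x z1 z2 z3 z4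
    using inv'[of U y0 x z1 z2 z3 z4] y0 that UU by simp
  \<comment> \<open>On a symplectic pair orthogonal to \<open>U\<close> only the last term is left,
    since \<open>D U p\<close> and \<open>D U q\<close> already vanish.\<close>
  have VU: "D V U z1 z2 z3 z4 = 0" for V z1 z2 z3 z4
    using inv'[of V q p z1 z2 z3 z4] pq Ux by simp
  then have UV: "D U V z1 z2 z3 z4 = 0" for V z1 z2 z3 z4
    using Dsym by metis
  have xV: "D V x z1 z2 z3 z4 = 0" if "w U x = 0" for x V z1 z2 z3 z4
    using inv'[of V y0 x z1 z2 z3 z4] y0 that VU UV by simp
  have yy: "D y0 y0 z1 z2 z3 z4 = 0" for z1 z2 z3 z4
  proof -
    \<comment> \<open>For \<open>p\<close> and \<open>q\<close> orthogonal to \<open>y0\<close> this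
      commutator is \<open>w p q\<close> times \<open>N y0 y0\<close>.\<close>
    have "derivation_act (\<lambda>x. N y0 p (N y0 q x) - N y0 q (N y0 p x)) F z1 z2 z3 z4 = 0"
      by (rule derivation_act_commutator[OF F]) (use xV pq in \<open>simp_all add: D_def\<close>)
    moreover have "(\<lambda>x. N y0 p (N y0 q x) - N y0 q (N y0 p x)) = N y0 y0"
      using pq w_skew[of q p] w_skew[of p y0] w_skew[of q y0]
      by (simp add: N_def fun_eq_iff w_simps algebra_simps)
    ultimately show ?thesis by (simp add: D_def)
  qed
  have dec: "w U (v - w U v *\<^sub>R y0) = 0" for v by (simp add: w_simps y0)
  have Dy0: "D y0 b z1 z2 z3 z4 = 0" for b
  proof -
    have "D y0 b z1 z2 z3 z4 = D ((b - w U b *\<^sub>R y0) + w U b *\<^sub>R y0) y0 z1 z2 z3 z4"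
      using Dsym by simp
    also have "\<dots> = D y0 (b - w U b *\<^sub>R y0) z1 z2 z3 z4 + w U b * D y0 y0 z1 z2 z3 z4"
      by (simp only: Dlin Dsym[of y0 "b - w U b *\<^sub>R y0"])
    finally show ?thesis using xV[OF dec] yy by simp
  qed
  have "D a b z1 z2 z3 z4 = D ((a - w U a *\<^sub>R y0) + w U a *\<^sub>R y0) b z1 z2 z3 z4" by simp
  also have "\<dots> = D b (a - w U a *\<^sub>R y0) z1 z2 z3 z4 + w U a * D y0 b z1 z2 z3 z4"
    by (simp only: Dlin Dsym[of b "a - w U a *\<^sub>R y0"])
  also have "\<dots> = 0" using xV[OF dec] Dy0 by simp
  finally show ?thesis by (simp add: D_def)
qed

section \<open>Solving the second Bianchi identity for the derivative of Ricci\<close>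

abbreviation K where "K \<equiv> kulkarni_nomizu w"

text \<open>On the diagonal \<open>s = z\<close> the identity forces \<open>T z z z = 0\<close>, and
  with this it makes \<open>T v z z\<close> a multiple of \<open>w v z\<close> whose factor does not
  depend on \<open>v\<close>. That factor is linear in \<open>z\<close>, hence represented by a
  vector, and polarisation recovers \<open>T\<close>.\<close>

lemma bianchi_solution:
  fixes T :: "real ^ 'd \<Rightarrow> real ^ 'd \<Rightarrow> real ^ 'd \<Rightarrow> real"
  assumes lin: "\<And>y z. linear (\<lambda>v. T v y z)" "\<And>v z. linear (\<lambda>y. T v y z)"
    and sym: "\<And>v y z. T v y z = T v z y" and dim: "CARD('d) > 2"
    and bianchi: "\<And>v x y z s. K (T v) x y z s + K (T x) y v z s + K (T y) v x z s = 0"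
  obtains U where "\<And>v z s. 2 * T v z s = w v z * w U s + w v s * w U z"
proof -
  have Tadd: "T (a + b) y z = T a y z + T b y z" "T v (a + b) z = T v a z + T v b z"
     "T (r *\<^sub>R a) y z = r * T a y z" "T v (r *\<^sub>R a) z = r * T v a z" for a b r v y z
    using lin by (auto simp: linear_iff)
  have Tadd': "T v z (a + b) = T v z a + T v z b" "T v z (r *\<^sub>R a) = r * T v z a" for a b r v z
    using Tadd sym by metis+
  \<comment> \<open>For \<open>s = z\<close> the first four terms of the product coincide in pairs,
    so a common factor 2 is divided out.\<close>
  have star: "(T v y z - T y v z) * w x z + (T x v z - T v x z) * w y z + (T y x z - T x y z) * w v z
     + w x y * T v z z + w y v * T x z z + w v x * T y z z = 0" for v x y z
    using bianchi[of v x y z z] by (simp add: kulkarni_nomizu_def algebra_simps)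
  have cubic: "T z z z = 0" for z
  proof (cases "z = 0")
    case True
    then show ?thesis using Tadd(3)[of 0 z z z] by simp
  next
    case False
    then obtain t where "w z t = 1" using dual_vector by blast
    then obtain x y where "w x y = 1" "w z x = 0" "w z y = 0"
      using dual_pair_perp[OF _ dim] by metis
    \<comment> \<open>With \<open>v = z\<close> and a symplectic pair \<open>x\<close>,
      \<open>y\<close> orthogonal to \<open>z\<close>, only \<open>w x y * T z z z\<close>
      survives.\<close>
    then show ?thesis using star[of z y z x] w_skew[of x z] w_skew[of y z] by simp
  qed
  have cyc: "T v z z = - 2 * T z v z" for v z
  proof -
    \<comment> \<open>The cubic polynomial in \<open>r\<close> vanishes identically; its linear
      coefficient is the claim, extracted from the values at 1 and -1.\<close>
    have "T (z + r *\<^sub>R v) (z + r *\<^sub>R v) (z + r *\<^sub>R v) = 0" for r by (rule cubic)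
    then have e: "T z z z + r * (T v z z + 2 * T z v z) + r\<^sup>2 * (T z v v + 2 * T v v z) + r^3 * T v v v = 0" for r
      using sym by (simp add: Tadd Tadd' power2_eq_square power3_eq_cube algebra_simps)
    show ?thesis using e[of 1] e[of "-1"] cubic[of z] cubic[of v] by simp
  qed
  have hom: "w y z * T v z z = w v z * T y z z" for v y z
  proof -
    have "T v z z = - 2 * T z v z" "T y z z = - 2 * T z y z" using cyc by auto
    then show ?thesis
      \<comment> \<open>Putting \<open>x = z\<close> in \<open>star\<close> and eliminating
        \<open>T z v z\<close> and \<open>T z y z\<close> by \<open>cyc\<close> yields 5/2 times the
        difference of the two sides.\<close>
      using star[of v y z z] cubic[of z] w_skew[of z y] w_skew[of z v] sym[of z z v] sym[of z z y]
      by (simp add: algebra_simps)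
  qed
  obtain a b where ab: "w a b = 1"
  proof -
    have "axis undefined 1 \<noteq> (0 :: real ^ 'd)" by (simp add: axis_eq_0_iff)
    then show ?thesis using dual_vector that by blast
  qed
  \<comment> \<open>Forced by the goal \<open>T a z z = w a z * u z\<close>: polarised with
    \<open>b\<close> it reads 2 T(a; b, z) = u(z) + w(a, z) u(b), and u(b) = T(a; b, b).\<close>
  define u where "u z = 2 * T a b z - w a z * T a b b" for z
  have lu: "linear u" by (intro linearI) (simp_all add: u_def Tadd' w_simps algebra_simps)
  have Ta: "T a z z = w a z * u z" for z
  proof -
    define z0 where "z0 = z - w a z *\<^sub>R b"
    have "w a z0 = 0" by (simp add: z0_def w_simps ab)
    then have z0: "T a z0 z0 = 0"
    proof (cases "z0 = 0")
      case False
      then obtain t where "w z0 t = 1" using dual_vector by blast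
      then have "w t z0 \<noteq> 0" using w_skew[of t z0] by simp
      then show ?thesis using hom[of t z0 a] \<open>w a z0 = 0\<close> by simp
    qed (use Tadd(4)[of a 0 z0 z0] in simp)
    have "z = z0 + w a z *\<^sub>R b" by (simp add: z0_def)
    then have "T a z z = T a (z0 + w a z *\<^sub>R b) (z0 + w a z *\<^sub>R b)" by simp
    also have "\<dots> = 2 * w a z * T a b z0 + (w a z)\<^sup>2 * T a b b"
      using z0 sym[of a z0 b] by (simp add: Tadd Tadd' power2_eq_square algebra_simps)
    also have "T a b z0 = T a b z - w a z * T a b b"
      using Tadd'(1)[of a b z0 "w a z *\<^sub>R b"] Tadd'(2)[of a b "w a z" b] \<open>z = z0 + w a z *\<^sub>R b\<close> by simp
    finally show ?thesis by (simp add: u_def power2_eq_square algebra_simps)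
  qed
  have generic: "T v z z = w v z * u z" if "w a z \<noteq> 0" for v z
    using hom[of a z v] Ta[of z] that by simp
  have Tu: "T v z z = w v z * u z" for v z
  proof (cases "w a z = 0")
    case True
    text \<open>Both sides are quadratic along \<open>z + r b\<close> and agree for \<open>r \<noteq> 0\<close>.\<close>
    have "T v (z + r *\<^sub>R b) (z + r *\<^sub>R b) = w v (z + r *\<^sub>R b) * u (z + r *\<^sub>R b)" if "r \<noteq> 0" for r
      by (rule generic) (use True ab that in \<open>simp add: w_simps\<close>)
    then have e: "T v z z - w v z * u z + r * (2 * T v b z - w v b * u z - w v z * u b) + r\<^sup>2 * (T v b b - w v b * u b) = 0"
      if "r \<noteq> 0" for r
      using that sym[of v z b] by (simp add: Tadd Tadd' w_simps linear_add[OF lu] linear_scale[OF lu] power2_eq_square algebra_simps)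
    show ?thesis using e[of 1] e[of "-1"] e[of 2] by simp
  qed (rule generic)
  obtain U where U: "\<And>z. u z = w U z" using linear_functional_repr[OF lu] by metis
  have "2 * T v z s = w v z * w U s + w v s * w U z" for v z s
    using Tu[of v "z + s"] Tu[of v z] Tu[of v s] sym[of v s z]
    by (simp add: Tadd Tadd' w_simps U algebra_simps)
  then show ?thesis using that by blast
qed

text \<open>The whole argument at one point, free of manifolds. \<open>E v x y\<close> stands for
  the derivative of the curvature operator, \<open>F\<close> for the Weyl tensor and
  \<open>k\<close> for its constant.\<close>

lemma pointwise_alternative:
  fixes T :: "real ^ 'd \<Rightarrow> real ^ 'd \<Rightarrow> real ^ 'd \<Rightarrow> real"
  assumes lin: "\<And>y z. linear (\<lambda>v. T v y z)" "\<And>v z. linear (\<lambda>y. T v y z)"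
    and sym: "\<And>v y z. T v y z = T v z y" and dim: "CARD('d) > 2"
    and bianchi: "\<And>v x y z s. K (T v) x y z s + K (T x) y v z s + K (T y) v x z s = 0"
    and F: "multilinear4 F" "\<And>x y z s. F x y z s = - F y x z s" "\<And>x y z s. F x y z s = F x y s z"
    and k: "k \<noteq> 0" "\<And>v x y z s. w (E v x y z) s = k * K (T v) x y z s"
    and inv: "\<And>v x y z1 z2 z3 z4. derivation_act (E v x y) F z1 z2 z3 z4 = 0"
  shows "(\<forall>v y z. T v y z = 0) \<or> (\<forall>x y z s. F x y z s = 0)"
proof -
  obtain U where U: "\<And>v z s. 2 * T v z s = w v z * w U s + w v s * w U z"
    using bianchi_solution[OF lin sym dim bianchi] by metis
  show ?thesis
  proof (cases "U = 0")
    case True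
    have "w U s = 0" for s using w_simps(5)[of 0 U s] True by simp
    then have "T v y z = 0" for v y z using U[of v y z] by simp
    then show ?thesis by blast
  next
    case False
    \<comment> \<open>Obtained by comparing pairings with an arbitrary \<open>s\<close>, where
      \<open>w (N a b z) s = w a z * w b s + w b z * w a s\<close>.\<close>
    have E: "E v x y z = (k / 2) *\<^sub>R (w v y *\<^sub>R N U x z + w U y *\<^sub>R N v x z + (- w v x) *\<^sub>R N U y z
         + (- w U x) *\<^sub>R N v y z + (2 * w x y) *\<^sub>R N v U z)" for v x y z
    proof (rule w_eqI)
      fix s
      have T: "T v z s = (w v z * w U s + w v s * w U z) / 2" for v z s using U[of v z s] by simp
      show "w (E v x y z) s = w ((k / 2) *\<^sub>R (w v y *\<^sub>R N U x z + w U y *\<^sub>R N v x z + (- w v x) *\<^sub>R N U y z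
         + (- w U x) *\<^sub>R N v y z + (2 * w x y) *\<^sub>R N v U z)) s"
        unfolding k by (simp add: kulkarni_nomizu_def T N_def w_simps field_simps)
    qed
    have "w v y * derivation_act (N U x) F z1 z2 z3 z4
      + w U y * derivation_act (N v x) F z1 z2 z3 z4 - w v x * derivation_act (N U y) F z1 z2 z3 z4
      - w U x * derivation_act (N v y) F z1 z2 z3 z4 + 2 * w x y * derivation_act (N v U) F z1 z2 z3 z4 = 0"
      for v x y z1 z2 z3 z4
    proof -
      have "derivation_act (E v x y) F z1 z2 z3 z4 = (k / 2) * (w v y * derivation_act (N U x) F z1 z2 z3 z4
      + w U y * derivation_act (N v x) F z1 z2 z3 z4 - w v x * derivation_act (N U y) F z1 z2 z3 z4
      - w U x * derivation_act (N v y) F z1 z2 z3 z4 + 2 * w x y * derivation_act (N v U) F z1 z2 z3 z4)"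
        by (simp only: derivation_act_def E multilinear4_simps[OF F(1)]) algebra
      then show ?thesis using inv k by simp
    qed
    then have "derivation_act (N a b) F z1 z2 z3 z4 = 0" for a b z1 z2 z3 z4
      by (intro act_N_zero[OF F(1) dim False])
    then have "F x y z s = 0" for x y z s by (intro N_invariant_zero[OF F])
    then show ?thesis by blast
  qed
qed

end

section \<open>Calculus on a Fedosov manifold\<close>

locale fedosov =
  fixes A :: "('m::{t2_space, second_countable_topology}, 'd::finite) chart set"
    and \<omega> :: "'m \<Rightarrow> real ^ 'd \<Rightarrow> real ^ 'd \<Rightarrow> real"
    and nabla :: "('m \<Rightarrow> real ^ 'd) \<Rightarrow> ('m \<Rightarrow> real ^ 'd) \<Rightarrow> ('m \<Rightarrow> real ^ 'd)"
  assumes fed: "fedosov_manifold A \<omega> nabla"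
begin

sublocale smooth_manifold A
  using fed by unfold_locales (simp add: fedosov_manifold_def)

sublocale symp: symplectic_space "\<omega> p" for p
proof
  have "symplectic_form A \<omega>" using fed by (simp add: fedosov_manifold_def)
  then show "bilinear (\<omega> p)" "\<omega> p u v = - \<omega> p v u" "(\<And>v. \<omega> p u v = 0) \<Longrightarrow> u = 0" for u v
    unfolding symplectic_form_def by blast+
qed

lemmas omega_simps = symp.w_simps

abbreviation smooth_field :: "('m \<Rightarrow> real ^ 'd) \<Rightarrow> bool"
  where "smooth_field X \<equiv> smooth_vf A X"

abbreviation X_deriv :: "('m \<Rightarrow> real ^ 'd) \<Rightarrow> ('m \<Rightarrow> real) \<Rightarrow> 'm \<Rightarrow> real"
  where "X_deriv X f \<equiv> vf_deriv A X f"

lemma conn: "affine_connection A nabla"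
  using fed by (simp add: fedosov_manifold_def)

lemma smooth_nabla: "smooth_field X \<Longrightarrow> smooth_field Y \<Longrightarrow> smooth_field (nabla X Y)"
  using conn by (simp add: affine_connection_def)

declare smooth_nabla [simp] smooth_vf_add [simp] smooth_vf_diff [simp] smooth_vf_minus [simp]
  smooth_vf_scale [simp] smooth_fun_add [simp] smooth_fun_diff [simp] smooth_fun_mult [simp]
  smooth_fun_minus [simp] smooth_fun_const [simp] smooth_fun_vf_deriv [simp] vf_ext [simp]

lemma nabla_add_left: "smooth_field X \<Longrightarrow> smooth_field X' \<Longrightarrow> smooth_field Y \<Longrightarrow>
    nabla (\<lambda>q. X q + X' q) Y = (\<lambda>p. nabla X Y p + nabla X' Y p)"
  using conn by (auto simp: affine_connection_def fun_eq_iff)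

lemma nabla_add_right: "smooth_field X \<Longrightarrow> smooth_field Y \<Longrightarrow> smooth_field Y' \<Longrightarrow>
    nabla X (\<lambda>q. Y q + Y' q) = (\<lambda>p. nabla X Y p + nabla X Y' p)"
  using conn by (auto simp: affine_connection_def fun_eq_iff)

lemma nabla_scale_left: "smooth_fun A f \<Longrightarrow> smooth_field X \<Longrightarrow> smooth_field Y \<Longrightarrow>
    nabla (\<lambda>q. f q *\<^sub>R X q) Y = (\<lambda>p. f p *\<^sub>R nabla X Y p)"
  using conn by (auto simp: affine_connection_def fun_eq_iff)

lemma nabla_scale_right: "smooth_fun A f \<Longrightarrow> smooth_field X \<Longrightarrow> smooth_field Y \<Longrightarrow>
    nabla X (\<lambda>q. f q *\<^sub>R Y q) = (\<lambda>p. X_deriv X f p *\<^sub>R Y p + f p *\<^sub>R nabla X Y p)"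
  using conn by (auto simp: affine_connection_def fun_eq_iff)

lemma nabla_minus_left: "smooth_field X \<Longrightarrow> smooth_field Y \<Longrightarrow> nabla (\<lambda>q. - X q) Y = (\<lambda>p. - nabla X Y p)"
  using nabla_scale_left[of "\<lambda>q. -1" X Y] by simp

lemma nabla_minus_right: "smooth_field X \<Longrightarrow> smooth_field Y \<Longrightarrow> nabla X (\<lambda>q. - Y q) = (\<lambda>p. - nabla X Y p)"
  using nabla_scale_right[of "\<lambda>q. -1" X Y] by (simp add: vf_deriv_const)

lemma nabla_diff_left: "smooth_field X \<Longrightarrow> smooth_field X' \<Longrightarrow> smooth_field Y \<Longrightarrow>
    nabla (\<lambda>q. X q - X' q) Y = (\<lambda>p. nabla X Y p - nabla X' Y p)"
  using nabla_add_left[of X "\<lambda>q. - X' q" Y] by (simp add: nabla_minus_left)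

lemma nabla_diff_right: "smooth_field X \<Longrightarrow> smooth_field Y \<Longrightarrow> smooth_field Y' \<Longrightarrow>
    nabla X (\<lambda>q. Y q - Y' q) = (\<lambda>p. nabla X Y p - nabla X Y' p)"
  using nabla_add_right[of X Y "\<lambda>q. - Y' q"] by (simp add: nabla_minus_right)

lemmas nabla_simps = nabla_add_left nabla_add_right nabla_scale_left nabla_scale_right
  nabla_diff_left nabla_diff_right nabla_minus_left nabla_minus_right

lemma lie_bracket_nabla:
  "smooth_field X \<Longrightarrow> smooth_field Y \<Longrightarrow> lie_bracket A X Y = (\<lambda>p. nabla X Y p - nabla Y X p)"
  using fed unfolding fedosov_manifold_def torsion_free_def fun_eq_iff by metis

lemma smooth_lie_bracket [simp]:
  "smooth_field X \<Longrightarrow> smooth_field Y \<Longrightarrow> smooth_field (lie_bracket A X Y)"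
  by (simp add: lie_bracket_nabla)

lemma vf_deriv_lie_bracket_fun:
  "smooth_field X \<Longrightarrow> smooth_field Y \<Longrightarrow> smooth_fun A f \<Longrightarrow>
    X_deriv (lie_bracket A X Y) f = (\<lambda>p. X_deriv X (X_deriv Y f) p - X_deriv Y (X_deriv X f) p)"
  using vf_deriv_lie_bracket by (simp add: fun_eq_iff)

text \<open>As derivations of smooth functions, brackets are commutators, and the cyclic sum cancels
  formally.\<close>

lemma jacobi:
  assumes "smooth_field X" "smooth_field Y" "smooth_field Z"
  shows "lie_bracket A (lie_bracket A X Y) Z p + lie_bracket A (lie_bracket A Y Z) X p
    + lie_bracket A (lie_bracket A Z X) Y p = 0"
proof (rule vf_deriv_separates[where X = "\<lambda>p. lie_bracket A (lie_bracket A X Y) Z p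
    + lie_bracket A (lie_bracket A Y Z) X p + lie_bracket A (lie_bracket A Z X) Y p"])
  fix f assume "smooth_fun A f"
  then show "X_deriv (\<lambda>p. lie_bracket A (lie_bracket A X Y) Z p
    + lie_bracket A (lie_bracket A Y Z) X p + lie_bracket A (lie_bracket A Z X) Y p) f p = 0"
    using assms by (simp add: vf_deriv_field_add vf_deriv_lie_bracket_fun vf_deriv_diff)
qed (use assms in simp)

text \<open>The chosen extensions \<open>vf_ext\<close> need not be additive in the vector;
  tensoriality absorbs the difference between the extension of a sum and the sum of the
  extensions.\<close>

lemma tensorial_linear:
  fixes \<Phi> :: "('m \<Rightarrow> real ^ 'd) \<Rightarrow> 'b::real_vector"
  assumes add: "\<And>X Y. smooth_field X \<Longrightarrow> smooth_field Y \<Longrightarrow> \<Phi> (\<lambda>q. X q + Y q) = \<Phi> X + \<Phi> Y"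
    and scale: "\<And>f X. smooth_fun A f \<Longrightarrow> smooth_field X \<Longrightarrow> \<Phi> (\<lambda>q. f q *\<^sub>R X q) = f p *\<^sub>R \<Phi> X"
  shows "linear (\<lambda>v. \<Phi> (vf_ext A p v))"
proof (rule linearI)
  fix u v
  show "\<Phi> (vf_ext A p (u + v)) = \<Phi> (vf_ext A p u) + \<Phi> (vf_ext A p v)"
    by (subst add[symmetric]) (auto intro!: tensorial[where p = p and \<Phi> = \<Phi>, OF add scale])
next
  fix r v
  show "\<Phi> (vf_ext A p (r *\<^sub>R v)) = r *\<^sub>R \<Phi> (vf_ext A p v)"
    by (subst scale[of "\<lambda>q. r", symmetric]) (auto intro!: tensorial[where p = p and \<Phi> = \<Phi>, OF add scale])
qed

subsection \<open>Curvature\<close>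

abbreviation R :: "('m \<Rightarrow> real ^ 'd) \<Rightarrow> ('m \<Rightarrow> real ^ 'd) \<Rightarrow> ('m \<Rightarrow> real ^ 'd) \<Rightarrow> 'm \<Rightarrow> real ^ 'd"
  where "R X Y Z \<equiv> curvature_vf A nabla X Y Z"

text \<open>Torsion-freeness removes the bracket, so the curvature identities become rewriting with
  the rules of \<open>nabla\<close>.\<close>

lemma R_eq: "smooth_field X \<Longrightarrow> smooth_field Y \<Longrightarrow> smooth_field Z \<Longrightarrow>
   R X Y Z = (\<lambda>p. nabla X (nabla Y Z) p - nabla Y (nabla X Z) p - (nabla (nabla X Y) Z p - nabla (nabla Y X) Z p))"
  by (simp add: fun_eq_iff curvature_vf_def lie_bracket_nabla nabla_simps)

lemma smooth_R [simp]: "smooth_field X \<Longrightarrow> smooth_field Y \<Longrightarrow> smooth_field Z \<Longrightarrow> smooth_field (R X Y Z)"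
  by (simp add: R_eq)

lemma R_skew: "smooth_field X \<Longrightarrow> smooth_field Y \<Longrightarrow> smooth_field Z \<Longrightarrow> R Y X Z p = - R X Y Z p"
  by (simp add: R_eq)

lemma R_add1: "smooth_field X \<Longrightarrow> smooth_field X' \<Longrightarrow> smooth_field Y \<Longrightarrow> smooth_field Z \<Longrightarrow>
    R (\<lambda>q. X q + X' q) Y Z p = R X Y Z p + R X' Y Z p"
  by (simp add: R_eq nabla_simps)

lemma R_scale1: "smooth_fun A f \<Longrightarrow> smooth_field X \<Longrightarrow> smooth_field Y \<Longrightarrow> smooth_field Z \<Longrightarrow>
    R (\<lambda>q. f q *\<^sub>R X q) Y Z p = f p *\<^sub>R R X Y Z p"
  by (simp add: R_eq nabla_simps algebra_simps)

lemma R_add2: "smooth_field X \<Longrightarrow> smooth_field Y' \<Longrightarrow> smooth_field Y \<Longrightarrow> smooth_field Z \<Longrightarrow>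
    R X (\<lambda>q. Y q + Y' q) Z p = R X Y Z p + R X Y' Z p"
  by (simp add: R_eq nabla_simps)

lemma R_scale2: "smooth_fun A f \<Longrightarrow> smooth_field X \<Longrightarrow> smooth_field Y \<Longrightarrow> smooth_field Z \<Longrightarrow>
    R X (\<lambda>q. f q *\<^sub>R Y q) Z p = f p *\<^sub>R R X Y Z p"
  by (simp add: R_eq nabla_simps algebra_simps)

lemma R_add3: "smooth_field X \<Longrightarrow> smooth_field Y \<Longrightarrow> smooth_field Z \<Longrightarrow> smooth_field Z' \<Longrightarrow>
    R X Y (\<lambda>q. Z q + Z' q) p = R X Y Z p + R X Y Z' p"
  by (simp add: R_eq nabla_simps)

text \<open>Terms with one derivative of \<open>f\<close> on a differentiated \<open>Z\<close> are
  symmetric in \<open>X\<close> and \<open>Y\<close> and cancel; the commutator of second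
  derivatives of \<open>f\<close> is cancelled by the derivative along the bracket.\<close>

lemma R_scale3:
  assumes "smooth_fun A f" "smooth_field X" "smooth_field Y" "smooth_field Z"
  shows "R X Y (\<lambda>q. f q *\<^sub>R Z q) p = f p *\<^sub>R R X Y Z p"
proof -
  have "X_deriv (nabla X Y) f p - X_deriv (nabla Y X) f p = X_deriv X (X_deriv Y f) p - X_deriv Y (X_deriv X f) p"
    using vf_deriv_lie_bracket[of X Y f p] assms by (simp add: lie_bracket_nabla vf_deriv_field_diff)
  then have e: "X_deriv (nabla X Y) f p = X_deriv (nabla Y X) f p + X_deriv X (X_deriv Y f) p - X_deriv Y (X_deriv X f) p"
    by simp
  show ?thesis
    using assms by (simp add: R_eq nabla_simps e algebra_simps)
qed

definition Rt :: "'m \<Rightarrow> real ^ 'd \<Rightarrow> real ^ 'd \<Rightarrow> real ^ 'd \<Rightarrow> real ^ 'd"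
  where "Rt p x y z = R (vf_ext A p x) (vf_ext A p y) (vf_ext A p z) p"

lemma R_tensor:
  assumes "smooth_field X" "smooth_field Y" "smooth_field Z"
  shows "R X Y Z p = Rt p (X p) (Y p) (Z p)"
proof -
  have "R X Y Z p = R (vf_ext A p (X p)) Y Z p"
    by (rule tensorial[where p = p and \<Phi> = "\<lambda>X. R X Y Z p"])
      (use assms in \<open>auto simp: R_add1 R_scale1\<close>)
  also have "\<dots> = R (vf_ext A p (X p)) (vf_ext A p (Y p)) Z p"
    by (rule tensorial[where p = p and \<Phi> = "\<lambda>Y. R (vf_ext A p (X p)) Y Z p"])
      (use assms in \<open>auto simp: R_add2 R_scale2\<close>)
  also have "\<dots> = R (vf_ext A p (X p)) (vf_ext A p (Y p)) (vf_ext A p (Z p)) p"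
    by (rule tensorial[where p = p and \<Phi> = "\<lambda>Z. R (vf_ext A p (X p)) (vf_ext A p (Y p)) Z p"])
      (use assms in \<open>auto simp: R_add3 R_scale3\<close>)
  finally show ?thesis by (simp add: Rt_def)
qed

lemma linear_Rt1: "linear (\<lambda>x. Rt p x y z)"
  unfolding Rt_def
  by (rule tensorial_linear[where p = p and \<Phi> = "\<lambda>X. R X (vf_ext A p y) (vf_ext A p z) p"])
    (simp_all add: R_add1 R_scale1)

lemma linear_Rt2: "linear (\<lambda>y. Rt p x y z)"
  unfolding Rt_def
  by (rule tensorial_linear[where p = p and \<Phi> = "\<lambda>Y. R (vf_ext A p x) Y (vf_ext A p z) p"])
    (simp_all add: R_add2 R_scale2)

lemma linear_Rt3: "linear (\<lambda>z. Rt p x y z)"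
  unfolding Rt_def
  by (rule tensorial_linear[where p = p and \<Phi> = "\<lambda>Z. R (vf_ext A p x) (vf_ext A p y) Z p"])
    (simp_all add: R_add3 R_scale3)

lemma smooth_omega [simp]:
  "smooth_field X \<Longrightarrow> smooth_field Y \<Longrightarrow> smooth_fun A (\<lambda>q. \<omega> q (X q) (Y q))"
  using fed unfolding fedosov_manifold_def symplectic_form_def by blast

lemma vf_deriv_omega:
  assumes "smooth_field V" "smooth_field X" "smooth_field Y"
  shows "X_deriv V (\<lambda>q. \<omega> q (X q) (Y q)) = (\<lambda>p. \<omega> p (nabla V X p) (Y p) + \<omega> p (X p) (nabla V Y p))"
proof
  fix p
  have "parallel2 A nabla \<omega>" using fed by (simp add: fedosov_manifold_def)
  then show "X_deriv V (\<lambda>q. \<omega> q (X q) (Y q)) p = \<omega> p (nabla V X p) (Y p) + \<omega> p (X p) (nabla V Y p)"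
    using assms unfolding parallel2_def by (metis (no_types, lifting) add.commute diff_eq_eq eq_iff_diff_eq_0)
qed

text \<open>Commuting two derivatives of the function \<omega>(Z, S), with \<omega> parallel, shows
  that R(X, Y) lies in the symplectic Lie algebra; skewness of \<omega> turns this into
  symmetry.\<close>

lemma R_omega_sym:
  assumes "smooth_field X" "smooth_field Y" "smooth_field Z" "smooth_field S"
  shows "\<omega> p (R X Y Z p) (S p) = \<omega> p (R X Y S p) (Z p)"
proof -
  have "X_deriv (lie_bracket A X Y) (\<lambda>q. \<omega> q (Z q) (S q)) p =
    X_deriv X (X_deriv Y (\<lambda>q. \<omega> q (Z q) (S q))) p - X_deriv Y (X_deriv X (\<lambda>q. \<omega> q (Z q) (S q))) p"
    by (rule vf_deriv_lie_bracket) (use assms in simp_all)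
  then have "\<omega> p (R X Y Z p) (S p) + \<omega> p (Z p) (R X Y S p) = 0"
    using assms by (simp add: vf_deriv_omega vf_deriv_add R_eq lie_bracket_nabla nabla_simps omega_simps algebra_simps)
  then show ?thesis using symp.w_skew[of p "Z p" "R X Y S p"] by simp
qed

text \<open>For a torsion-free connection the cyclic sum is the Jacobi sum written out in
  \<open>nabla\<close>.\<close>

lemma first_bianchi:
  assumes "smooth_field X" "smooth_field Y" "smooth_field Z"
  shows "R X Y Z p + R Y Z X p + R Z X Y p = 0"
  using jacobi[of X Y Z p] assms
  by (simp add: R_eq lie_bracket_nabla nabla_simps algebra_simps)

definition dR where
  "dR V X Y Z p = nabla V (R X Y Z) p - R (nabla V X) Y Z p - R X (nabla V Y) Z p - R X Y (nabla V Z) p"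

text \<open>After expansion everything cancels up to the derivative of \<open>Z\<close> along the
  Jacobi sum of \<open>V\<close>, \<open>X\<close>, \<open>Y\<close>. The zero field is written as
  \<open>0 *\<^sub>R X q\<close> so that linearity over functions evaluates that derivative.\<close>

lemma second_bianchi:
  assumes "smooth_field V" "smooth_field X" "smooth_field Y" "smooth_field Z"
  shows "dR V X Y Z p + dR X Y V Z p + dR Y V X Z p = 0"
proof -
  have "nabla (\<lambda>p. lie_bracket A (lie_bracket A V X) Y p + lie_bracket A (lie_bracket A X Y) V p
      + lie_bracket A (lie_bracket A Y V) X p) Z p = nabla (\<lambda>q. 0 *\<^sub>R X q) Z p"
    using jacobi[of V X Y] assms by simp
  also have "\<dots> = 0"
    using assms by (subst nabla_scale_left) auto
  finally show ?thesis
    using assms by (simp add: dR_def R_eq lie_bracket_nabla nabla_simps algebra_simps)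
qed

lemma curvature_tensor_eq: "curvature_tensor A \<omega> nabla p x y z s = \<omega> p (Rt p x y z) s"
  by (simp add: curvature_tensor_def Rt_def)

abbreviation C where "C \<equiv> curvature_tensor A \<omega> nabla"

lemma C_fields: "smooth_field X \<Longrightarrow> smooth_field Y \<Longrightarrow> smooth_field Z \<Longrightarrow>
    C p (X p) (Y p) (Z p) s = \<omega> p (R X Y Z p) s"
  by (simp add: curvature_tensor_eq R_tensor)

lemma multilinear4_C: "multilinear4 (C p)"
proof -
  have l: "linear (\<lambda>x. \<omega> p x s)" for s using symp.w_bilinear by (simp add: bilinear_def)
  have l2: "linear (\<omega> p x)" for x using symp.w_bilinear by (simp add: bilinear_def)
  show ?thesis
    unfolding multilinear4_def curvature_tensor_eq
    using linear_compose[OF linear_Rt1 l] linear_compose[OF linear_Rt2 l] linear_compose[OF linear_Rt3 l] l2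
    by (auto simp: o_def)
qed

lemma C_skew: "C p x y z s = - C p y x z s"
proof -
  have "Rt p x y z = - Rt p y x z" unfolding Rt_def by (rule R_skew) auto
  then show ?thesis using symp.w_simps(5)[of p "-1"] by (simp add: curvature_tensor_eq)
qed

lemma C_sym: "C p x y z s = C p x y s z"
  using R_omega_sym[of "vf_ext A p x" "vf_ext A p y" "vf_ext A p z" "vf_ext A p s" p]
  by (simp add: curvature_tensor_eq Rt_def)

lemma C_cyclic: "C p x y z s + C p y z x s + C p z x y s = 0"
proof -
  have "Rt p x y z + Rt p y z x + Rt p z x y = 0"
    unfolding Rt_def by (rule first_bianchi) auto
  then have "\<omega> p (Rt p x y z + Rt p y z x + Rt p z x y) s = 0"
    using symp.w_simps(5)[of p 0 0 s] by simp
  then show ?thesis by (simp add: curvature_tensor_eq omega_simps)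
qed

end

subsection \<open>Ricci tensor\<close>

text \<open>Cyclicity of the trace, which makes the trace of an endomorphism independent of the
  chart.\<close>

lemma linear_trace_commute:
  fixes F G :: "real ^ 'd::finite \<Rightarrow> real ^ 'd"
  assumes "linear F" "linear G"
  shows "(\<Sum>i\<in>UNIV. F (G (axis i 1)) $ i) = (\<Sum>i\<in>UNIV. G (F (axis i 1)) $ i)"
proof -
  have e: "(\<Sum>i\<in>UNIV. F (G (axis i 1)) $ i) = (\<Sum>i\<in>UNIV. \<Sum>k\<in>UNIV. G (axis i 1) $ k * F (axis k 1) $ i)"
    if "linear F" for F G :: "real ^ 'd \<Rightarrow> real ^ 'd"
    by (subst linear_axis_expand[OF that]) (simp add: sum_component)
  show ?thesis
    unfolding e[OF assms(1)] e[OF assms(2)]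
    by (subst sum.swap) (simp add: mult.commute)
qed

section \<open>Inverse symplectic matrix and symplectic trace\<close>

context symplectic_space
begin

definition w_inv :: "real ^ 'd ^ 'd"
  where "w_inv = matrix_inv (\<chi> i j. w (axis i 1) (axis j 1))"

text \<open>\<open>matrix_inv\<close> is a choice that has meaning only once an inverse exists.
  Nondegeneracy gives a trivial kernel, hence a left inverse, which is two-sided for a square
  matrix.\<close>

lemma w_inv_inverse: "w_inv ** (\<chi> i j. w (axis i 1) (axis j 1)) = mat 1"
proof -
  let ?M = "\<chi> i j. w (axis i 1) (axis j 1)"
  have lw: "linear (\<lambda>v. w v u)" for u using w_bilinear by (simp add: bilinear_def)
  have "x = 0" if "?M *v x = 0" for x
  proof -
    have lw': "linear (w v)" for v using w_bilinear by (simp add: bilinear_def)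
    have "w (axis i 1) x = (?M *v x) $ i" for i
      by (subst linear_axis_expand[OF lw']) (simp add: matrix_vector_mult_def mult.commute)
    then have "w (axis i 1) x = 0" for i using that by simp
    then have "w v x = 0" for v by (subst linear_axis_expand[OF lw]) simp
    then show "x = 0" using w_nondeg w_skew by (metis neg_0_equal_iff_equal)
  qed
  then obtain B where "B ** ?M = mat 1" using matrix_left_invertible_ker by blast
  then have "\<exists>B. ?M ** B = mat 1 \<and> B ** ?M = mat 1" using matrix_left_right_inverse by blast
  from someI_ex[OF this] show ?thesis by (simp add: w_inv_def matrix_inv_def)
qed

lemma w_inv_w: "(\<Sum>j\<in>UNIV. w_inv $ i $ j * w (axis j 1) (axis k 1)) = (if i = k then 1 else 0)"
proof -
  have "(w_inv ** (\<chi> i j. w (axis i 1) (axis j 1))) $ i $ k = (if i = k then 1 else 0)"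
    unfolding w_inv_inverse by (simp add: mat_def)
  then show ?thesis by (simp add: matrix_matrix_mult_def)
qed

lemma w_inv_skew: "w_inv $ i $ j = - w_inv $ j $ i"
proof -
  let ?M = "(\<chi> i j. w (axis i 1) (axis j 1)) :: real ^ 'd ^ 'd"
  have MT: "transpose ?M = - ?M"
    by (simp add: vec_eq_iff transpose_def) (metis w_skew)
  have neg: "(- X) ** Y = - (X ** Y)" "X ** (- Y) = - (X ** Y)" for X Y :: "real ^ 'd ^ 'd"
    by (simp_all add: vec_eq_iff matrix_matrix_mult_def sum_negf)
  have "?M ** transpose w_inv = - mat 1"
  proof -
    have "transpose (w_inv ** ?M) = mat 1" by (simp add: w_inv_inverse transpose_mat)
    then have "(- ?M) ** transpose w_inv = mat 1" by (simp add: matrix_transpose_mul MT)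
    then show ?thesis by (metis neg(1) minus_minus)
  qed
  then have "w_inv ** (?M ** transpose w_inv) = - w_inv" by (simp add: neg)
  then have "transpose w_inv = - w_inv" by (simp add: matrix_mul_assoc w_inv_inverse)
  then have "transpose w_inv $ j $ i = (- w_inv) $ j $ i" by simp
  then show ?thesis by (simp add: transpose_def)
qed

lemma symplectic_trace_eq: "symplectic_trace w B = (\<Sum>i\<in>UNIV. \<Sum>j\<in>UNIV. w_inv $ i $ j * B (axis i 1) (axis j 1))"
  by (simp add: symplectic_trace_def w_inv_def)

text \<open>The sign comes from swapping the arguments of \<open>w\<close> before contracting with
  its inverse. It cancels the sign in \<open>ricci_tensor\<close> and leaves the ordinary
  trace.\<close>

lemma symplectic_trace_linear:
  assumes "linear L"
  shows "symplectic_trace w (\<lambda>x s. w (L x) s) = - (\<Sum>i\<in>UNIV. L (axis i 1) $ i)"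
proof -
  have lw: "linear (\<lambda>v. w v u)" for u using w_bilinear by (simp add: bilinear_def)
  have "(\<Sum>j\<in>UNIV. w_inv $ i $ j * w (L (axis i 1)) (axis j 1)) = - L (axis i 1) $ i" for i
  proof -
    have "(\<Sum>j\<in>UNIV. w_inv $ i $ j * w (L (axis i 1)) (axis j 1)) =
       (\<Sum>j\<in>UNIV. \<Sum>k\<in>UNIV. w_inv $ i $ j * (L (axis i 1) $ k * w (axis k 1) (axis j 1)))"
      by (subst linear_axis_expand[OF lw]) (simp add: sum_distrib_left)
    also have "\<dots> = (\<Sum>k\<in>UNIV. \<Sum>j\<in>UNIV. w_inv $ i $ j * (L (axis i 1) $ k * w (axis k 1) (axis j 1)))"
      by (rule sum.swap)
    also have "\<dots> = (\<Sum>k\<in>UNIV. - (L (axis i 1) $ k * (\<Sum>j\<in>UNIV. w_inv $ i $ j * w (axis j 1) (axis k 1))))"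
      by (subst w_skew) (simp add: sum_distrib_left sum_negf mult_ac)
    also have "\<dots> = - L (axis i 1) $ i"
      by (simp add: w_inv_w sum_negf if_distrib cong: if_cong)
    finally show ?thesis .
  qed
  then show ?thesis by (simp add: symplectic_trace_eq sum_negf)
qed

lemma symplectic_trace_symmetric:
  assumes "\<And>x s. B x s = B s x"
  shows "symplectic_trace w B = 0"
proof -
  have "symplectic_trace w B = (\<Sum>i\<in>UNIV. \<Sum>j\<in>UNIV. w_inv $ j $ i * B (axis j 1) (axis i 1))"
    unfolding symplectic_trace_eq by (rule sum.swap)
  also have "\<dots> = - symplectic_trace w B"
    unfolding symplectic_trace_eq sum_negf[symmetric]
    by (intro sum.cong refl) (metis w_inv_skew assms mult_minus_left)
  finally show ?thesis by simp
qed

lemma symplectic_trace_add: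
  "symplectic_trace w (\<lambda>x s. B x s + B' x s) = symplectic_trace w B + symplectic_trace w B'"
  by (simp add: symplectic_trace_eq sum.distrib algebra_simps)

end

section \<open>Ricci tensor and its covariant derivative\<close>

context fedosov
begin

abbreviation Ric where "Ric \<equiv> ricci_tensor A \<omega> nabla"

lemma Ric_trace: "Ric p y z = (\<Sum>i\<in>UNIV. Rt p (axis i 1) y z $ i)"
  using symp.symplectic_trace_linear[OF linear_Rt1, of p p y z]
  by (simp add: ricci_tensor_def curvature_tensor_eq)

text \<open>By the cyclic identity the difference of the two sides is the symplectic trace of a form
  symmetric in \<open>x\<close> and \<open>s\<close>, and such a trace vanishes because the inverse
  matrix is skew.\<close>

lemma Ric_sym: "Ric p y z = Ric p z y"
proof -
  have "C p x y z s = C p x z y s + - C p y z x s" for x s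
    using C_cyclic[of p x y z s] C_skew[of p z x y s] by simp
  then have "Ric p y z = - symplectic_trace (\<omega> p) (\<lambda>x s. C p x z y s + - C p y z x s)"
    by (simp add: ricci_tensor_def)
  also have "\<dots> = Ric p z y - symplectic_trace (\<omega> p) (\<lambda>x s. - C p y z x s)"
    by (subst symp.symplectic_trace_add) (simp add: ricci_tensor_def)
  also have "symplectic_trace (\<omega> p) (\<lambda>x s. - C p y z x s) = 0"
    by (rule symp.symplectic_trace_symmetric) (use C_sym in metis)
  finally show ?thesis by simp
qed

lemma Ric_linear: "linear (\<lambda>y. Ric p y z)" "linear (\<lambda>z. Ric p y z)"
proof -
  show l: "linear (\<lambda>y. Ric p y z)" for z
    unfolding Ric_trace
    by (intro linearI) (simp_all add: linear_add[OF linear_Rt2] linear_scale[OF linear_Rt2] sum.distrib sum_distrib_left)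
  have "(\<lambda>z. Ric p y z) = (\<lambda>z. Ric p z y)" by (rule ext, rule Ric_sym)
  then show "linear (\<lambda>z. Ric p y z)" using l[of y] by simp
qed

lemma Ric_simps:
  "Ric p (a + b) z = Ric p a z + Ric p b z" "Ric p z (a + b) = Ric p z a + Ric p z b"
  "Ric p (a - b) z = Ric p a z - Ric p b z" "Ric p z (a - b) = Ric p z a - Ric p z b"
  "Ric p (r *\<^sub>R a) z = r * Ric p a z" "Ric p z (r *\<^sub>R a) = r * Ric p z a"
  by (simp_all add: linear_add[OF Ric_linear(1)] linear_add[OF Ric_linear(2)] linear_diff[OF Ric_linear(1)]
    linear_diff[OF Ric_linear(2)] linear_scale[OF Ric_linear(1)] linear_scale[OF Ric_linear(2)])

lemma frame_values:
  assumes "c \<in> A" "q \<in> cdom c" "\<And>i. vf_coord A c (E i) (cmap c q) = axis i 1"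
  shows "E i q = jac c (chart_at A q) q (axis i 1)"
  using assms(3)[of i, symmetric] assms(1,2) by (simp add: vf_coord_cmap jac_inverse chart_at)

text \<open>\<open>Ric_trace\<close> uses the preferred chart of each point. Conjugation by the
  Jacobian does not change the trace, so one fixed chart can serve a neighbourhood; smoothness of
  Ricci is read off from this form.\<close>

lemma Ric_frame:
  assumes c: "c \<in> A" "q \<in> cdom c" and E: "\<And>i. smooth_field (E i)"
    "\<And>i. vf_coord A c (E i) (cmap c q) = axis i 1"
    and YZ: "smooth_field Y" "smooth_field Z"
  shows "Ric q (Y q) (Z q) = (\<Sum>i\<in>UNIV. vf_coord A c (R (E i) Y Z) (cmap c q) $ i)"
proof -
  define k where "k = chart_at A q"
  have k: "k \<in> A" "q \<in> cdom k" using chart_at k_def by auto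
  have l: "linear (jac c k q)" "linear (jac k c q)" using linear_jac c k by auto
  define L where "L v = Rt q v (Y q) (Z q)" for v
  have L: "linear L" unfolding L_def by (rule linear_Rt1)
  have "vf_coord A c (R (E i) Y Z) (cmap c q) = jac k c q (L (jac c k q (axis i 1)))" for i
    using c E YZ frame_values[OF c, of E i] by (simp add: vf_coord_cmap R_tensor k_def L_def)
  then have "(\<Sum>i\<in>UNIV. vf_coord A c (R (E i) Y Z) (cmap c q) $ i) =
    (\<Sum>i\<in>UNIV. jac k c q ((L \<circ> jac c k q) (axis i 1)) $ i)" by simp
  also have "\<dots> = (\<Sum>i\<in>UNIV. (L \<circ> jac c k q) (jac k c q (axis i 1)) $ i)"
    by (rule linear_trace_commute[OF l(2) linear_compose[OF l(1) L]])
  also have "\<dots> = Ric q (Y q) (Z q)"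
    using c k by (simp add: jac_inverse Ric_trace L_def)
  finally show ?thesis by simp
qed

lemma smooth_Ric [simp]:
  assumes YZ: "smooth_field Y" "smooth_field Z"
  shows "smooth_fun A (\<lambda>q. Ric q (Y q) (Z q))"
proof (rule smooth_funI_local)
  fix p
  define c where "c = chart_at A p"
  have c: "c \<in> A" "p \<in> cdom c" using chart_at c_def by auto
  obtain r E where E: "r > 0" "cball (cmap c p) r \<subseteq> cimg c" "\<And>i. smooth_field (E i)"
    "\<And>i x. x \<in> cball (cmap c p) r \<Longrightarrow> vf_coord A c (E i) x = axis i 1"
    using frame[OF c] by metis
  let ?B = "ball (cmap c p) r"
  have B: "?B \<subseteq> cimg c" "?B \<subseteq> cball (cmap c p) r" using E by auto
  have "smooth_on ?B (\<lambda>x. \<Sum>i\<in>UNIV. vf_coord A c (R (E i) Y Z) x $ i)"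
    by (intro smooth_on_sum smooth_on_nth open_ball smooth_on_subset[OF smooth_vfD[OF _ c(1)] B(1)])
      (use E YZ in simp)
  then have "smooth_on ?B (\<lambda>x. Ric (cinv c x) (Y (cinv c x)) (Z (cinv c x)))"
  proof (rule smooth_on_cong[OF open_ball, rotated])
    fix x assume "x \<in> ?B"
    then have x: "x \<in> cimg c" "x \<in> cball (cmap c p) r" using B by auto
    show "(\<Sum>i\<in>UNIV. vf_coord A c (R (E i) Y Z) x $ i) = Ric (cinv c x) (Y (cinv c x)) (Z (cinv c x))"
      using Ric_frame[OF c(1), of "cinv c x" E Y Z] x c E YZ by auto
  qed
  then show "\<exists>c\<in>A. \<exists>T. p \<in> cdom c \<and> open T \<and> cmap c p \<in> T \<and> T \<subseteq> cimg c
      \<and> smooth_on T (\<lambda>x. Ric (cinv c x) (Y (cinv c x)) (Z (cinv c x)))"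
    using c B E(1) by (intro bexI[of _ c] exI[of _ ?B]) auto
qed

definition dRic where
  "dRic V Y Z p = X_deriv V (\<lambda>q. Ric q (Y q) (Z q)) p - Ric p (nabla V Y p) (Z p) - Ric p (Y p) (nabla V Z p)"

lemma dRic_sym: "dRic V Y Z p = dRic V Z Y p"
proof -
  have "(\<lambda>q. Ric q (Y q) (Z q)) = (\<lambda>q. Ric q (Z q) (Y q))"
    by (rule ext, rule Ric_sym)
  then show ?thesis
    unfolding dRic_def using Ric_sym[of p "nabla V Y p" "Z p"] Ric_sym[of p "Y p" "nabla V Z p"] by simp
qed

lemma dRic_add1:
  assumes "smooth_field V" "smooth_field V'" "smooth_field Y" "smooth_field Z"
  shows "dRic (\<lambda>q. V q + V' q) Y Z p = dRic V Y Z p + dRic V' Y Z p"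
  using assms by (simp add: dRic_def nabla_simps vf_deriv_field_add Ric_simps)

lemma dRic_scale1:
  assumes "smooth_fun A f" "smooth_field V" "smooth_field Y" "smooth_field Z"
  shows "dRic (\<lambda>q. f q *\<^sub>R V q) Y Z p = f p * dRic V Y Z p"
  using assms by (simp add: dRic_def nabla_simps vf_deriv_field_scale Ric_simps algebra_simps)

lemma dRic_add2:
  assumes "smooth_field V" "smooth_field Y" "smooth_field Y'" "smooth_field Z"
  shows "dRic V (\<lambda>q. Y q + Y' q) Z p = dRic V Y Z p + dRic V Y' Z p"
  using assms by (simp add: dRic_def nabla_simps vf_deriv_add Ric_simps)

lemma dRic_scale2:
  assumes "smooth_fun A f" "smooth_field V" "smooth_field Y" "smooth_field Z"
  shows "dRic V (\<lambda>q. f q *\<^sub>R Y q) Z p = f p * dRic V Y Z p"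
  using assms by (simp add: dRic_def nabla_simps vf_deriv_mult Ric_simps algebra_simps)

definition T :: "'m \<Rightarrow> real ^ 'd \<Rightarrow> real ^ 'd \<Rightarrow> real ^ 'd \<Rightarrow> real" where
  "T p v y z = dRic (vf_ext A p v) (vf_ext A p y) (vf_ext A p z) p"

lemma T_sym: "T p v y z = T p v z y"
  unfolding T_def by (rule dRic_sym)

lemma T_linear: "linear (\<lambda>v. T p v y z)" "linear (\<lambda>y. T p v y z)"
proof -
  show "linear (\<lambda>v. T p v y z)" unfolding T_def
    by (rule tensorial_linear[where p = p and \<Phi> = "\<lambda>V. dRic V (vf_ext A p y) (vf_ext A p z) p"])
      (simp_all add: dRic_add1 dRic_scale1)
  show "linear (\<lambda>y. T p v y z)" unfolding T_def
    by (rule tensorial_linear[where p = p and \<Phi> = "\<lambda>Y. dRic (vf_ext A p v) Y (vf_ext A p z) p"])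
      (simp_all add: dRic_add2 dRic_scale2)
qed

text \<open>The last slot is brought into the middle by \<open>dRic_sym\<close>, where tensoriality
  is already available.\<close>

lemma dRic_tensor:
  assumes "smooth_field V" "smooth_field Y" "smooth_field Z"
  shows "dRic V Y Z p = T p (V p) (Y p) (Z p)"
proof -
  have "dRic V Y Z p = dRic (vf_ext A p (V p)) Y Z p"
    by (rule tensorial[where p = p and \<Phi> = "\<lambda>V. dRic V Y Z p"]) (use assms in \<open>simp_all add: dRic_add1 dRic_scale1\<close>)
  also have "\<dots> = dRic (vf_ext A p (V p)) (vf_ext A p (Y p)) Z p"
    by (rule tensorial[where p = p and \<Phi> = "\<lambda>Y. dRic (vf_ext A p (V p)) Y Z p"]) (use assms in \<open>simp_all add: dRic_add2 dRic_scale2\<close>)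
  also have "\<dots> = dRic (vf_ext A p (V p)) Z (vf_ext A p (Y p)) p" by (rule dRic_sym)
  also have "\<dots> = dRic (vf_ext A p (V p)) (vf_ext A p (Z p)) (vf_ext A p (Y p)) p"
    by (rule tensorial[where p = p and \<Phi> = "\<lambda>Z. dRic (vf_ext A p (V p)) Z (vf_ext A p (Y p)) p"]) (use assms in \<open>simp_all add: dRic_add2 dRic_scale2\<close>)
  finally show ?thesis using T_sym[of p "V p" "Z p" "Y p"] by (simp add: T_def)
qed

end

section \<open>Parallel Weyl tensor\<close>

locale weyl_parallel = fedosov A \<omega> nabla
  for A :: "('m::{t2_space, second_countable_topology}, 'd::finite) chart set"
    and \<omega> :: "'m \<Rightarrow> real ^ 'd \<Rightarrow> real ^ 'd \<Rightarrow> real"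
    and nabla :: "('m \<Rightarrow> real ^ 'd) \<Rightarrow> ('m \<Rightarrow> real ^ 'd) \<Rightarrow> ('m \<Rightarrow> real ^ 'd)" +
  fixes n :: nat
  assumes dim: "CARD('d) = 2 * n"
    and parallel_weyl: "parallel4 A nabla (weyl_tensor n A \<omega> nabla)"
begin

abbreviation W where "W \<equiv> weyl_tensor n A \<omega> nabla"

definition \<kappa> :: real where "\<kappa> = 1 / (2 * (real n + 1))"

abbreviation KN where "KN p \<equiv> kulkarni_nomizu (\<omega> p)"

lemma kappa_nz: "\<kappa> \<noteq> 0"
  by (simp add: \<kappa>_def)

lemma W_eq: "W p x y z s = C p x y z s - \<kappa> * KN p (Ric p) x y z s"
  by (simp add: weyl_tensor_def \<kappa>_def)

lemma multilinear4_W: "multilinear4 (W p)"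
  unfolding multilinear4_def W_eq kulkarni_nomizu_def
  by (intro conjI allI linearI)
    (simp_all add: multilinear4_simps[OF multilinear4_C] omega_simps Ric_simps algebra_simps)

lemmas W_simps = multilinear4_simps[OF multilinear4_W] multilinear4_diff[OF multilinear4_W]

lemma W_skew: "W p x y z s = - W p y x z s"
  unfolding W_eq kulkarni_nomizu_def
  using C_skew[of p x y z s] symp.w_skew[of p x y] by (simp add: algebra_simps)

lemma W_sym: "W p x y z s = W p x y s z"
  unfolding W_eq kulkarni_nomizu_def
  using C_sym[of p x y z s] Ric_sym[of p z s] by (simp add: algebra_simps)

lemma smooth_KN [simp]:
  "smooth_field X \<Longrightarrow> smooth_field Y \<Longrightarrow> smooth_field Z \<Longrightarrow> smooth_field S \<Longrightarrow>
    smooth_fun A (\<lambda>q. KN q (Ric q) (X q) (Y q) (Z q) (S q))"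
  by (simp add: kulkarni_nomizu_def)

lemma smooth_W [simp]:
  "smooth_field X \<Longrightarrow> smooth_field Y \<Longrightarrow> smooth_field Z \<Longrightarrow> smooth_field S \<Longrightarrow>
    smooth_fun A (\<lambda>q. W q (X q) (Y q) (Z q) (S q))"
  by (simp add: W_eq C_fields)

section \<open>Derivatives of the Weyl tensor, of Ricci and of the curvature\<close>

lemma vf_deriv_W:
  assumes "smooth_field V" "smooth_field X" "smooth_field Y" "smooth_field Z" "smooth_field S"
  shows "X_deriv V (\<lambda>q. W q (X q) (Y q) (Z q) (S q)) = (\<lambda>p.
    W p (nabla V X p) (Y p) (Z p) (S p) + W p (X p) (nabla V Y p) (Z p) (S p) +
    W p (X p) (Y p) (nabla V Z p) (S p) + W p (X p) (Y p) (Z p) (nabla V S p))"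
proof
  fix p
  have "X_deriv V (\<lambda>q. W q (X q) (Y q) (Z q) (S q)) p
    - W p (nabla V X p) (Y p) (Z p) (S p) - W p (X p) (nabla V Y p) (Z p) (S p)
    - W p (X p) (Y p) (nabla V Z p) (S p) - W p (X p) (Y p) (Z p) (nabla V S p) = 0"
    using parallel_weyl assms unfolding parallel4_def by blast
  then show "X_deriv V (\<lambda>q. W q (X q) (Y q) (Z q) (S q)) p =
    W p (nabla V X p) (Y p) (Z p) (S p) + W p (X p) (nabla V Y p) (Z p) (S p) +
    W p (X p) (Y p) (nabla V Z p) (S p) + W p (X p) (Y p) (Z p) (nabla V S p)"
    by simp
qed

lemma vf_deriv_Ric:
  assumes "smooth_field V" "smooth_field Y" "smooth_field Z"
  shows "X_deriv V (\<lambda>q. Ric q (Y q) (Z q)) =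
    (\<lambda>p. T p (V p) (Y p) (Z p) + Ric p (nabla V Y p) (Z p) + Ric p (Y p) (nabla V Z p))"
  using dRic_tensor[OF assms] by (simp add: dRic_def fun_eq_iff algebra_simps)

text \<open>As \<omega> is parallel, only the Ricci factor contributes a tensorial derivative,
  namely \<open>T\<close>.\<close>

lemma vf_deriv_KN:
  assumes "smooth_field V" "smooth_field X" "smooth_field Y" "smooth_field Z" "smooth_field S"
  shows "X_deriv V (\<lambda>q. KN q (Ric q) (X q) (Y q) (Z q) (S q)) p = KN p (T p (V p)) (X p) (Y p) (Z p) (S p) +
    KN p (Ric p) (nabla V X p) (Y p) (Z p) (S p) + KN p (Ric p) (X p) (nabla V Y p) (Z p) (S p) +
    KN p (Ric p) (X p) (Y p) (nabla V Z p) (S p) + KN p (Ric p) (X p) (Y p) (Z p) (nabla V S p)"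
  using assms unfolding kulkarni_nomizu_def
  by (simp add: vf_deriv_add vf_deriv_diff vf_deriv_mult vf_deriv_const vf_deriv_Ric vf_deriv_omega algebra_simps)

lemma curvature_derivative:
  assumes "smooth_field V" "smooth_field X" "smooth_field Y" "smooth_field Z" "smooth_field S"
  shows "X_deriv V (\<lambda>q. C q (X q) (Y q) (Z q) (S q)) p = \<kappa> * KN p (T p (V p)) (X p) (Y p) (Z p) (S p) +
    C p (nabla V X p) (Y p) (Z p) (S p) + C p (X p) (nabla V Y p) (Z p) (S p) +
    C p (X p) (Y p) (nabla V Z p) (S p) + C p (X p) (Y p) (Z p) (nabla V S p)"
proof -
  have "(\<lambda>q. C q (X q) (Y q) (Z q) (S q)) =
      (\<lambda>q. W q (X q) (Y q) (Z q) (S q) + \<kappa> * KN q (Ric q) (X q) (Y q) (Z q) (S q))"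
    by (simp add: W_eq)
  then have "X_deriv V (\<lambda>q. C q (X q) (Y q) (Z q) (S q)) p =
      X_deriv V (\<lambda>q. W q (X q) (Y q) (Z q) (S q)) p + \<kappa> * X_deriv V (\<lambda>q. KN q (Ric q) (X q) (Y q) (Z q) (S q)) p"
    using assms by (simp add: vf_deriv_add vf_deriv_mult vf_deriv_const)
  then show ?thesis
    unfolding vf_deriv_W[OF assms] vf_deriv_KN[OF assms] by (simp add: W_eq algebra_simps)
qed

text \<open>Passes from the 4-tensor to the vector-valued \<open>dR\<close>: since \<omega> is
  parallel, the terms with the derivative of the last argument cancel.\<close>

lemma dR_KN:
  assumes "smooth_field V" "smooth_field X" "smooth_field Y" "smooth_field Z"
  shows "\<omega> p (dR V X Y Z p) s = \<kappa> * KN p (T p (V p)) (X p) (Y p) (Z p) s"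
proof -
  let ?S = "vf_ext A p s"
  have "X_deriv V (\<lambda>q. C q (X q) (Y q) (Z q) (?S q)) p = X_deriv V (\<lambda>q. \<omega> q (R X Y Z q) (?S q)) p"
    using assms by (simp add: C_fields)
  also have "\<dots> = \<omega> p (nabla V (R X Y Z) p) s + \<omega> p (R X Y Z p) (nabla V ?S p)"
    using assms by (simp add: vf_deriv_omega)
  finally show ?thesis
    using assms curvature_derivative[of V X Y Z ?S p] C_fields[of "nabla V X" Y Z p s]
      C_fields[of X "nabla V Y" Z p s] C_fields[of X Y "nabla V Z" p s] C_fields[of X Y Z p "nabla V ?S p"]
    by (simp add: dR_def omega_simps)
qed

text \<open>The commutator of two derivatives is applied to a component function of
  \<open>W\<close>. Because \<open>W\<close> is parallel, terms with derivatives in two different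
  slots cancel and R(U, V) remains in each slot.\<close>

lemma ricci_identity:
  assumes "smooth_field U" "smooth_field V" "smooth_field X" "smooth_field Y" "smooth_field Z" "smooth_field S"
  shows "W p (R U V X p) (Y p) (Z p) (S p) + W p (X p) (R U V Y p) (Z p) (S p) +
    W p (X p) (Y p) (R U V Z p) (S p) + W p (X p) (Y p) (Z p) (R U V S p) = 0"
proof -
  let ?f = "\<lambda>q. W q (X q) (Y q) (Z q) (S q)"
  have "X_deriv (lie_bracket A U V) ?f p = X_deriv U (X_deriv V ?f) p - X_deriv V (X_deriv U ?f) p"
    by (rule vf_deriv_lie_bracket) (use assms in simp_all)
  then show ?thesis
    using assms by (simp add: vf_deriv_W vf_deriv_add R_eq lie_bracket_nabla nabla_simps W_simps)
qed

text \<open>Differentiating the Ricci identity: since \<open>W\<close> is parallel, \<open>\<nabla>R\<close> acts trivially on \<open>W\<close> as well.\<close>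

lemma dR_act:
  assumes "smooth_field V" "smooth_field X" "smooth_field Y"
    "smooth_field Z1" "smooth_field Z2" "smooth_field Z3" "smooth_field Z4"
  shows "W p (dR V X Y Z1 p) (Z2 p) (Z3 p) (Z4 p) + W p (Z1 p) (dR V X Y Z2 p) (Z3 p) (Z4 p) +
    W p (Z1 p) (Z2 p) (dR V X Y Z3 p) (Z4 p) + W p (Z1 p) (Z2 p) (Z3 p) (dR V X Y Z4 p) = 0"
proof -
  have "X_deriv V (\<lambda>q. W q (R X Y Z1 q) (Z2 q) (Z3 q) (Z4 q) + W q (Z1 q) (R X Y Z2 q) (Z3 q) (Z4 q) +
    W q (Z1 q) (Z2 q) (R X Y Z3 q) (Z4 q) + W q (Z1 q) (Z2 q) (Z3 q) (R X Y Z4 q)) p = 0"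
    using assms by (simp add: ricci_identity vf_deriv_const)
  then show ?thesis
    using assms ricci_identity[of "nabla V X" Y Z1 Z2 Z3 Z4 p] ricci_identity[of X "nabla V Y" Z1 Z2 Z3 Z4 p]
      ricci_identity[of X Y "nabla V Z1" Z2 Z3 Z4 p] ricci_identity[of X Y Z1 "nabla V Z2" Z3 Z4 p]
      ricci_identity[of X Y Z1 Z2 "nabla V Z3" Z4 p] ricci_identity[of X Y Z1 Z2 Z3 "nabla V Z4" p]
    by (simp add: vf_deriv_add vf_deriv_W dR_def W_simps)
qed

lemma ricci_parallel_or_weyl_zero:
  assumes "n \<ge> 2"
  shows "(\<forall>v y z. T p v y z = 0) \<or> (\<forall>x y z s. W p x y z s = 0)"
proof (rule symp.pointwise_alternative[where p = p and k = \<kappa> and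
      E = "\<lambda>v x y z. dR (vf_ext A p v) (vf_ext A p x) (vf_ext A p y) (vf_ext A p z) p"])
  show "linear (\<lambda>v. T p v y z)" "linear (\<lambda>y. T p v y z)" for v y z by (rule T_linear)+
  show "T p v y z = T p v z y" for v y z by (rule T_sym)
  show "2 < CARD('d)" using dim assms by simp
  show "multilinear4 (W p)" by (rule multilinear4_W)
  show "W p x y z s = - W p y x z s" "W p x y z s = W p x y s z" for x y z s
    by (rule W_skew, rule W_sym)
  show "\<kappa> \<noteq> 0" by (rule kappa_nz)
  have E: "\<omega> p (dR (vf_ext A p v) (vf_ext A p x) (vf_ext A p y) (vf_ext A p z) p) s = \<kappa> * KN p (T p v) x y z s"
    for v x y z s by (subst dR_KN) simp_all
  then show "\<omega> p (dR (vf_ext A p v) (vf_ext A p x) (vf_ext A p y) (vf_ext A p z) p) s = \<kappa> * KN p (T p v) x y z s"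
    for v x y z s by simp
  show "KN p (T p v) x y z s + KN p (T p x) y v z s + KN p (T p y) v x z s = 0" for v x y z s
  proof -
    let ?e = "vf_ext A p"
    have "dR (?e v) (?e x) (?e y) (?e z) p + dR (?e x) (?e y) (?e v) (?e z) p + dR (?e y) (?e v) (?e x) (?e z) p = 0"
      by (rule second_bianchi) simp_all
    then have "\<omega> p (dR (?e v) (?e x) (?e y) (?e z) p + dR (?e x) (?e y) (?e v) (?e z) p + dR (?e y) (?e v) (?e x) (?e z) p) s = 0"
      using omega_simps(5)[of p 0 0 s] by simp
    \<comment> \<open>\<open>E\<close> translates the second Bianchi identity, paired with
      \<open>s\<close>, into one for \<open>T\<close>, up to the nonzero constant \<kappa>.\<close>
    then have "\<kappa> * (KN p (T p v) x y z s + KN p (T p x) y v z s + KN p (T p y) v x z s) = 0"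
      by (simp add: omega_simps E algebra_simps)
    then show ?thesis using kappa_nz by simp
  qed
  show "derivation_act (\<lambda>z. dR (vf_ext A p v) (vf_ext A p x) (vf_ext A p y) (vf_ext A p z) p) (W p) z1 z2 z3 z4 = 0"
    for v x y z1 z2 z3 z4
    using dR_act[of "vf_ext A p v" "vf_ext A p x" "vf_ext A p y" "vf_ext A p z1" "vf_ext A p z2" "vf_ext A p z3" "vf_ext A p z4" p]
    by (simp add: derivation_act_def)
qed

lemma parallel_curvature:
  assumes "\<And>p v y z. T p v y z = 0"
  shows "parallel4 A nabla (curvature_tensor A \<omega> nabla)"
  unfolding parallel4_def
proof (intro allI impI)
  fix V X Y Z S p
  assume "smooth_vf A V" "smooth_vf A X" "smooth_vf A Y" "smooth_vf A Z" "smooth_vf A S"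
  note curvature_derivative[OF this, of p]
  moreover have "KN p (T p (V p)) (X p) (Y p) (Z p) (S p) = 0"
    by (simp add: kulkarni_nomizu_def assms)
  ultimately show "X_deriv V (\<lambda>q. C q (X q) (Y q) (Z q) (S q)) p
         - C p (nabla V X p) (Y p) (Z p) (S p) - C p (X p) (nabla V Y p) (Z p) (S p)
         - C p (X p) (Y p) (nabla V Z p) (S p) - C p (X p) (Y p) (Z p) (nabla V S p) = 0"
    by simp
qed

end

subsection \<open>Propagation of zeros\<close>

text \<open>The squared norm g satisfies g' <= L g, with \<open>L\<close> coming from the
  Cauchy--Schwarz bound of the squared sum of absolute values by \<open>CARD('i)\<close> times g.
  Hence g exp(-L t) does not increase, and it starts at 0. Squares keep g differentiable.\<close>

lemma gronwall_zero:
  fixes w w' :: "'i::finite \<Rightarrow> real \<Rightarrow> real"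
  assumes der: "\<And>i t. 0 \<le> t \<Longrightarrow> t \<le> 1 \<Longrightarrow> (w i has_real_derivative w' i t) (at t)"
    and bound: "\<And>i t. 0 \<le> t \<Longrightarrow> t \<le> 1 \<Longrightarrow> \<bar>w' i t\<bar> \<le> B * (\<Sum>j\<in>UNIV. \<bar>w j t\<bar>)"
    and B: "B \<ge> 0" and zero: "\<And>i. w i 0 = 0"
  shows "w i 1 = 0"
proof -
  define L where "L = 2 * B * real CARD('i)"
  define g where "g t = (\<Sum>i\<in>UNIV. (w i t)\<^sup>2)" for t
  define g' where "g' t = (\<Sum>i\<in>UNIV. 2 * w i t * w' i t)" for t
  have dg: "(g has_real_derivative g' t) (at t)" if "0 \<le> t" "t \<le> 1" for t
    unfolding g_def g'_def by (auto intro!: derivative_eq_intros der[OF that] simp: mult_ac)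
  have le: "g' t \<le> L * g t" if t: "0 \<le> t" "t \<le> 1" for t
  proof -
    let ?S = "\<Sum>j\<in>UNIV. \<bar>w j t\<bar>"
    have "2 * w i t * w' i t \<le> 2 * B * ?S * \<bar>w i t\<bar>" for i
    proof -
      have "w i t * w' i t \<le> \<bar>w i t\<bar> * \<bar>w' i t\<bar>" by (metis abs_ge_self abs_mult)
      also have "\<dots> \<le> \<bar>w i t\<bar> * (B * ?S)" using bound[OF t] by (intro mult_left_mono) auto
      finally show ?thesis by (simp add: mult_ac)
    qed
    then have "g' t \<le> (\<Sum>i\<in>UNIV. 2 * B * ?S * \<bar>w i t\<bar>)" unfolding g'_def by (intro sum_mono)
    also have "\<dots> = 2 * B * ?S\<^sup>2" by (simp add: sum_distrib_left[symmetric] power2_eq_square)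
    also have "\<dots> \<le> 2 * B * (g t * real CARD('i))"
      using B sum_squared_le_sum_of_squares[of "\<lambda>j. \<bar>w j t\<bar>" "UNIV :: 'i set"]
      by (intro mult_left_mono) (auto simp: g_def)
    finally show ?thesis by (simp add: L_def mult_ac)
  qed
  have "g 1 * exp (- L * 1) \<le> g 0 * exp (- L * 0)"
  proof (rule DERIV_nonpos_imp_nonincreasing[where f = "\<lambda>t. g t * exp (- L * t)" and a = 0 and b = 1])
    fix t :: real assume t: "0 \<le> t" "t \<le> 1"
    have "((\<lambda>t. g t * exp (- L * t)) has_real_derivative (g' t - L * g t) * exp (- L * t)) (at t)"
      by (auto intro!: derivative_eq_intros dg t simp: algebra_simps)
    moreover have "(g' t - L * g t) * exp (- L * t) \<le> 0"
      using le[OF t] by (simp add: mult_nonpos_nonneg)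
    ultimately show "\<exists>y. ((\<lambda>t. g t * exp (- L * t)) has_real_derivative y) (at t) \<and> y \<le> 0" by blast
  qed simp
  then have "g 1 \<le> 0" by (simp add: g_def zero mult_le_0_iff)
  moreover have "(w i 1)\<^sup>2 \<le> g 1" unfolding g_def by (rule member_le_sum) auto
  ultimately show ?thesis by (smt (verit) power2_less_eq_zero_iff)
qed

lemma sum_inj_le:
  fixes g :: "'j::finite \<Rightarrow> real" and f :: "'i::finite \<Rightarrow> 'j"
  assumes "inj f"
  shows "(\<Sum>a\<in>UNIV. \<bar>g (f a)\<bar>) \<le> (\<Sum>j\<in>UNIV. \<bar>g j\<bar>)"
proof -
  have "(\<Sum>a\<in>UNIV. \<bar>g (f a)\<bar>) = (\<Sum>j\<in>range f. \<bar>g j\<bar>)"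
    using sum.reindex[OF assms, of "\<lambda>j. \<bar>g j\<bar>"] by simp
  also have "\<dots> \<le> (\<Sum>j\<in>UNIV. \<bar>g j\<bar>)" by (rule sum_mono2) auto
  finally show ?thesis .
qed

text \<open>Estimates one tensor slot filled with the derivative of a frame field: \<open>k\<close>
  are connection coefficients, \<open>e\<close> is the frame, and \<open>h\<close> inserts the
  summation index into a multi-index. Injectivity of \<open>h\<close> means that no component is
  counted twice.\<close>

lemma abs_linear_combination_le:
  fixes f :: "'b::real_vector \<Rightarrow> real" and g :: "'j::finite \<Rightarrow> real" and h :: "'i::finite \<Rightarrow> 'j"
  assumes f: "linear f" and h: "inj h" "\<And>a. f (e a) = g (h a)" and G: "G \<ge> 0" "\<And>a. \<bar>k a\<bar> \<le> G"
  shows "\<bar>f (\<Sum>a\<in>UNIV. k a *\<^sub>R e a)\<bar> \<le> G * (\<Sum>j\<in>UNIV. \<bar>g j\<bar>)"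
proof -
  have "\<bar>f (\<Sum>a\<in>UNIV. k a *\<^sub>R e a)\<bar> = \<bar>\<Sum>a\<in>UNIV. k a * g (h a)\<bar>"
    by (simp add: linear_sum[OF f] linear_scale[OF f] h)
  also have "\<dots> \<le> (\<Sum>a\<in>UNIV. \<bar>k a\<bar> * \<bar>g (h a)\<bar>)"
    by (rule order_trans[OF sum_abs]) (simp add: abs_mult)
  also have "\<dots> \<le> (\<Sum>a\<in>UNIV. G * \<bar>g (h a)\<bar>)" by (intro sum_mono mult_right_mono G) auto
  also have "\<dots> = G * (\<Sum>a\<in>UNIV. \<bar>g (h a)\<bar>)" by (simp add: sum_distrib_left)
  also have "\<dots> \<le> G * (\<Sum>j\<in>UNIV. \<bar>g j\<bar>)" by (intro mult_left_mono sum_inj_le h G)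
  finally show ?thesis .
qed

section \<open>Local and global vanishing of the Weyl tensor\<close>

context weyl_parallel
begin

lemma field_expand:
  assumes "c \<in> A" "q \<in> cdom c" "\<And>i. vf_coord A c (E i) (cmap c q) = axis i 1"
  shows "X q = (\<Sum>a\<in>UNIV. vf_coord A c X (cmap c q) $ a *\<^sub>R E a q)"
proof -
  have "X q = jac c (chart_at A q) q (vf_coord A c X (cmap c q))"
    using assms by (simp add: vf_coord_cmap jac_inverse chart_at)
  also have "\<dots> = (\<Sum>a\<in>UNIV. vf_coord A c X (cmap c q) $ a *\<^sub>R jac c (chart_at A q) q (axis a 1))"
    by (rule linear_axis_expand[OF linear_jac[OF assms(1) chart_at(1) assms(2) chart_at(2)]])
  finally show ?thesis by (simp add: frame_values[of c q E, OF assms])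
qed

lemma W_linear:
  "linear (\<lambda>x. W p x y z s)" "linear (\<lambda>y. W p x y z s)" "linear (\<lambda>z. W p x y z s)" "linear (\<lambda>s. W p x y z s)"
  using multilinear4_W[of p] by (simp_all add: multilinear4_def)

lemma W_zero_on_frame:
  assumes c: "c \<in> A" "q \<in> cdom c" "\<And>i. vf_coord A c (E i) (cmap c q) = axis i 1"
    and "\<And>i j k l. W q (E i q) (E j q) (E k q) (E l q) = 0"
  shows "W q x y z s = 0"
proof -
  have lin: "f v = 0" if "linear f" "\<And>a. f (E a q) = 0" for f :: "real ^ 'd \<Rightarrow> real" and v
  proof -
    have "v = (\<Sum>a\<in>UNIV. vf_coord A c (\<lambda>_. v) (cmap c q) $ a *\<^sub>R E a q)"
      using field_expand[of c q E "\<lambda>_. v", OF c] .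
    then have "f v = f (\<Sum>a\<in>UNIV. vf_coord A c (\<lambda>_. v) (cmap c q) $ a *\<^sub>R E a q)" by simp
    also have "\<dots> = 0" by (simp add: linear_sum[OF that(1)] linear_scale[OF that(1)] that(2))
    finally show ?thesis .
  qed
  have 1: "W q x (E j q) (E k q) (E l q) = 0" for x j k l by (rule lin[OF W_linear(1)]) (rule assms)
  have 2: "W q x y (E k q) (E l q) = 0" for x y k l by (rule lin[OF W_linear(2)]) (rule 1)
  have 3: "W q x y z (E l q) = 0" for x y z l by (rule lin[OF W_linear(3)]) (rule 2)
  show ?thesis by (rule lin[OF W_linear(4)]) (rule 3)
qed

text \<open>On the segment from \<open>p\<close> to a point of a coordinate ball, the frame
  components of the parallel tensor \<open>W\<close> obey a linear system. Its coefficients are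
  built from Christoffel symbols, bounded on the compact ball.\<close>

lemma weyl_zero_open:
  assumes zero: "\<And>x y z s. W p x y z s = 0"
  shows "\<exists>U. open U \<and> p \<in> U \<and> (\<forall>q\<in>U. \<forall>x y z s. W q x y z s = 0)"
proof -
  define c where "c = chart_at A p"
  have c: "c \<in> A" "p \<in> cdom c" using chart_at c_def by auto
  obtain r E where r: "r > 0" "cball (cmap c p) r \<subseteq> cimg c" and sE: "\<And>i. smooth_field (E i)"
    and E: "\<And>i x. x \<in> cball (cmap c p) r \<Longrightarrow> vf_coord A c (E i) x = axis i 1"
    using frame[OF c] by metis
  \<comment> \<open>Christoffel symbols of the frame: \<open>m\<close> is the direction,
    \<open>i\<close> the differentiated field, \<open>a\<close> the component.\<close>
  define \<Gamma> where "\<Gamma> = (\<lambda>(m, i, a) x. vf_coord A c (nabla (E m) (E i)) x $ a)"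
  have "\<exists>G. \<forall>x\<in>cball (cmap c p) r. \<bar>\<Gamma> I x\<bar> \<le> G" for I
  proof -
    obtain m i a where I: "I = (m, i, a)" by (cases I)
    have "continuous_on (cball (cmap c p) r) (\<Gamma> I)"
      unfolding \<Gamma>_def I prod.case
      by (rule smooth_on_continuous_on, rule smooth_on_subset[OF smooth_on_nth[OF open_cimg[OF c(1)] smooth_vfD[OF _ c(1)]] r(2)])
        (simp add: sE)
    then have "bounded (\<Gamma> I ` cball (cmap c p) r)"
      by (intro compact_imp_bounded compact_continuous_image) auto
    then show ?thesis unfolding bounded_iff by auto
  qed
  then obtain G0 where G0: "\<And>I x. x \<in> cball (cmap c p) r \<Longrightarrow> \<bar>\<Gamma> I x\<bar> \<le> G0 I" by metis
  define G where "G = (\<Sum>I\<in>UNIV. \<bar>G0 I\<bar>)"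
  have G: "\<bar>\<Gamma> I x\<bar> \<le> G" if "x \<in> cball (cmap c p) r" for I x
  proof -
    have "\<bar>\<Gamma> I x\<bar> \<le> \<bar>G0 I\<bar>" using G0[OF that, of I] by simp
    also have "\<dots> \<le> G" unfolding G_def by (rule member_le_sum) auto
    finally show ?thesis .
  qed
  have Gnn: "G \<ge> 0" unfolding G_def by (rule sum_nonneg) auto
  define wI where "wI = (\<lambda>(i, j, k, l) q. W q (E i q) (E j q) (E k q) (E l q))"
  have swI: "smooth_fun A (wI J)" for J by (cases J) (simp add: wI_def sE)
  have slot: "\<bar>X_deriv (E m) (wI J) q\<bar> \<le> 4 * G * (\<Sum>J\<in>UNIV. \<bar>wI J q\<bar>)"
    if q: "q \<in> cdom c" "cmap c q \<in> cball (cmap c p) r" for m J q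
  proof -
    obtain i j k l where J: "J = (i, j, k, l)" by (cases J)
    have fe: "nabla (E m) (E i) q = (\<Sum>a\<in>UNIV. \<Gamma> (m, i, a) (cmap c q) *\<^sub>R E a q)" for i
      unfolding \<Gamma>_def prod.case by (rule field_expand[OF c(1) q(1) E[OF q(2)]])
    let ?S = "G * (\<Sum>J\<in>UNIV. \<bar>wI J q\<bar>)"
    note b = abs_linear_combination_le[where g = "\<lambda>J. wI J q" and e = "\<lambda>a. E a q", OF _ _ _ Gnn G[OF q(2)]]
    have "\<bar>W q (nabla (E m) (E i) q) (E j q) (E k q) (E l q)\<bar> \<le> ?S"
      unfolding fe by (rule b[OF W_linear(1), where h = "\<lambda>a. (a, j, k, l)"]) (auto simp: inj_on_def wI_def)
    moreover have "\<bar>W q (E i q) (nabla (E m) (E j) q) (E k q) (E l q)\<bar> \<le> ?S"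
      unfolding fe by (rule b[OF W_linear(2), where h = "\<lambda>a. (i, a, k, l)"]) (auto simp: inj_on_def wI_def)
    moreover have "\<bar>W q (E i q) (E j q) (nabla (E m) (E k) q) (E l q)\<bar> \<le> ?S"
      unfolding fe by (rule b[OF W_linear(3), where h = "\<lambda>a. (i, j, a, l)"]) (auto simp: inj_on_def wI_def)
    moreover have "\<bar>W q (E i q) (E j q) (E k q) (nabla (E m) (E l) q)\<bar> \<le> ?S"
      unfolding fe by (rule b[OF W_linear(4), where h = "\<lambda>a. (i, j, k, a)"]) (auto simp: inj_on_def wI_def)
    moreover have "X_deriv (E m) (wI J) q = W q (nabla (E m) (E i) q) (E j q) (E k q) (E l q) +
        W q (E i q) (nabla (E m) (E j) q) (E k q) (E l q) + W q (E i q) (E j q) (nabla (E m) (E k) q) (E l q) +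
        W q (E i q) (E j q) (E k q) (nabla (E m) (E l) q)"
      unfolding J wI_def prod.case by (simp add: vf_deriv_W sE)
    ultimately show ?thesis by linarith
  qed
  have vanish: "wI J (cinv c y) = 0" if y: "y \<in> ball (cmap c p) r" for J y
  proof -
    define v where "v = y - cmap c p"
    have nv: "norm v < r" using y by (simp add: v_def dist_norm norm_minus_commute)
    define u where "u t = cmap c p + t *\<^sub>R v" for t
    have u: "u t \<in> cball (cmap c p) r" if "0 \<le> t" "t \<le> 1" for t
    proof -
      have "\<bar>t\<bar> * norm v \<le> 1 * norm v" using that by (intro mult_right_mono) auto
      then show ?thesis using nv by (simp add: u_def dist_norm)
    qed
    define D where "D J x = frechet_derivative (\<lambda>x. wI J (cinv c x)) (at x)" for J x
    have D: "((\<lambda>x. wI J (cinv c x)) has_derivative D J x) (at x)" if "x \<in> cball (cmap c p) r" for J x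
      unfolding D_def using smooth_on_has_derivative[OF smooth_funD[OF swI c(1)]] r that by blast
    \<comment> \<open>In the constant \<open>B\<close>, \<open>r\<close> bounds each component of
      the direction \<open>v\<close>, \<open>CARD('d)\<close> counts these components, and
      \<open>4 * G\<close> comes from the four slots in \<open>slot\<close>.\<close>
    have "wI J (cinv c (u 1)) = 0"
    proof (rule gronwall_zero[where w = "\<lambda>J t. wI J (cinv c (u t))" and w' = "\<lambda>J t. D J (u t) v"
          and B = "real CARD('d) * r * (4 * G)"])
      fix J and t :: real assume t: "0 \<le> t" "t \<le> 1"
      have "(u has_derivative (\<lambda>h. h *\<^sub>R v)) (at t)"
        unfolding u_def by (auto intro!: derivative_eq_intros)
      from has_derivative_compose[OF this D[OF u[OF t]]]
      have "((\<lambda>t. wI J (cinv c (u t))) has_derivative (\<lambda>h. D J (u t) (h *\<^sub>R v))) (at t)" .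
      then show "((\<lambda>t. wI J (cinv c (u t))) has_real_derivative D J (u t) v) (at t)"
        unfolding has_field_derivative_def
        by (rule has_derivative_eq_rhs)
          (simp add: fun_eq_iff linear_scale[OF has_derivative_linear[OF D[OF u[OF t]]]])
      let ?q = "cinv c (u t)" and ?S = "\<Sum>J\<in>UNIV. \<bar>wI J (cinv c (u t))\<bar>"
      have uc: "u t \<in> cimg c" using u[OF t] r by blast
      have q: "?q \<in> cdom c" "cmap c ?q = u t" using uc c by auto
      have "D J (u t) (axis m 1) = X_deriv (E m) (wI J) ?q" for m
        using vf_deriv_chart[OF swI c(1) q(1), of "E m" J] E[OF u[OF t]] by (simp add: q D_def)
      then have "D J (u t) v = (\<Sum>m\<in>UNIV. v $ m * X_deriv (E m) (wI J) ?q)"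
        by (subst linear_axis_expand[OF has_derivative_linear[OF D[OF u[OF t]]]]) simp
      also have "\<bar>\<dots>\<bar> \<le> (\<Sum>m\<in>UNIV. \<bar>v $ m\<bar> * \<bar>X_deriv (E m) (wI J) ?q\<bar>)"
        by (rule order_trans[OF sum_abs]) (simp add: abs_mult)
      also have "\<dots> \<le> (\<Sum>m\<in>(UNIV :: 'd set). r * (4 * G * ?S))"
      proof (intro sum_mono mult_mono)
        show "\<bar>v $ m\<bar> \<le> r" for m using component_le_norm_cart[of v m] nv by linarith
        show "\<bar>X_deriv (E m) (wI J) ?q\<bar> \<le> 4 * G * ?S" for m
          using slot[OF q(1), of m J] u[OF t] unfolding q(2) by blast
      qed (use r in auto)
      finally show "\<bar>D J (u t) v\<bar> \<le> real CARD('d) * r * (4 * G) * ?S" by (simp add: mult_ac)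
    next
      show "0 \<le> real CARD('d) * r * (4 * G)" using r Gnn by simp
      show "wI J (cinv c (u 0)) = 0" for J using c zero by (cases J) (simp add: u_def wI_def)
    qed
    then show ?thesis by (simp add: u_def v_def)
  qed
  have "W q x y z s = 0" if q: "q \<in> cinv c ` ball (cmap c p) r" for q x y z s
  proof -
    obtain u where u: "u \<in> ball (cmap c p) r" "q = cinv c u" using q by blast
    have uc: "u \<in> cball (cmap c p) r" "u \<in> cimg c" using u r by auto
    show ?thesis
    proof (rule W_zero_on_frame[OF c(1)])
      show "q \<in> cdom c" using u uc c by auto
      show "vf_coord A c (E i) (cmap c q) = axis i 1" for i using E uc c u by simp
      show "W q (E i q) (E j q) (E k q) (E l q) = 0" for i j k l
        using vanish[OF u(1), of "(i, j, k, l)"] u by (simp add: wI_def)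
    qed
  qed
  moreover have "open (cinv c ` ball (cmap c p) r)"
    using open_cinv_image[OF c(1) open_ball] r(2) by (meson ball_subset_cball subset_trans)
  moreover have "p \<in> cinv c ` ball (cmap c p) r" using c r by (auto intro!: image_eqI[of _ _ "cmap c p"])
  ultimately show ?thesis by (intro exI[of _ "cinv c ` ball (cmap c p) r"]) simp
qed

text \<open>Smoothness is known for \<open>W\<close> on smooth fields, not on vectors with constant
  components, so the witnesses are extended to fields before continuity is used.\<close>

lemma weyl_nonzero_open:
  assumes "W p x y z s \<noteq> 0"
  shows "\<exists>U. open U \<and> p \<in> U \<and> (\<forall>q\<in>U. \<exists>x y z s. W q x y z s \<noteq> 0)"
proof -
  define c where "c = chart_at A p"
  have c: "c \<in> A" "p \<in> cdom c" using chart_at c_def by auto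
  let ?f = "\<lambda>q. W q (vf_ext A p x q) (vf_ext A p y q) (vf_ext A p z q) (vf_ext A p s q)"
  let ?T = "cimg c \<inter> (\<lambda>u. ?f (cinv c u)) -` (- {0})"
  have "continuous_on (cimg c) (\<lambda>u. ?f (cinv c u))"
    by (rule smooth_on_continuous_on[OF smooth_funD[OF _ c(1)]]) simp
  then have "open ?T" using continuous_open_preimage open_cimg[OF c(1)] by blast
  then have "open (cinv c ` ?T)" using open_cinv_image[OF c(1)] by blast
  moreover have "p \<in> cinv c ` ?T" using c assms by (intro image_eqI[of _ _ "cmap c p"]) auto
  ultimately show ?thesis by (intro exI[of _ "cinv c ` ?T"]) auto
qed

lemma weyl_zero_everywhere:
  assumes "\<And>x y z s. W p x y z s = 0"
  shows "W q x y z s = 0"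
proof (rule ccontr)
  assume nz: "W q x y z s \<noteq> 0"
  let ?Z = "{q. \<forall>x y z s. W q x y z s = 0}"
  have "open ?Z"
  proof (rule Topological_Spaces.openI)
    fix q assume "q \<in> ?Z"
    then obtain U where "open U" "q \<in> U" "\<forall>q\<in>U. \<forall>x y z s. W q x y z s = 0"
      using weyl_zero_open[of q] by auto
    then show "\<exists>T. open T \<and> q \<in> T \<and> T \<subseteq> ?Z" by (intro exI[of _ U]) auto
  qed
  moreover have "open (- ?Z)"
  proof (rule Topological_Spaces.openI)
    fix q assume "q \<in> - ?Z"
    then obtain x y z s where "W q x y z s \<noteq> 0" by auto
    then obtain U where "open U" "q \<in> U" "\<forall>q\<in>U. \<exists>x y z s. W q x y z s \<noteq> 0"
      using weyl_nonzero_open[of q x y z s] by auto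
    then show "\<exists>T. open T \<and> q \<in> T \<and> T \<subseteq> - ?Z" by (intro exI[of _ U]) auto
  qed
  moreover have "connected (UNIV :: 'm set)" using fed by (simp add: fedosov_manifold_def)
  ultimately have "?Z \<inter> UNIV = {} \<or> - ?Z \<inter> UNIV = {}" by (intro connectedD) auto
  then show False using assms nz by blast
qed

subsection \<open>Dimension two\<close>

text \<open>On a plane a skew pair of arguments enters only through \<omega>(x, y), so the curvature
  is \<omega>(x, y) \<rho>(z, s) with \<rho> symmetric, and Ricci equals \<rho>. The planar identity
  \<omega>(x, y) u + \<omega>(y, u) x + \<omega>(u, x) y = 0 explains why the Kulkarni--Nomizu
  product is 4 \<omega>(x, y) \<rho>(z, s), which matches \<kappa> = 1/4.\<close>

lemma weyl_zero_dim2: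
  assumes "n = 1"
  shows "W p x y z s = 0"
proof -
  obtain a b where ab: "\<omega> p a b = 1"
  proof -
    have "axis undefined 1 \<noteq> (0 :: real ^ 'd)" by (simp add: axis_eq_0_iff)
    then show ?thesis using symp.dual_vector that by blast
  qed
  have ba: "\<omega> p b a = -1" using ab symp.w_skew by metis
  have full: "span {a, b} = UNIV"
  proof -
    have ne: "a \<noteq> b" using ab by auto
    have "independent {a, b}"
    proof -
      have "a \<notin> span {b}"
      proof
        assume "a \<in> span {b}"
        then obtain k where "a = k *\<^sub>R b" by (auto simp: span_singleton)
        then show False using ab by (simp add: omega_simps)
      qed
      moreover have "b \<noteq> 0" using ab omega_simps(6)[of p a 0 b] by auto
      ultimately show ?thesis by (simp add: independent_insert)
    qed
    then have "dim (span {a, b}) = 2" using ne by (simp add: dim_eq_card_independent dim_span)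
    then show ?thesis using dim assms dim_eq_full[of "{a, b}"] by (simp add: dim_span)
  qed
  have exp: "\<exists>k l. v = k *\<^sub>R a + l *\<^sub>R b" for v
  proof -
    have "v \<in> span {a, b}" using full by simp
    then obtain k where "v - k *\<^sub>R a \<in> span {b}" using span_breakdown_eq[of v a "{b}"] by blast
    then obtain l where "v - k *\<^sub>R a = l *\<^sub>R b" by (auto simp: span_singleton)
    then have "v = k *\<^sub>R a + l *\<^sub>R b" by (simp add: algebra_simps)
    then show ?thesis by blast
  qed
  have Rt0: "Rt p x y z = \<omega> p x y *\<^sub>R Rt p a b z" for x y z
  proof -
    obtain x1 x2 where x: "x = x1 *\<^sub>R a + x2 *\<^sub>R b" using exp by blast
    obtain y1 y2 where y: "y = y1 *\<^sub>R a + y2 *\<^sub>R b" using exp by blast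
    have sk: "Rt p u v z = - Rt p v u z" for u v unfolding Rt_def by (rule R_skew) auto
    have self: "Rt p u u z = 0" for u
    proof -
      have "2 *\<^sub>R Rt p u u z = 0" using sk[of u u] by (simp only: scaleR_2) (metis add.left_inverse)
      then show ?thesis by simp
    qed
    show ?thesis
      unfolding x y
      by (simp add: linear_add[OF linear_Rt1] linear_add[OF linear_Rt2] linear_scale[OF linear_Rt1]
          linear_scale[OF linear_Rt2] self sk[of b a] omega_simps ab ba algebra_simps)
  qed
  define \<rho> where "\<rho> z s = \<omega> p (Rt p a b z) s" for z s
  have Cr: "C p x y z s = \<omega> p x y * \<rho> z s" for x y z s
    by (simp add: curvature_tensor_eq Rt0[of x y] omega_simps \<rho>_def)
  have \<rho>sym: "\<rho> z s = \<rho> s z" for z s using C_sym[of p a b z s] by (simp add: Cr ab)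
  have Ricr: "Ric p y z = \<rho> z y" for y z
  proof -
    have "linear (\<lambda>v. \<omega> p v y)" using symp.w_bilinear by (simp add: bilinear_def)
    \<comment> \<open>The factor \<open>\<omega> p (axis i 1) y\<close> supplied by
      \<open>Rt0\<close> turns the Ricci trace into this expansion of
      \<open>Rt p a b z\<close>.\<close>
    then have "\<omega> p (Rt p a b z) y = (\<Sum>i\<in>UNIV. Rt p a b z $ i *\<^sub>R \<omega> p (axis i 1) y)"
      by (rule linear_axis_expand)
    then show ?thesis by (simp add: Ric_trace \<rho>_def mult.commute Rt0[of "axis _ 1" y])
  qed
  have lin: "\<rho> (k *\<^sub>R u + l *\<^sub>R v) s = k * \<rho> u s + l * \<rho> v s" "\<rho> s (k *\<^sub>R u + l *\<^sub>R v) = k * \<rho> s u + l * \<rho> s v" for k l u v s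
    by (simp_all add: \<rho>_def linear_add[OF linear_Rt3] linear_scale[OF linear_Rt3] omega_simps)
  obtain x1 x2 where x: "x = x1 *\<^sub>R a + x2 *\<^sub>R b" using exp by blast
  obtain y1 y2 where y: "y = y1 *\<^sub>R a + y2 *\<^sub>R b" using exp by blast
  obtain z1 z2 where z: "z = z1 *\<^sub>R a + z2 *\<^sub>R b" using exp by blast
  obtain s1 s2 where s: "s = s1 *\<^sub>R a + s2 *\<^sub>R b" using exp by blast
  have k: "\<kappa> = 1 / 4" unfolding \<kappa>_def using assms by simp
  show ?thesis
    unfolding W_eq Cr kulkarni_nomizu_def Ricr k x y z s
    by (simp add: lin omega_simps ab ba \<rho>sym[of b a] algebra_simps)
qed

end

theorem theorem1:
  fixes A :: "('m::{t2_space, second_countable_topology}, 'd::finite) chart set"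
    and \<omega> :: "'m \<Rightarrow> real ^ 'd \<Rightarrow> real ^ 'd \<Rightarrow> real"
    and nabla :: "('m \<Rightarrow> real ^ 'd) \<Rightarrow> ('m \<Rightarrow> real ^ 'd) \<Rightarrow> ('m \<Rightarrow> real ^ 'd)"
    and n :: nat
  assumes "fedosov_manifold A \<omega> nabla"
    and "CARD('d) = 2 * n"
    and "parallel4 A nabla (weyl_tensor n A \<omega> nabla)"
  shows "parallel4 A nabla (curvature_tensor A \<omega> nabla) \<or>
    (\<forall>p x y z s. weyl_tensor n A \<omega> nabla p x y z s = 0)"
proof -
  interpret weyl_parallel A \<omega> nabla n
    using assms by unfold_locales
  consider "n = 1" | "n \<ge> 2"
  proof -
    \<comment> \<open>A finite index type has an element, so the dimension is positive.\<close>
    have "n \<noteq> 0" using dim by (metis mult_0_right zero_less_card_finite less_numeral_extra(3))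
    then show ?thesis using that by linarith
  qed
  then show ?thesis
  proof cases
    case 1
    then show ?thesis using weyl_zero_dim2 by blast
  next
    case 2
    show ?thesis
    proof (cases "\<exists>p. \<forall>x y z s. W p x y z s = 0")
      case True
      then show ?thesis using weyl_zero_everywhere by blast
    next
      case False
      then have "T p v y z = 0" for p v y z
        using ricci_parallel_or_weyl_zero[OF 2, of p] by blast
      then show ?thesis using parallel_curvature by blast
    qed
  qed
qed

end
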